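(* Let $S$ be a closed orientable hyperbolic surface and $f\in\mathrm{Homeo}_0(S)$. The set $S_T$ of points of $S$ that admit a tracking geodesic is a Borel set, and it has full measure for every $\mu\in\mathcal{M}^{\mathrm{erg}}_{\vartheta>0}(f)$. Furthermore, there exists a Borel mapping $x\mapsto\gamma_x$ assigning to each $x\in S_T$ its normalized tracking geodesic $\gamma_x:\mathbb{R}\to S$.
   Context: $S$ is a closed orientable surface of genus $\ge 2$ with a hyperbolic metric; $\widetilde S\simeq\mathbb{H}^2$ is its universal cover with lifted distance $\widetilde{\mathrm{dist}}$ and $\Gamma$ the group of deck transformations. $\mathrm{Homeo}_0(S)$ is the set of homeomorphisms of $S$ isotopic to the identity; each $f\in\mathrm{Homeo}_0(S)$ has a unique lift $\widetilde f$ to $\widetilde S$ commuting with all elements of $\Gamma$. Rotation speed: for $x\in S$ and $n\in\mathbb{N}$ let $L_n(x)=\widetilde{\mathrm{dist}}(\widetilde x,\widetilde f^n(\widetilde x))$ for any lift $\widetilde x$ of $x$. The rotation speed $\vartheta(x)$ is the common value of $\lim_{n\to+\infty}\frac1nL_n(x)$ and $\lim_{n\to+\infty}\frac1nL_n(f^{-n}(x))$ if both limits exist and coincide. For every ergodic $f$-invariant Borel probability measure $\mu$, $\vartheta$ is $\mu$-a.e. equal to a constant $\vartheta_\mu$; $\mathcal{M}^{\mathrm{erg}}_{\vartheta>0}(f)$ is the set of ergodic $f$-invariant Borel probability measures with $\vartheta_\mu>0$. A geodesic is a local isometry $\gamma:\mathbb{R}\to S$; the space of geodesics is identified with the unit tangent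 bundle $\mathrm{T}^1S$ via $\gamma\mapsto\dot\gamma(0)$ (this gives its topology). A point $x$ admits a tracking geodesic $\gamma$ if $\vartheta(x)>0$ and for each lift $\widetilde x$ of $x$ there is a lift $\widetilde\gamma$ of $\gamma$ with $$\lim_{n\to+\infty}\tfrac1n\widetilde{\mathrm{dist}}\big(\widetilde f^n(\widetilde x),\widetilde\gamma(n\vartheta(x))\big)=\lim_{n\to+\infty}\tfrac1n\widetilde{\mathrm{dist}}\big(\widetilde f^{-n}(\widetilde x),\widetilde\gamma(-n\vartheta(x))\big)=0.$$ It is normalized if there are lifts $\widetilde x,\widetilde\gamma$ satisfying these limits with $\widetilde{\mathrm{dist}}(\widetilde x,\widetilde\gamma(0))=\widetilde{\mathrm{dist}}(\widetilde x,\widetilde\gamma(\mathbb{R}))$; each point admitting a tracking geodesic admits a unique normalized one. *)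

theory Defs
  imports "HOL-Probability.Probability"
begin

section \<open>The hyperbolic plane\<close>

text \<open>The upper half-plane with the metric \<open>|dz| / Im z\<close> of curvature \<open>-1\<close>. The topology induced by
  \<open>hdist\<close> is the subspace topology of the complex plane, so continuity on \<open>hplane\<close> is the usual one.\<close>

definition hplane :: "complex set"
  where "hplane = {z. Im z > 0}"

definition hdist :: "complex \<Rightarrow> complex \<Rightarrow> real"
  where "hdist z w = arcosh (1 + (cmod (z - w))\<^sup>2 / (2 * Im z * Im w))"

text \<open>The orientation-preserving isometries of the upper half-plane are the real Moebius
  transformations of determinant 1.\<close>

definition orientation_preserving_isometry :: "(complex \<Rightarrow> complex) \<Rightarrow> bool"
  where "orientation_preserving_isometry g \<longleftrightarrow>
    (\<exists>a b c d :: real. a * d - b * c = 1 \<and>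
       (\<forall>z\<in>hplane. g z = moebius (of_real a) (of_real b) (of_real c) (of_real d) z))"

text \<open>Unit vectors of the metric \<open>|dz| / Im z\<close>: a tangent vector \<open>v\<close> at \<open>z\<close> has length \<open>|v| / Im z\<close>.\<close>

definition unit_tangent_hplane :: "(complex \<times> complex) set"
  where "unit_tangent_hplane = {(z, v). z \<in> hplane \<and> cmod v = Im z}"


section \<open>Closed orientable hyperbolic surfaces\<close>

definition deck_group :: "(complex \<Rightarrow> 'a) \<Rightarrow> (complex \<Rightarrow> complex) set"
  where "deck_group p =
    {g. (\<exists>g'. homeomorphism hplane hplane g g') \<and> (\<forall>z\<in>hplane. p (g z) = p z)}"

text \<open>A closed orientable hyperbolic surface \<open>S\<close>, given together with its universal covering \<open>p\<close> by the
  hyperbolic plane. The distance of the ambient type restricts on \<open>S\<close> to the hyperbolic (path) metric,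
  i.e. to the quotient of \<open>hdist\<close>. Orientability says that the deck transformations preserve
  the orientation of the hyperbolic plane. Connectedness follows from the existence of \<open>p\<close>, and
  genus at least 2 from the Gauss-Bonnet theorem.\<close>

definition closed_orientable_hyperbolic_surface ::
    "'a::metric_space set \<Rightarrow> (complex \<Rightarrow> 'a) \<Rightarrow> bool"
  where "closed_orientable_hyperbolic_surface S p \<longleftrightarrow>
    compact S \<and>
    covering_space hplane p S \<and>
    (\<forall>z\<in>hplane. \<forall>w\<in>hplane. dist (p z) (p w) = (INF w'\<in>{w'\<in>hplane. p w' = p w}. hdist z w')) \<and>
    (\<forall>g\<in>deck_group p. orientation_preserving_isometry g)"


section \<open>Homeomorphisms isotopic to the identity and their canonical lifts\<close>

definition Homeo\<^sub>0 :: "'a::metric_space set \<Rightarrow> ('a \<Rightarrow> 'a) set"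
  where "Homeo\<^sub>0 S =
    {f. homotopic_with (\<lambda>g. \<exists>g'. homeomorphism S S g g') (top_of_set S) (top_of_set S) id f}"

text \<open>The unique lift commuting with the deck group. Membership in the extensional function space
  \<open>hplane \<rightarrow>\<^sub>E hplane\<close> only fixes the irrelevant values outside \<open>hplane\<close>, so that the
  definite description denotes.\<close>

definition canonical_lift :: "(complex \<Rightarrow> 'a) \<Rightarrow> ('a \<Rightarrow> 'a) \<Rightarrow> complex \<Rightarrow> complex"
  where "canonical_lift p f =
    (THE F. F \<in> hplane \<rightarrow>\<^sub>E hplane \<and> continuous_on hplane F \<and>
       (\<forall>z\<in>hplane. p (F z) = f (p z)) \<and>
       (\<forall>g\<in>deck_group p. \<forall>z\<in>hplane. F (g z) = g (F z)))"


section \<open>Rotation speed\<close>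

text \<open>The value does not depend on the chosen lift \<open>inv_into hplane p x\<close> of \<open>x\<close>, since the canonical
  lift commutes with the deck transformations, which are isometries.\<close>

definition displacement :: "(complex \<Rightarrow> 'a) \<Rightarrow> ('a \<Rightarrow> 'a) \<Rightarrow> nat \<Rightarrow> 'a \<Rightarrow> real"
  where "displacement p f n x =
    (let z = inv_into hplane p x in hdist z ((canonical_lift p f ^^ n) z))"

definition has_rotation_speed ::
    "'a set \<Rightarrow> (complex \<Rightarrow> 'a) \<Rightarrow> ('a \<Rightarrow> 'a) \<Rightarrow> 'a \<Rightarrow> real \<Rightarrow> bool"
  where "has_rotation_speed S p f x v \<longleftrightarrow>
    (\<lambda>n. displacement p f n x / real n) \<longlonglongrightarrow> v \<and>
    (\<lambda>n. displacement p f n ((inv_into S f ^^ n) x) / real n) \<longlonglongrightarrow> v"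


section \<open>Ergodic measures of positive rotation speed\<close>

definition ergodic_measures :: "'a::metric_space set \<Rightarrow> ('a \<Rightarrow> 'a) \<Rightarrow> 'a measure set"
  where "ergodic_measures S f =
    {\<mu>. sets \<mu> = sets (restrict_space borel S) \<and> prob_space \<mu> \<and> distr \<mu> \<mu> f = \<mu> \<and>
        (\<forall>A\<in>sets \<mu>. f -` A \<inter> S = A \<longrightarrow> emeasure \<mu> A = 0 \<or> emeasure \<mu> A = 1)}"

definition ergodic_measures_pos ::
    "'a::metric_space set \<Rightarrow> (complex \<Rightarrow> 'a) \<Rightarrow> ('a \<Rightarrow> 'a) \<Rightarrow> 'a measure set"
  where "ergodic_measures_pos S p f =
    {\<mu> \<in> ergodic_measures S f. \<exists>v>0. AE x in \<mu>. has_rotation_speed S p f x v}"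


section \<open>The space of geodesics\<close>

definition geodesics :: "'a::metric_space set \<Rightarrow> (real \<Rightarrow> 'a) set"
  where "geodesics S =
    {\<gamma>. range \<gamma> \<subseteq> S \<and>
        (\<forall>t. \<exists>e>0. \<forall>s\<in>ball t e. \<forall>u\<in>ball t e. dist (\<gamma> s) (\<gamma> u) = \<bar>s - u\<bar>)}"

definition is_path_lift :: "(complex \<Rightarrow> 'a) \<Rightarrow> (real \<Rightarrow> 'a) \<Rightarrow> (real \<Rightarrow> complex) \<Rightarrow> bool"
  where "is_path_lift p \<gamma> c \<longleftrightarrow>
    continuous_on UNIV c \<and> range c \<subseteq> hplane \<and> (\<forall>t. p (c t) = \<gamma> t)"

text \<open>A unit tangent vector of \<open>S\<close> is an orbit of the deck group acting on the unit tangent bundle of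
  the hyperbolic plane by differentials; the deck transformations are holomorphic, so the
  differential of \<open>g\<close> at \<open>z\<close> is multiplication by \<open>deriv g z\<close>.\<close>

definition tangent_proj :: "(complex \<Rightarrow> 'a) \<Rightarrow> complex \<times> complex \<Rightarrow> (complex \<times> complex) set"
  where "tangent_proj p = (\<lambda>(z, v). {(g z, deriv g z * v) | g. g \<in> deck_group p})"

text \<open>The quotient topology on the unit tangent bundle of \<open>S\<close>.\<close>

definition unit_tangent_topology ::
    "(complex \<Rightarrow> 'a) \<Rightarrow> (complex \<times> complex) set topology"
  where "unit_tangent_topology p = topology (\<lambda>U.
    U \<subseteq> tangent_proj p ` unit_tangent_hplane \<and>
    openin (top_of_set unit_tangent_hplane) (unit_tangent_hplane \<inter> tangent_proj p -` U))"

lemma openin_unit_tangent_topology: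
  "openin (unit_tangent_topology p) U \<longleftrightarrow>
    U \<subseteq> tangent_proj p ` unit_tangent_hplane \<and>
    openin (top_of_set unit_tangent_hplane) (unit_tangent_hplane \<inter> tangent_proj p -` U)"
proof -
  let ?T = unit_tangent_hplane and ?q = "tangent_proj p"
  have "istopology (\<lambda>U. U \<subseteq> ?q ` ?T \<and> openin (top_of_set ?T) (?T \<inter> ?q -` U))"
    unfolding istopology_def
  proof (intro conjI allI impI)
    fix U V assume "U \<subseteq> ?q ` ?T \<and> openin (top_of_set ?T) (?T \<inter> ?q -` U)"
      "V \<subseteq> ?q ` ?T \<and> openin (top_of_set ?T) (?T \<inter> ?q -` V)"
    moreover have "?T \<inter> ?q -` (U \<inter> V) = (?T \<inter> ?q -` U) \<inter> (?T \<inter> ?q -` V)" by auto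
    ultimately show "U \<inter> V \<subseteq> ?q ` ?T" "openin (top_of_set ?T) (?T \<inter> ?q -` (U \<inter> V))"
      by (blast, simp add: openin_Int)
  next
    fix K assume K: "\<forall>U\<in>K. U \<subseteq> ?q ` ?T \<and> openin (top_of_set ?T) (?T \<inter> ?q -` U)"
    have "openin (top_of_set ?T) (\<Union>U\<in>K. ?T \<inter> ?q -` U)" using K by blast
    moreover have "(\<Union>U\<in>K. ?T \<inter> ?q -` U) = ?T \<inter> ?q -` (\<Union>K)" by auto
    ultimately show "openin (top_of_set ?T) (?T \<inter> ?q -` (\<Union>K))" by metis
    show "\<Union>K \<subseteq> ?q ` ?T" using K by blast
  qed
  then show ?thesis
    unfolding unit_tangent_topology_def by (simp add: topology_inverse')
qed

text \<open>The vector \<open>\<gamma>'(0)\<close>. The lifts of \<open>\<gamma>\<close> are permuted transitively by the deck group, so their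
  initial velocities form exactly one orbit.\<close>

definition initial_velocity :: "(complex \<Rightarrow> 'a) \<Rightarrow> (real \<Rightarrow> 'a) \<Rightarrow> (complex \<times> complex) set"
  where "initial_velocity p \<gamma> = {(c 0, vector_derivative c (at 0)) | c. is_path_lift p \<gamma> c}"

definition geodesic_topology ::
    "'a::metric_space set \<Rightarrow> (complex \<Rightarrow> 'a) \<Rightarrow> (real \<Rightarrow> 'a) topology"
  where "geodesic_topology S p =
    pullback_topology (geodesics S) (initial_velocity p) (unit_tangent_topology p)"

definition geodesic_borel ::
    "'a::metric_space set \<Rightarrow> (complex \<Rightarrow> 'a) \<Rightarrow> (real \<Rightarrow> 'a) measure"
  where "geodesic_borel S p = sigma (geodesics S) {U. openin (geodesic_topology S p) U}"


section \<open>Tracking geodesics\<close>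

definition tracks ::
    "(complex \<Rightarrow> 'a) \<Rightarrow> ('a \<Rightarrow> 'a) \<Rightarrow> real \<Rightarrow> complex \<Rightarrow> (real \<Rightarrow> complex) \<Rightarrow> bool"
  where "tracks p f v z c \<longleftrightarrow>
    (let F = canonical_lift p f in
      (\<lambda>n. hdist ((F ^^ n) z) (c (real n * v)) / real n) \<longlonglongrightarrow> 0 \<and>
      (\<lambda>n. hdist ((inv_into hplane F ^^ n) z) (c (- real n * v)) / real n) \<longlonglongrightarrow> 0)"

definition tracking_geodesic ::
    "'a::metric_space set \<Rightarrow> (complex \<Rightarrow> 'a) \<Rightarrow> ('a \<Rightarrow> 'a) \<Rightarrow> 'a \<Rightarrow> (real \<Rightarrow> 'a) \<Rightarrow> bool"
  where "tracking_geodesic S p f x \<gamma> \<longleftrightarrow>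
    \<gamma> \<in> geodesics S \<and>
    (\<exists>v>0. has_rotation_speed S p f x v \<and>
       (\<forall>z\<in>hplane. p z = x \<longrightarrow> (\<exists>c. is_path_lift p \<gamma> c \<and> tracks p f v z c)))"

definition normalized_tracking_geodesic ::
    "'a::metric_space set \<Rightarrow> (complex \<Rightarrow> 'a) \<Rightarrow> ('a \<Rightarrow> 'a) \<Rightarrow> 'a \<Rightarrow> (real \<Rightarrow> 'a) \<Rightarrow> bool"
  where "normalized_tracking_geodesic S p f x \<gamma> \<longleftrightarrow>
    tracking_geodesic S p f x \<gamma> \<and>
    (\<exists>v z c. has_rotation_speed S p f x v \<and> z \<in> hplane \<and> p z = x \<and>
       is_path_lift p \<gamma> c \<and> tracks p f v z c \<and>
       hdist z (c 0) = (INF t. hdist z (c t)))"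

definition tracked_points ::
    "'a::metric_space set \<Rightarrow> (complex \<Rightarrow> 'a) \<Rightarrow> ('a \<Rightarrow> 'a) \<Rightarrow> 'a set"
  where "tracked_points S p f = {x \<in> S. \<exists>\<gamma>. tracking_geodesic S p f x \<gamma>}"

end

theory Submission
  imports Defs
begin

text \<open>In the hyperboloid model, the orbit \<open>x\<^sub>n\<close> of a lift under the canonical lift has bounded steps and
  escapes at speed \<open>v > 0\<close>; hence the rescaled points \<open>x\<^sub>n / cosh (dist x\<^sub>0 x\<^sub>n)\<close> converge
  exponentially fast to a null vector, and the orbit sublinearly tracks every geodesic ending there.
  So a point of positive rotation speed is tracked by a geodesic iff its forward and backward null
  vectors differ, and otherwise the distance of \<open>x\<^sub>-\<^sub>n\<close> and \<open>x\<^sub>n\<close> is \<open>o(n)\<close>. The latter is excluded almost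
  everywhere by dominated convergence, because this distance has the same integral as the
  displacement under the \<open>2n\<close>-th iterate. The null vectors are limits of continuous functions, hence
  Borel, and so is the normalized geodesic, which depends continuously on them.\<close>

section \<open>The hyperboloid model\<close>

text \<open>The quantitative core is the polarization identity
  \<open>2 * mink P Q = mink P P + mink Q Q - mink (P - Q) (P - Q)\<close>. Rescaled points have
  equal height over the base point, so their differences are orthogonal to a timelike vector, and
  there the form is definite. An error of order exp (- v n) in the vectors thus costs only exp (- 2
  v n) in their product. This balances the factor exp (2 v n) produced by the distances up to exp of
  a small multiple of n; convergence without a rate would not yield tracking. Orbits live in the
  half-plane but measures live on \<open>S\<close>, and the lift picked by \<open>inv_into\<close>
  carries no measurability. Hence sets are tested on their preimages in the half-plane and brought
  down by local inverses of \<open>p\<close>. The canonical lift is a definite description, so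
  nothing can be said about it before its uniqueness. Two equivariant lifts differ by a central deck
  transformation; its displacement is invariant, hence bounded because \<open>S\<close> is compact,
  and a real Moebius map of bounded displacement is the identity.\<close>

definition mink :: "real \<times> complex \<Rightarrow> real \<times> complex \<Rightarrow> real"
  where "mink V W = fst V * fst W - snd V \<bullet> snd W"

lemma mink_commute: "mink V W = mink W V"
  by (simp add: mink_def inner_commute mult.commute)

lemma mink_add_left: "mink (U + V) W = mink U W + mink V W"
  and mink_diff_left: "mink (U - V) W = mink U W - mink V W"
  and mink_scaleR_left: "mink (r *\<^sub>R U) W = r * mink U W"
  by (simp_all add: mink_def inner_add_left inner_diff_left algebra_simps)

lemma mink_add_right: "mink W (U + V) = mink W U + mink W V"
  and mink_diff_right: "mink W (U - V) = mink W U - mink W V"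
  and mink_scaleR_right: "mink W (r *\<^sub>R U) = r * mink W U"
  by (simp_all add: mink_def inner_add_right inner_diff_right algebra_simps)

lemmas mink_simps = mink_add_left mink_diff_left mink_scaleR_left
  mink_add_right mink_diff_right mink_scaleR_right

lemma tendsto_mink [tendsto_intros]:
  "(f \<longlongrightarrow> V) F \<Longrightarrow> (g \<longlongrightarrow> W) F \<Longrightarrow> ((\<lambda>x. mink (f x) (g x)) \<longlongrightarrow> mink V W) F"
  unfolding mink_def by (intro tendsto_intros)

lemma continuous_on_mink [continuous_intros]:
  "continuous_on A f \<Longrightarrow> continuous_on A g \<Longrightarrow> continuous_on A (\<lambda>x. mink (f x) (g x))"
  unfolding mink_def by (intro continuous_intros)

lemma borel_measurable_mink [measurable]:
  assumes [measurable]: "f \<in> borel_measurable M" "g \<in> borel_measurable M"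
  shows "(\<lambda>x. mink (f x) (g x)) \<in> borel_measurable M"
  using borel_measurable_continuous_Pair[OF assms, of mink]
  by (simp add: mink_def continuous_intros)

lemma mink_self_ge: "- mink V V \<le> (norm (snd V))\<^sup>2" "- mink V V \<le> (norm V)\<^sup>2"
proof -
  show "- mink V V \<le> (norm (snd V))\<^sup>2"
    by (simp add: mink_def power2_norm_eq_inner)
  then show "- mink V V \<le> (norm V)\<^sup>2"
    by (simp add: norm_prod_def add_increasing)
qed

text \<open>On the orthogonal complement of a unit timelike vector the form is negative definite.
  The third bound converts decay of \<open>- mink V V\<close> into decay of the Euclidean norm, with
  a factor that depends on \<open>Y\<close> only.\<close>

lemma spacelike_bounds:
  assumes Y: "mink Y Y = 1" and V: "mink V Y = 0"
  shows "(norm (snd V))\<^sup>2 \<le> (fst Y)\<^sup>2 * (- mink V V)" "\<bar>fst V\<bar> \<le> norm (snd V)"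
    "norm V \<le> 2 * \<bar>fst Y\<bar> * sqrt (- mink V V)" "0 \<le> - mink V V"
proof -
  have Y': "(fst Y)\<^sup>2 = 1 + (norm (snd Y))\<^sup>2"
    using Y unfolding mink_def power2_norm_eq_inner by (simp add: power2_eq_square)
  have "(fst V * fst Y)\<^sup>2 = (snd V \<bullet> snd Y)\<^sup>2"
    using V by (simp add: mink_def)
  also have "\<dots> \<le> (norm (snd V))\<^sup>2 * (norm (snd Y))\<^sup>2"
    by (metis Cauchy_Schwarz_ineq power2_norm_eq_inner)
  finally have *: "(fst V)\<^sup>2 * (fst Y)\<^sup>2 \<le> (norm (snd V))\<^sup>2 * ((fst Y)\<^sup>2 - 1)"
    using Y' by (simp add: power_mult_distrib)
  have V2: "- mink V V = (norm (snd V))\<^sup>2 - (fst V)\<^sup>2"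
    unfolding mink_def power2_norm_eq_inner by (simp add: power2_eq_square)
  show a: "(norm (snd V))\<^sup>2 \<le> (fst Y)\<^sup>2 * (- mink V V)"
    using * unfolding V2 by (simp add: algebra_simps)
  have pos: "(fst Y)\<^sup>2 \<ge> 1"
    using Y' by simp
  show n: "0 \<le> - mink V V"
  proof (rule ccontr)
    assume "\<not> 0 \<le> - mink V V"
    then have "(fst Y)\<^sup>2 * (- mink V V) < 0"
      using pos by (intro mult_pos_neg) auto
    then show False
      using a zero_le_power2[of "norm (snd V)"] by linarith
  qed
  then have "(fst V)\<^sup>2 \<le> (norm (snd V))\<^sup>2"
    using V2 by simp
  then show b: "\<bar>fst V\<bar> \<le> norm (snd V)"
    using abs_le_square_iff[of "fst V" "norm (snd V)"] by simp
  have "norm V \<le> \<bar>fst V\<bar> + norm (snd V)"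
    by (metis norm_Pair_le prod.collapse real_norm_def)
  also have "\<dots> \<le> 2 * norm (snd V)"
    using b by simp
  also have "norm (snd V) \<le> \<bar>fst Y\<bar> * sqrt (- mink V V)"
    using real_le_rsqrt[OF a] by (simp only: real_sqrt_mult real_sqrt_abs)
  finally show "norm V \<le> 2 * \<bar>fst Y\<bar> * sqrt (- mink V V)"
    by simp
qed

lemma spacelike_eq_0:
  assumes "mink Y Y = 1" "mink V Y = 0" "mink V V = 0"
  shows "V = 0"
  using spacelike_bounds(3)[OF assms(1,2)] assms(3) by simp

lemma spacelike_Cauchy_Schwarz:
  assumes Y: "mink Y Y = 1" and V: "mink V Y = 0" and W: "mink W Y = 0"
  shows "\<bar>mink V W\<bar> \<le> sqrt (- mink V V) * sqrt (- mink W W)"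
proof (cases "mink W W = 0")
  case True
  then have "W = 0"
    using spacelike_eq_0[OF Y W] by simp
  then show ?thesis
    by (simp add: mink_def)
next
  case False
  then have neg: "mink W W < 0"
    using spacelike_bounds(4)[OF Y W] by simp
  \<comment> \<open>With this \<open>t\<close> the vector \<open>V - t *\<^sub>R W\<close> is
    orthogonal to \<open>W\<close>, and semidefiniteness at that vector is the claim.\<close>
  define t where "t = mink V W / mink W W"
  have "mink (V - t *\<^sub>R W) Y = 0"
    using V W by (simp add: mink_simps)
  from spacelike_bounds(4)[OF Y this]
  have "mink V V - 2 * t * mink V W + t\<^sup>2 * mink W W \<le> 0"
    by (simp add: mink_simps mink_commute power2_eq_square algebra_simps)
  also have "t\<^sup>2 * mink W W = t * mink V W"
    using neg by (simp add: t_def power2_eq_square)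
  finally have "mink V V \<le> (mink V W)\<^sup>2 / mink W W"
    by (simp add: t_def power2_eq_square)
  then have "(mink V W)\<^sup>2 \<le> (- mink V V) * (- mink W W)"
    using neg by (simp add: field_simps)
  then have "\<bar>mink V W\<bar> \<le> sqrt ((- mink V V) * (- mink W W))"
    by (metis real_sqrt_abs real_sqrt_le_iff)
  then show ?thesis
    by (simp only: real_sqrt_mult)
qed

text \<open>The standard isometry onto the upper sheet of the hyperboloid
  \<open>mink V V = 1\<close>, sending \<i> to the vertex \<open>(1, 0)\<close>. The light-cone
  coordinate \<open>fst - Re (snd)\<close> of the image is \<open>1 / Im z\<close>, so division by
  it inverts the map in \<open>hyp_inv\<close>.\<close>

definition hyp :: "complex \<Rightarrow> real \<times> complex"
  where "hyp z = (((cmod z)\<^sup>2 + 1) / (2 * Im z), Complex (((cmod z)\<^sup>2 - 1) / (2 * Im z)) (Re z / Im z))"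

definition hyp_inv :: "real \<times> complex \<Rightarrow> complex"
  where "hyp_inv V = Complex (Im (snd V)) 1 / of_real (fst V - Re (snd V))"

lemma hplane_iff [simp]: "z \<in> hplane \<longleftrightarrow> Im z > 0"
  by (simp add: hplane_def)

lemma mink_hyp:
  assumes "Im z > 0" "Im w > 0"
  shows "mink (hyp z) (hyp w) = 1 + (cmod (z - w))\<^sup>2 / (2 * Im z * Im w)"
  using assms unfolding mink_def hyp_def inner_complex_def cmod_power2
  by (simp add: divide_simps) (simp add: power2_eq_square algebra_simps)

lemma cosh_hdist:
  assumes "Im z > 0" "Im w > 0"
  shows "cosh (hdist z w) = mink (hyp z) (hyp w)"
  using assms by (simp add: hdist_def mink_hyp)

lemma hdist_nonneg: "Im z > 0 \<Longrightarrow> Im w > 0 \<Longrightarrow> 0 \<le> hdist z w"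
  by (simp add: hdist_def)

lemma hdist_commute: "hdist z w = hdist w z"
  by (simp add: hdist_def norm_minus_commute mult_ac)

lemma hdist_self [simp]: "hdist z z = 0"
  by (simp add: hdist_def)

lemma mink_hyp_self: "Im z > 0 \<Longrightarrow> mink (hyp z) (hyp z) = 1"
  by (simp add: mink_hyp)

lemma mink_hyp_ge_1: "Im z > 0 \<Longrightarrow> Im w > 0 \<Longrightarrow> 1 \<le> mink (hyp z) (hyp w)"
  by (simp add: mink_hyp)

lemma hyp_inv_hyp: "Im z > 0 \<Longrightarrow> hyp_inv (hyp z) = z"
proof -
  assume z: "Im z > 0"
  have "fst (hyp z) - Re (snd (hyp z)) = 1 / Im z"
    using z by (simp add: hyp_def field_simps)
  then show ?thesis
    using z unfolding hyp_inv_def complex_eq_iff Re_divide_of_real Im_divide_of_real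
    by (simp add: hyp_def)
qed

lemma fst_hyp_pos: "Im z > 0 \<Longrightarrow> fst (hyp z) > 0"
  by (simp add: hyp_def add_nonneg_pos)

lemma hyp_inject: "Im z > 0 \<Longrightarrow> Im w > 0 \<Longrightarrow> hyp z = hyp w \<longleftrightarrow> z = w"
  by (metis hyp_inv_hyp)

lemma fst_gt_Re_snd:
  assumes "mink V V = 1" "fst V > 0"
  shows "fst V > Re (snd V)"
proof -
  have "(fst V)\<^sup>2 = 1 + (Re (snd V))\<^sup>2 + (Im (snd V))\<^sup>2"
    using assms(1) by (simp add: mink_def inner_complex_def power2_eq_square)
  then have "(Re (snd V))\<^sup>2 < (fst V)\<^sup>2"
    using zero_le_power2[of "Im (snd V)"] by linarith
  then show ?thesis
    using assms(2) by (auto intro: power2_less_imp_less[OF _ less_imp_le])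
qed

lemma hyp_hyp_inv:
  assumes "mink V V = 1" "fst V > 0"
  shows "Im (hyp_inv V) > 0" "hyp (hyp_inv V) = V"
proof -
  obtain a x y where V: "V = (a, Complex x y)"
    by (metis complex.exhaust prod.exhaust)
  have D: "a - x > 0"
    using fst_gt_Re_snd[OF assms] by (simp add: V)
  have a2: "a\<^sup>2 = 1 + x\<^sup>2 + y\<^sup>2"
    using assms(1) by (simp add: V mink_def inner_complex_def power2_eq_square)
  show "Im (hyp_inv V) > 0"
    using D by (simp add: V hyp_inv_def Im_divide_of_real)
  have *: "Re (hyp_inv V) = y / (a - x)" "Im (hyp_inv V) = 1 / (a - x)"
    by (simp_all add: V hyp_inv_def Re_divide_of_real Im_divide_of_real)
  have "(cmod (hyp_inv V))\<^sup>2 = (y\<^sup>2 + 1) / (a - x)\<^sup>2"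
    by (simp add: cmod_power2 * power_divide add_divide_distrib)
  also have "\<dots> = (a + x) / (a - x)"
  proof -
    \<comment> \<open>The equation of the hyperboloid, factored in light-cone coordinates.\<close>
    have "y\<^sup>2 + 1 = (a + x) * (a - x)"
      using a2 by (simp add: algebra_simps power2_eq_square)
    then show ?thesis
      using D by (simp add: power2_eq_square)
  qed
  finally have c: "(cmod (hyp_inv V))\<^sup>2 = (a + x) / (a - x)" .
  show "hyp (hyp_inv V) = V"
    using D unfolding hyp_def c * by (simp add: V complex_eq_iff divide_simps)
qed

section \<open>The hyperbolic distance and its topology through the Minkowski form\<close>

lemma arcosh_le:
  fixes a::real
  assumes "0 \<le> b" "1 \<le> a" "a \<le> cosh b"
  shows "arcosh a \<le> b"
  using assms by (metis arcosh_cosh_real arcosh_less_iff_real cosh_real_ge_1 not_le)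

lemma hdist_eq_arcosh: "Im z > 0 \<Longrightarrow> Im w > 0 \<Longrightarrow> hdist z w = arcosh (mink (hyp z) (hyp w))"
  by (simp add: hdist_def mink_hyp)

text \<open>Polar coordinates around \<open>Y\<close>: the components of \<open>X\<close> and
  \<open>Z\<close> orthogonal to \<open>Y\<close> have lengths sinh a and sinh b, so Cauchy-Schwarz
  on the complement bounds \<open>mink X Z\<close> by the addition formula for cosh. Equality would
  mean opposite directions.\<close>

lemma hdist_triangle:
  assumes "Im x > 0" "Im y > 0" "Im z > 0"
  shows "hdist x z \<le> hdist x y + hdist y z"
proof -
  define X Y Z where "X = hyp x" and "Y = hyp y" and "Z = hyp z"
  define a b where "a = hdist x y" and "b = hdist y z"
  have YY: "mink Y Y = 1" "mink X X = 1" "mink Z Z = 1"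
    using assms by (simp_all add: X_def Y_def Z_def mink_hyp_self)
  have a: "cosh a = mink X Y" and b: "cosh b = mink Z Y"
    using assms by (simp_all add: a_def b_def X_def Y_def Z_def cosh_hdist mink_commute)
  have [simp]: "0 \<le> a" "0 \<le> b"
    using assms by (simp_all add: a_def b_def hdist_nonneg)
  define V W where "V = X - cosh a *\<^sub>R Y" and "W = Z - cosh b *\<^sub>R Y"
  have V: "mink V Y = 0" and W: "mink W Y = 0"
    by (simp_all add: V_def W_def mink_simps a b YY)
  have "- mink V V = (sinh a)\<^sup>2" "- mink W W = (sinh b)\<^sup>2"
    using mink_commute[of Y X] mink_commute[of Y Z]
    by (simp_all add: V_def W_def mink_simps YY sinh_square_eq flip: a b)
      (simp_all add: power2_eq_square algebra_simps cosh_square_eq)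
  then have "\<bar>mink V W\<bar> \<le> sinh a * sinh b"
    using spacelike_Cauchy_Schwarz[OF YY(1) V W] by simp
  moreover have "mink X Z = cosh a * cosh b + mink V W"
    using mink_commute[of Y X] mink_commute[of Y Z]
    by (simp add: V_def W_def mink_simps YY a b algebra_simps)
  ultimately have "mink X Z \<le> cosh (a + b)"
    by (simp add: cosh_add)
  then have "arcosh (mink X Z) \<le> a + b"
    using assms by (intro arcosh_le) (simp_all add: X_def Z_def mink_hyp_ge_1)
  then show ?thesis
    using assms by (simp add: a_def b_def hdist_eq_arcosh X_def Z_def)
qed

lemma continuous_on_hyp: "continuous_on hplane hyp"
  unfolding hyp_def Complex_eq by (intro continuous_intros) auto

lemma continuous_on_hdist:
  assumes "continuous_on A f" "continuous_on A g" "f ` A \<subseteq> hplane" "g ` A \<subseteq> hplane"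
  shows "continuous_on A (\<lambda>x. hdist (f x) (g x))"
proof -
  have "continuous_on A (\<lambda>x. arcosh (mink (hyp (f x)) (hyp (g x))))"
    using assms
    by (intro continuous_on_compose2[OF continuous_on_arcosh[OF order_refl]]
        continuous_on_mink continuous_on_compose2[OF continuous_on_hyp])
      (auto intro!: mink_hyp_ge_1 simp: image_subset_iff)
  then show ?thesis
    by (rule continuous_on_eq) (use assms in \<open>auto simp: hdist_eq_arcosh image_subset_iff\<close>)
qed

lemma cosh_le_exp:
  fixes x :: real
  assumes "0 \<le> x"
  shows "cosh x \<le> exp x"
  using assms by (simp add: cosh_def)

lemma exp_le_cosh: "exp x \<le> 2 * cosh (x::real)"
  by (simp add: cosh_def)

text \<open>The map \<open>hyp_inv\<close> is continuous at \<open>hyp z\<close>, and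
  \<open>hyp w - hyp z\<close> splits into a multiple of \<open>hyp z\<close> and an orthogonal part
  of Minkowski length sinh (hdist z w). Both parts shrink with the hyperbolic distance, uniformly in
  \<open>w\<close>.\<close>

lemma hdist_small_imp_dist_small:
  assumes z: "Im z > 0" and e: "e > 0"
  obtains d where "d > 0" "\<And>w. Im w > 0 \<Longrightarrow> hdist z w < d \<Longrightarrow> dist z w < e"
proof -
  have *: "dist z w = cmod (hyp_inv (hyp w) - hyp_inv (hyp z))" if "Im w > 0" for w
    using that z by (simp add: hyp_inv_hyp dist_norm norm_minus_commute)
  have nz: "fst (hyp z) - Re (snd (hyp z)) \<noteq> 0"
    using fst_gt_Re_snd[OF mink_hyp_self[OF z] fst_hyp_pos[OF z]] by simp
  then have "(hyp_inv \<longlongrightarrow> hyp_inv (hyp z)) (at (hyp z))"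
    unfolding hyp_inv_def Complex_eq by (intro tendsto_intros) (auto simp flip: of_real_diff)
  then have "isCont hyp_inv (hyp z)"
    by (simp add: isCont_def)
  then obtain d where d: "d > 0" "\<And>V. dist V (hyp z) < d \<Longrightarrow> dist (hyp_inv V) (hyp_inv (hyp z)) < e"
    using e unfolding continuous_at_eps_delta by blast
  have bound: "dist (hyp w) (hyp z) \<le> 2 * \<bar>fst (hyp z)\<bar> * sqrt ((cosh (hdist z w))\<^sup>2 - 1)
        + (cosh (hdist z w) - 1) * norm (hyp z)" if w: "Im w > 0" for w
  proof -
    define V where "V = hyp w - cosh (hdist z w) *\<^sub>R hyp z"
    have ch: "mink (hyp w) (hyp z) = cosh (hdist z w)" "mink (hyp z) (hyp w) = cosh (hdist z w)"
      using z w by (simp_all add: cosh_hdist mink_commute)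
    have "mink V (hyp z) = 0"
      using z by (simp add: V_def mink_simps ch mink_hyp_self)
    moreover have "- mink V V = (cosh (hdist z w))\<^sup>2 - 1"
      using z w by (simp add: V_def mink_simps mink_hyp_self ch power2_eq_square algebra_simps)
    ultimately have "norm V \<le> 2 * \<bar>fst (hyp z)\<bar> * sqrt ((cosh (hdist z w))\<^sup>2 - 1)"
      using spacelike_bounds(3)[OF mink_hyp_self[OF z]] by metis
    moreover have "hyp w - hyp z = V + (cosh (hdist z w) - 1) *\<^sub>R hyp z"
      by (simp add: V_def algebra_simps)
    then have "dist (hyp w) (hyp z) \<le> norm V + norm ((cosh (hdist z w) - 1) *\<^sub>R hyp z)"
      unfolding dist_norm by (metis norm_triangle_ineq)
    moreover have "norm ((cosh (hdist z w) - 1) *\<^sub>R hyp z) = (cosh (hdist z w) - 1) * norm (hyp z)"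
      using cosh_real_ge_1[of "hdist z w"] by simp
    ultimately show ?thesis
      by linarith
  qed
  define h where "h r = 2 * \<bar>fst (hyp z)\<bar> * sqrt ((cosh r)\<^sup>2 - 1) + (cosh r - 1) * norm (hyp z)" for r :: real
  have "isCont h 0"
    unfolding h_def by (intro continuous_intros)
  moreover have "h 0 = 0" by (simp add: h_def)
  ultimately obtain r where r: "r > 0" "\<And>s. dist s 0 < r \<Longrightarrow> dist (h s) 0 < d"
    using d(1) unfolding continuous_at_eps_delta by metis
  show ?thesis
  proof (rule that[OF r(1)])
    fix w assume w: "Im w > 0" "hdist z w < r"
    then have "\<bar>h (hdist z w)\<bar> < d"
      using r(2)[of "hdist z w"] hdist_nonneg[OF z w(1)] by simp
    then have "dist (hyp w) (hyp z) < d"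
      using bound[OF w(1)] by (simp add: h_def)
    then show "dist z w < e"
      using d(2) unfolding *[OF w(1)] by (simp only: dist_norm)
  qed
qed

section \<open>Geodesics in the hyperboloid model\<close>

lemma fst_null:
  assumes "mink N N = 0" "fst N \<ge> 0"
  shows "fst N = norm (snd N)"
proof -
  have "(fst N)\<^sup>2 = (norm (snd N))\<^sup>2"
    using assms(1) unfolding mink_def power2_norm_eq_inner by (simp add: power2_eq_square)
  then show ?thesis
    using assms(2) by (simp add: power2_eq_iff_nonneg)
qed

lemma mink_null_nonneg:
  assumes "mink N N = 0" "fst N \<ge> 0" "mink M M = 0" "fst M \<ge> 0"
  shows "mink N M \<ge> 0"
  using norm_cauchy_schwarz[of "snd N" "snd M"] fst_null[OF assms(1,2)] fst_null[OF assms(3,4)]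
  by (simp add: mink_def)

text \<open>This is the equality case of Cauchy-Schwarz for the spatial parts: orthogonal future
  null vectors represent the same point at infinity.\<close>

lemma null_orthogonal_imp_proportional:
  assumes "mink N N = 0" "fst N > 0" "mink M M = 0" "fst M > 0" "mink N M = 0"
  shows "M = (fst M / fst N) *\<^sub>R N"
proof -
  have N: "fst N = norm (snd N)" and M: "fst M = norm (snd M)"
    using assms fst_null by auto
  have "snd N \<bullet> snd M = norm (snd N) * norm (snd M)"
    using assms(5) N M by (simp add: mink_def)
  then have "norm (snd N) *\<^sub>R snd M = norm (snd M) *\<^sub>R snd N"
    by (simp add: norm_cauchy_schwarz_eq)
  then have "fst N *\<^sub>R snd M = fst M *\<^sub>R snd N"
    by (simp add: N M)
  then have "snd M = (fst M / fst N) *\<^sub>R snd N"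
    using assms(2) by (metis divideR_right less_irrefl scaleR_scaleR divide_inverse_commute)
  then show ?thesis
    using assms(2) by (simp add: prod_eq_iff)
qed

lemma mink_hyp_null_pos:
  assumes "Im z > 0" "mink N N = 0" "fst N > 0"
  shows "mink (hyp z) N > 0"
proof -
  have "(fst (hyp z))\<^sup>2 = 1 + (norm (snd (hyp z)))\<^sup>2"
    using mink_hyp_self[OF assms(1)] unfolding mink_def power2_norm_eq_inner
    by (simp add: power2_eq_square)
  then have "norm (snd (hyp z)) < fst (hyp z)"
    using fst_hyp_pos[OF assms(1)] by (auto intro: power2_less_imp_less[OF _ less_imp_le])
  then have "norm (snd (hyp z)) * norm (snd N) < fst (hyp z) * fst N"
    using fst_null[OF assms(2)] assms(3) by auto
  then show ?thesis
    using norm_cauchy_schwarz[of "snd (hyp z)" "snd N"] by (simp add: mink_def)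
qed

text \<open>The null vectors \<open>N\<close> and \<open>M\<close> represent the two ends of the geodesic \<open>c\<close> on the circle at
  infinity; \<open>c\<close> has unit speed by the normalization of \<open>mink N M\<close>.\<close>

definition hgeod :: "(real \<Rightarrow> complex) \<Rightarrow> real \<times> complex \<Rightarrow> real \<times> complex \<Rightarrow> bool"
  where "hgeod c N M \<longleftrightarrow> mink N N = 0 \<and> mink M M = 0 \<and> mink N M = 1/2 \<and>
    (\<forall>t. Im (c t) > 0 \<and> hyp (c t) = exp t *\<^sub>R N + exp (- t) *\<^sub>R M)"

lemma hgeodD:
  assumes "hgeod c N M"
  shows "mink N N = 0" "mink M M = 0" "mink N M = 1/2" "mink M N = 1/2"
    "Im (c t) > 0" "hyp (c t) = exp t *\<^sub>R N + exp (- t) *\<^sub>R M"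
  using assms by (simp_all add: hgeod_def mink_commute)

lemma hgeod_hdist:
  assumes "hgeod c N M"
  shows "hdist (c s) (c t) = \<bar>s - t\<bar>"
proof -
  have "mink (hyp (c s)) (hyp (c t)) = (exp s * exp (- t) + exp (- s) * exp t) / 2"
    by (simp add: hgeodD[OF assms] mink_simps algebra_simps)
  also have "\<dots> = cosh \<bar>s - t\<bar>"
    unfolding cosh_real_abs by (simp add: cosh_def flip: exp_add)
  finally show ?thesis
    using hgeodD(5)[OF assms] by (simp only: hdist_eq_arcosh arcosh_cosh_real abs_ge_zero)
qed

text \<open>\<open>N\<close> is the limit of \<open>exp (- t) *\<^sub>R hyp (c t)\<close> as t tends
  to infinity, which gives a nonnegative first coordinate; reversing time does the same for
  \<open>M\<close>. A zero coordinate would make a null vector vanish, against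
  \<open>mink N M = 1/2\<close>.\<close>

lemma hgeod_fst_pos:
  assumes "hgeod c N M"
  shows "fst N > 0" "fst M > 0"
proof -
  have pos: "exp t * fst N + exp (- t) * fst M > 0" for t
    using fst_hyp_pos[OF hgeodD(5)[OF assms, of t]] by (simp add: hgeodD(6)[OF assms])
  have nonneg: "a \<ge> 0" if "\<And>t. exp t * a + exp (- t) * b > 0" for a b :: real
  proof (rule ccontr)
    assume "\<not> a \<ge> 0"
    have "((\<lambda>t. a + exp (- 2 * t) * b) \<longlongrightarrow> a + 0 * b) at_top"
      by (intro tendsto_intros filterlim_compose[OF exp_at_bot]
          filterlim_tendsto_neg_mult_at_bot[OF tendsto_const _ filterlim_ident]) auto
    moreover have "a + exp (- 2 * t) * b \<ge> 0" for t
    proof -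
      have "a + exp (- 2 * t) * b = exp (- t) * (exp t * a + exp (- t) * b)"
        by (simp add: algebra_simps flip: exp_add)
      then show ?thesis
        using that[of t] by (metis exp_ge_zero less_imp_le mult_nonneg_nonneg)
    qed
    ultimately have "a + 0 * b \<ge> 0"
      by (intro tendsto_lowerbound[of "\<lambda>t. a + exp (- 2 * t) * b"]) auto
    then show False
      using \<open>\<not> a \<ge> 0\<close> by simp
  qed
  have N: "fst N \<ge> 0"
    using nonneg pos by blast
  have M: "fst M \<ge> 0"
    by (rule nonneg[of _ "fst N"]) (metis add.commute minus_minus pos)
  have "fst N \<noteq> 0" "fst M \<noteq> 0"
    using fst_null[OF hgeodD(1)[OF assms] N] fst_null[OF hgeodD(2)[OF assms] M] hgeodD(3)[OF assms]
    by (auto simp: mink_def)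
  then show "fst N > 0" "fst M > 0"
    using N M by auto
qed

lemma hgeod_unique:
  assumes "hgeod c N M" "hgeod c' N M"
  shows "c = c'"
proof
  fix t
  have "hyp (c t) = hyp (c' t)"
    by (simp add: hgeodD(6)[OF assms(1)] hgeodD(6)[OF assms(2)])
  then show "c t = c' t"
    using hgeodD(5)[OF assms(1)] hgeodD(5)[OF assms(2)] hyp_inject by blast
qed

text \<open>Agreement at a parameter t says that \<open>M - M'\<close> is exp (2 t) times
  \<open>N' - N\<close>. Two different values of t leave only zero.\<close>

lemma null_pair_unique:
  fixes N :: "'a::real_vector"
  assumes "a \<noteq> b"
    and "exp a *\<^sub>R N + exp (- a) *\<^sub>R M = exp a *\<^sub>R N' + exp (- a) *\<^sub>R M'"
    and "exp b *\<^sub>R N + exp (- b) *\<^sub>R M = exp b *\<^sub>R N' + exp (- b) *\<^sub>R M'"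
  shows "N = N' \<and> M = M'"
proof -
  have *: "M - M' = exp (2 * t) *\<^sub>R (N' - N)"
    if "exp t *\<^sub>R N + exp (- t) *\<^sub>R M = exp t *\<^sub>R N' + exp (- t) *\<^sub>R M'" for t
  proof -
    have "exp (- t) *\<^sub>R (M - M') = exp t *\<^sub>R (N' - N)"
      using that by (simp add: algebra_simps)
    then have "exp t *\<^sub>R exp (- t) *\<^sub>R (M - M') = exp t *\<^sub>R exp t *\<^sub>R (N' - N)"
      by simp
    then show ?thesis
      by (simp flip: exp_add)
  qed
  have "exp (2 * a) *\<^sub>R (N' - N) = exp (2 * b) *\<^sub>R (N' - N)"
    using *[OF assms(2)] *[OF assms(3)] by (rule subst)
  then have "N' = N"
    using assms(1) by simp
  with *[OF assms(2)] show ?thesis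
    by simp
qed

text \<open>Distances determine the Gram matrix of the points \<open>hyp (c s)\<close>. Two of the
  points give \<open>N\<close> and \<open>M\<close> by linear algebra; all further identities then
  follow from the Gram matrix and from definiteness on the complement of a timelike vector.\<close>

lemma local_isometry_null_pair:
  assumes I: "\<And>s u. s \<in> I \<Longrightarrow> u \<in> I \<Longrightarrow> hdist (c s) (c u) = \<bar>s - u\<bar>"
    and pos: "\<And>s. s \<in> I \<Longrightarrow> Im (c s) > 0"
    and ab: "a \<in> I" "b \<in> I" "a < b"
  obtains N M where "mink N N = 0" "mink M M = 0" "mink N M = 1/2"
    "\<And>s. s \<in> I \<Longrightarrow> hyp (c s) = exp s *\<^sub>R N + exp (- s) *\<^sub>R M"
proof -
  define X where "X s = hyp (c s)" for s
  define k where "k = exp (b - a) - exp (a - b)"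
  have k: "k > 0"
    using ab(3) by (simp add: k_def)
  have k': "k = exp b * exp (- a) - exp a * exp (- b)"
    by (simp add: k_def flip: exp_add)
  have X: "mink (X s) (X u) = (exp s * exp (- u) + exp (- s) * exp u) / 2"
    if "s \<in> I" "u \<in> I" for s u
  proof -
    have "mink (X s) (X u) = cosh \<bar>s - u\<bar>"
      using cosh_hdist[of "c s" "c u"] that by (simp add: X_def I pos)
    then show ?thesis
      unfolding cosh_real_abs by (simp add: cosh_def flip: exp_add)
  qed
  \<comment> \<open>\<open>N\<close> and \<open>M\<close> solve the two linear equations that the
    claimed formula imposes at a and b; up to sign, k = 2 sinh (b - a) is the determinant of that
    system.\<close>
  define N where "N = (1 / k) *\<^sub>R (exp (- a) *\<^sub>R X b - exp (- b) *\<^sub>R X a)"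
  define M where "M = (1 / k) *\<^sub>R (exp b *\<^sub>R X a - exp a *\<^sub>R X b)"
  have N: "mink N (X s) = exp (- s) / 2" and M: "mink M (X s) = exp s / 2" if "s \<in> I" for s
  proof -
    have "mink N (X s) = (1 / k) * (exp (- a) * mink (X b) (X s) - exp (- b) * mink (X a) (X s))"
      by (simp add: N_def mink_simps)
    also have "exp (- a) * mink (X b) (X s) - exp (- b) * mink (X a) (X s) = k * exp (- s) / 2"
      by (simp add: X that ab k' field_simps)
    finally have "mink N (X s) = (1 / k) * (k * exp (- s) / 2)" .
    then show "mink N (X s) = exp (- s) / 2"
      using k by simp
    have "mink M (X s) = (1 / k) * (exp b * mink (X a) (X s) - exp a * mink (X b) (X s))"
      by (simp add: M_def mink_simps)
    also have "exp b * mink (X a) (X s) - exp a * mink (X b) (X s) = k * exp s / 2"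
      by (simp add: X that ab k' field_simps)
    finally have "mink M (X s) = (1 / k) * (k * exp s / 2)" .
    then show "mink M (X s) = exp s / 2"
      using k by simp
  qed
  show ?thesis
  proof
    show NN: "mink N N = 0"
      by (subst (2) N_def) (simp add: mink_simps N ab)
    show MM: "mink M M = 0"
      by (subst (2) M_def) (simp add: mink_simps M ab)
    have "mink N M = (1 / k) * (exp b * mink N (X a) - exp a * mink N (X b))"
      by (simp add: M_def mink_simps)
    also have "exp b * mink N (X a) - exp a * mink N (X b) = k / 2"
      by (simp add: N ab k' field_simps)
    finally have "mink N M = (1 / k) * (k / 2)" .
    then show NM: "mink N M = 1/2"
      using k by simp
    fix s assume s: "s \<in> I"
    \<comment> \<open>The error of the formula is orthogonal to every \<open>X r\<close>, hence to
      \<open>N\<close> and \<open>M\<close>, hence to itself; being also orthogonal to the timelike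
      \<open>X s\<close>, it is zero.\<close>
    define Y where "Y = X s - (exp s *\<^sub>R N + exp (- s) *\<^sub>R M)"
    have Y: "mink Y (X r) = 0" if "r \<in> I" for r
      using that s by (simp add: Y_def mink_simps X N M)
    have "mink Y N = 0"
      by (subst N_def) (simp add: mink_simps Y ab)
    moreover have "mink Y M = 0"
      by (subst M_def) (simp add: mink_simps Y ab)
    ultimately have "mink Y Y = 0"
      by (subst (2) Y_def) (simp add: mink_simps Y s)
    moreover have "mink (X s) (X s) = 1"
      using s by (simp add: X_def mink_hyp_self pos)
    ultimately have "Y = 0"
      using spacelike_eq_0 Y[OF s] by blast
    then show "hyp (c s) = exp s *\<^sub>R N + exp (- s) *\<^sub>R M"
      by (simp add: Y_def X_def)
  qed
qed

text \<open>Near each time the curve is given by one null pair, and a pair is determined by the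
  curve on any interval. The pair is therefore locally constant in time, and constant because the
  real line is connected.\<close>

lemma local_isometry_imp_hgeod:
  assumes loc: "\<And>t. \<exists>e>0. \<forall>s\<in>ball t e. \<forall>u\<in>ball t e. hdist (c s) (c u) = \<bar>s - u\<bar>"
    and pos: "\<And>t. Im (c t) > 0"
  obtains N M where "hgeod c N M"
proof -
  define good where "good t Q \<longleftrightarrow> (case Q of (N, M) \<Rightarrow> mink N N = 0 \<and> mink M M = 0 \<and> mink N M = 1/2 \<and>
    (\<forall>\<^sub>F s in nhds t. hyp (c s) = exp s *\<^sub>R N + exp (- s) *\<^sub>R M))" for t Q
  have "\<exists>Q. good t Q" for t
  proof -
    obtain e where e: "e > 0" "\<forall>s\<in>ball t e. \<forall>u\<in>ball t e. hdist (c s) (c u) = \<bar>s - u\<bar>"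
      using loc by blast
    obtain N M where NM: "mink N N = 0" "mink M M = 0" "mink N M = 1/2"
      "\<And>s. s \<in> ball t e \<Longrightarrow> hyp (c s) = exp s *\<^sub>R N + exp (- s) *\<^sub>R M"
      by (rule local_isometry_null_pair[of "ball t e" c t "t + e/2"]) (use e pos in \<open>auto simp: dist_real_def\<close>)
    have "\<forall>\<^sub>F s in nhds t. s \<in> ball t e"
      using e(1) by (intro eventually_nhds_in_open) auto
    then have "\<forall>\<^sub>F s in nhds t. hyp (c s) = exp s *\<^sub>R N + exp (- s) *\<^sub>R M"
      by eventually_elim (use NM in auto)
    then show ?thesis
      using NM(1-3) by (intro exI[of _ "(N, M)"]) (simp add: good_def)
  qed
  then obtain Q where Q: "\<And>t. good t (Q t)"
    by metis
  have uniq: "P = P'" if "good t P" "good t P'" for t P P'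
  proof -
    obtain N M N' M' where P: "P = (N, M)" "P' = (N', M')"
      by (metis prod.exhaust)
    have "\<forall>\<^sub>F s in nhds t. exp s *\<^sub>R N + exp (- s) *\<^sub>R M = exp s *\<^sub>R N' + exp (- s) *\<^sub>R M'"
      using that unfolding good_def P by (auto elim: eventually_elim2)
    then obtain e where e: "e > 0"
      "\<And>s. dist s t < e \<Longrightarrow> exp s *\<^sub>R N + exp (- s) *\<^sub>R M = exp s *\<^sub>R N' + exp (- s) *\<^sub>R M'"
      unfolding eventually_nhds_metric by blast
    have "N = N' \<and> M = M'"
      by (rule null_pair_unique[of t "t + e/2", OF _ e(2) e(2)]) (use e(1) in \<open>auto simp: dist_real_def\<close>)
    then show ?thesis
      by (simp add: P)
  qed
  \<comment> \<open>A pair that is valid on a neighbourhood of t is valid near every u in its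
    interior.\<close>
  have "\<forall>\<^sub>F u in nhds t. good u (Q t)" for t
  proof -
    obtain N M where P: "Q t = (N, M)"
      by (metis prod.exhaust)
    have "\<forall>\<^sub>F u in nhds t. \<forall>\<^sub>F s in nhds u. hyp (c s) = exp s *\<^sub>R N + exp (- s) *\<^sub>R M"
      using Q[of t] unfolding P good_def by (simp add: eventually_eventually)
    then show ?thesis
      using Q[of t] unfolding P good_def by simp
  qed
  then have *: "\<forall>\<^sub>F u in nhds t. Q t = Q u" for t
    by (rule eventually_mono) (use uniq Q in blast)
  have "\<forall>t\<in>UNIV. \<forall>\<^sub>F u in at t. Q t = Q u"
    unfolding eventually_at_filter using eventually_mono[OF *] by simp
  then have const: "Q t = Q 0" for t
    by (intro connected_local_const[of UNIV]) auto
  obtain N M where P: "Q 0 = (N, M)"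
    by (metis prod.exhaust)
  have "hyp (c t) = exp t *\<^sub>R N + exp (- t) *\<^sub>R M" for t
    using Q[of t] unfolding const[of t] P good_def by (auto dest: eventually_nhds_x_imp_x)
  then have "hgeod c N M"
    using Q[of 0] pos unfolding P good_def hgeod_def by auto
  then show ?thesis
    by (rule that)
qed

section \<open>The nearest point on a geodesic\<close>

lemma hdist_hgeod:
  assumes "hgeod c N M" "Im z > 0"
  shows "cosh (hdist z (c t)) = exp t * mink (hyp z) N + exp (- t) * mink (hyp z) M"
  using hgeodD(5)[OF assms(1)] assms(2)
  by (simp add: cosh_hdist hgeodD(6)[OF assms(1)] mink_simps)

text \<open>By \<open>hdist_hgeod\<close> the task is to minimize exp (t) a + exp (- t) b, whose
  minimum sits at t = 0 exactly when a = b. The normalization of a tracking geodesic thus becomes a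
  linear condition on its two null vectors.\<close>

lemma hgeod_nearest_iff:
  assumes c: "hgeod c N M" and z: "Im z > 0"
  shows "hdist z (c 0) = (INF t. hdist z (c t)) \<longleftrightarrow> mink (hyp z) N = mink (hyp z) M"
proof -
  define a b where "a = mink (hyp z) N" and "b = mink (hyp z) M"
  have ab: "a > 0" "b > 0"
    using mink_hyp_null_pos[OF z] hgeodD(1,2)[OF c] hgeod_fst_pos[OF c] by (auto simp: a_def b_def)
  have pos: "0 \<le> hdist z (c t)" for t
    using z hgeodD(5)[OF c] by (rule hdist_nonneg)
  then have bdd: "bdd_below (range (\<lambda>t. hdist z (c t)))"
    by (intro bdd_belowI[of _ 0]) auto
  have "hdist z (c 0) = (INF t. hdist z (c t)) \<longleftrightarrow> (\<forall>t. hdist z (c 0) \<le> hdist z (c t))"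
  proof
    assume "hdist z (c 0) = (INF t. hdist z (c t))"
    then show "\<forall>t. hdist z (c 0) \<le> hdist z (c t)"
      using cINF_lower[OF bdd] by simp
  next
    assume "\<forall>t. hdist z (c 0) \<le> hdist z (c t)"
    then show "hdist z (c 0) = (INF t. hdist z (c t))"
      by (intro antisym cINF_greatest cINF_lower[OF bdd]) auto
  qed
  also have "\<dots> \<longleftrightarrow> (\<forall>t. a + b \<le> exp t * a + exp (- t) * b)"
  proof -
    have "hdist z (c 0) \<le> hdist z (c t) \<longleftrightarrow> cosh (hdist z (c 0)) \<le> cosh (hdist z (c t))" for t
      using pos by (simp add: cosh_real_nonneg_le_iff)
    then show ?thesis
      unfolding hdist_hgeod[OF c z] by (simp add: a_def b_def)
  qed
  also have "\<dots> \<longleftrightarrow> a = b"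
  proof
    assume "\<forall>t. a + b \<le> exp t * a + exp (- t) * b"
    \<comment> \<open>The minimizer of the right-hand side; its value there is twice the geometric
      mean of a and b, so the inequality is the equality case of the arithmetic-geometric mean
      inequality.\<close>
    from this[rule_format, of "ln (sqrt (b / a))"] have "a + b \<le> sqrt (b / a) * a + b / sqrt (b / a)"
      using ab by (simp add: exp_minus field_simps)
    also have "sqrt (b / a) * a = sqrt a * sqrt b"
      using ab by (simp add: real_sqrt_divide field_simps)
    also have "b / sqrt (b / a) = sqrt a * sqrt b"
      using ab by (simp add: real_sqrt_divide field_simps)
    finally have "(sqrt a - sqrt b)\<^sup>2 \<le> 0"
      using ab by (simp add: power2_diff)
    then show "a = b"
      by simp
  next
    assume "a = b"
    moreover have "2 \<le> exp t + exp (- t)" for t :: real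
      using cosh_real_ge_1[of t] by (simp add: cosh_def)
    then have "a * 2 \<le> a * (exp t + exp (- t))" for t
      using ab by (intro mult_left_mono) auto
    ultimately show "\<forall>t. a + b \<le> exp t * a + exp (- t) * b"
      by (simp add: algebra_simps)
  qed
  finally show ?thesis
    by (simp add: a_def b_def)
qed

section \<open>Geodesics with prescribed ends and their initial vectors\<close>

definition geo :: "real \<times> complex \<Rightarrow> real \<times> complex \<Rightarrow> real \<Rightarrow> complex"
  where "geo N M t = hyp_inv (exp t *\<^sub>R N + exp (- t) *\<^sub>R M)"

lemma hgeod_geo:
  assumes "mink N N = 0" "mink M M = 0" "mink N M = 1/2" "fst N > 0" "fst M > 0"
  shows "hgeod (geo N M) N M"
proof -
  have "mink (exp t *\<^sub>R N + exp (- t) *\<^sub>R M) (exp t *\<^sub>R N + exp (- t) *\<^sub>R M) = 1" for t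
    using assms by (simp add: mink_simps mink_commute[of M N] exp_minus field_simps)
  moreover have "fst (exp t *\<^sub>R N + exp (- t) *\<^sub>R M) > 0" for t
    using assms by (simp add: add_pos_pos)
  ultimately show ?thesis
    using assms by (simp add: hgeod_def geo_def hyp_hyp_inv)
qed

lemma hgeod_eq_geo:
  assumes "hgeod c N M"
  shows "c = geo N M"
  using hgeod_unique[OF assms hgeod_geo] hgeodD[OF assms] hgeod_fst_pos[OF assms] by blast

text \<open>The quotient rule for \<open>hyp_inv\<close> at the point \<open>V\<close> with velocity
  \<open>W\<close>, where \<open>D\<close> is the denominator and \<open>E\<close> its derivative.
  As an explicit rational expression it is visibly a Borel function of the two null vectors.\<close>

definition geo_velocity :: "real \<times> complex \<Rightarrow> real \<times> complex \<Rightarrow> complex"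
  where "geo_velocity N M = (let V = N + M; W = N - M; D = fst V - Re (snd V); E = fst W - Re (snd W)
    in Complex ((Im (snd W) * D - Im (snd V) * E) / (D * D)) (- E / (D * D)))"

lemma geo_has_vector_derivative:
  assumes "hgeod c N M"
  shows "(c has_vector_derivative geo_velocity N M) (at 0)"
proof -
  have D: "fst (N + M) - Re (snd (N + M)) > 0"
    using fst_gt_Re_snd[OF mink_hyp_self fst_hyp_pos, of "c 0"] hgeodD(5)[OF assms]
    by (simp add: hgeodD(6)[OF assms])
  have "((\<lambda>t. Im (exp t *\<^sub>R snd N + exp (- t) *\<^sub>R snd M) /
      (fst (exp t *\<^sub>R N + exp (- t) *\<^sub>R M) - Re (snd (exp t *\<^sub>R N + exp (- t) *\<^sub>R M))))
      has_real_derivative Re (geo_velocity N M)) (at 0)"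
    using D by (auto intro!: derivative_eq_intros simp: geo_velocity_def Let_def)
  moreover have "((\<lambda>t. 1 /
      (fst (exp t *\<^sub>R N + exp (- t) *\<^sub>R M) - Re (snd (exp t *\<^sub>R N + exp (- t) *\<^sub>R M))))
      has_real_derivative Im (geo_velocity N M)) (at 0)"
    using D by (auto intro!: derivative_eq_intros simp: geo_velocity_def Let_def)
      (simp only: minus_divide_left minus_diff_eq)
  ultimately have "(geo N M has_vector_derivative geo_velocity N M) (at 0)"
    unfolding has_vector_derivative_complex_iff
    by (simp add: geo_def hyp_inv_def Re_divide_of_real Im_divide_of_real)
  then show ?thesis
    using hgeod_eq_geo[OF assms] by simp
qed

text \<open>In light-cone coordinates the form reads A D - b^2, and the claim reduces to the
  relations saying that \<open>V\<close> has square 1, \<open>W\<close> has square -1, and the two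
  are orthogonal. It places the initial vector in the bundle on which the topology of geodesics is
  defined.\<close>

lemma geo_velocity_unit:
  assumes "hgeod c N M"
  shows "(c 0, geo_velocity N M) \<in> unit_tangent_hplane"
proof -
  define V W where "V = N + M" and "W = N - M"
  define D E where "D = fst V - Re (snd V)" and "E = fst W - Re (snd W)"
  define A A' where "A = fst V + Re (snd V)" and "A' = fst W + Re (snd W)"
  define b b' where "b = Im (snd V)" and "b' = Im (snd W)"
  note h = hgeodD[OF assms]
  have D: "D > 0"
    using fst_gt_Re_snd[OF mink_hyp_self fst_hyp_pos, of "c 0"] h(5) by (simp add: h(6) D_def V_def)
  have mink': "mink P Q = ((fst P + Re (snd P)) * (fst Q - Re (snd Q)) +
      (fst P - Re (snd P)) * (fst Q + Re (snd Q))) / 2 - Im (snd P) * Im (snd Q)" for P Q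
    by (simp add: mink_def inner_complex_def field_simps)
  have "mink V V = 1" "mink V W = 0" "mink W W = - 1"
    using h(1-4) by (simp_all add: V_def W_def mink_simps)
  then have 1: "A * D = 1 + b * b" and 2: "A * E + D * A' = 2 * b * b'" and 3: "A' * E = b' * b' - 1"
    unfolding mink' by (simp_all add: A_def A'_def D_def E_def b_def b'_def field_simps)
  have "(b' * D - b * E)\<^sup>2 + E\<^sup>2 = b' * b' * D * D - (2 * b * b') * D * E + (1 + b * b) * E * E"
    by (simp add: power2_eq_square algebra_simps)
  also have "\<dots> = D * D * (b' * b' - A' * E)"
    unfolding 1[symmetric] 2[symmetric] by (simp add: algebra_simps)
  also have "\<dots> = D\<^sup>2"
    by (simp add: 3 power2_eq_square)
  finally have "(b' * D - b * E)\<^sup>2 + E\<^sup>2 = D\<^sup>2" .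
  then have "(cmod (geo_velocity N M))\<^sup>2 = D\<^sup>2 / (D * D)\<^sup>2"
    unfolding cmod_power2 geo_velocity_def Let_def
    by (simp add: V_def[symmetric] W_def[symmetric] D_def[symmetric] E_def[symmetric] b_def[symmetric]
        b'_def[symmetric] power_divide add_divide_distrib[symmetric])
  also have "\<dots> = (1 / D)\<^sup>2"
    using D by (simp add: power2_eq_square)
  finally have "cmod (geo_velocity N M) = 1 / D"
    using D by (simp add: power2_eq_iff_nonneg)
  moreover have "Im (c 0) = 1 / D"
    by (simp add: hgeod_eq_geo[OF assms] geo_def hyp_inv_def Im_divide_of_real D_def V_def)
  ultimately show ?thesis
    using h(5)[of 0] D by (simp add: unit_tangent_hplane_def)
qed

section \<open>Geodesics that stay at sublinear distance\<close>

lemma linear_growth_le: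
  assumes lim: "(\<lambda>n. d n / real n) \<longlonglongrightarrow> l" and "k > 0"
    and le: "\<And>n. k * exp (a * real n) \<le> exp (d n)"
  shows "a \<le> l"
proof (rule LIMSEQ_le)
  show "(\<lambda>n. ln k / real n + a) \<longlonglongrightarrow> a"
    using tendsto_add[OF lim_const_over_n tendsto_const] by simp
  show "\<exists>N. \<forall>n\<ge>N. ln k / real n + a \<le> d n / real n"
  proof (intro exI allI impI)
    fix n :: nat assume n: "n \<ge> 1"
    have "ln (k * exp (a * real n)) \<le> d n"
      using le[of n] \<open>k > 0\<close> by (metis exp_gt_zero ln_exp ln_le_cancel_iff mult_pos_pos)
    then have "ln k + a * real n \<le> d n"
      using \<open>k > 0\<close> by (simp add: ln_mult)
    then have "(ln k + a * real n) / real n \<le> d n / real n"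
      by (rule divide_right_mono) simp
    then show "ln k / real n + a \<le> d n / real n"
      using n by (simp add: add_divide_distrib)
  qed
qed (rule lim)

text \<open>If the forward ends differed, then \<open>mink N N'\<close> would be positive and the
  product of the two points at time n v would grow like exp (2 v n), which forces a distance of
  linear rate at least 2 v.\<close>

lemma sublinear_ends_proportional:
  assumes c: "hgeod c N M" and c': "hgeod c' N' M'" and v: "v > 0"
    and lim: "(\<lambda>n. hdist (c (real n * v)) (c' (real n * v)) / real n) \<longlonglongrightarrow> 0"
  shows "N' = (fst N' / fst N) *\<^sub>R N"
proof -
  have fst_pos: "fst N > 0" "fst M > 0" "fst N' > 0" "fst M' > 0"
    using hgeod_fst_pos c c' by auto
  have nonneg: "mink N N' \<ge> 0" "mink N M' \<ge> 0" "mink M N' \<ge> 0" "mink M M' \<ge> 0"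
    using fst_pos hgeodD[OF c] hgeodD[OF c'] by (auto intro!: mink_null_nonneg)
  have "mink N N' = 0"
  proof (rule ccontr)
    assume "mink N N' \<noteq> 0"
    then have pos: "mink N N' > 0"
      using nonneg by simp
    have "mink N N' * exp (2 * v * real n) \<le> exp (hdist (c (real n * v)) (c' (real n * v)))" for n
    proof -
      define t where "t = real n * v"
      have "exp (2 * v * real n) = exp t * exp t"
        by (simp add: t_def flip: exp_add)
      then have "mink N N' * exp (2 * v * real n) \<le> mink (hyp (c t)) (hyp (c' t))"
        using nonneg by (simp add: hgeodD(6)[OF c] hgeodD(6)[OF c'] mink_simps algebra_simps)
      also have "\<dots> = cosh (hdist (c t) (c' t))"
        using hgeodD(5) c c' by (simp add: cosh_hdist)
      also have "\<dots> \<le> exp (hdist (c t) (c' t))"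
        using hgeodD(5) c c' by (intro cosh_le_exp hdist_nonneg) auto
      finally show ?thesis
        by (simp add: t_def)
    qed
    from linear_growth_le[OF lim pos this] v show False
      by simp
  qed
  then show ?thesis
    using fst_pos hgeodD(1)[OF c] hgeodD(1)[OF c'] null_orthogonal_imp_proportional by blast
qed

lemma hgeod_reverse:
  assumes "hgeod c N M"
  shows "hgeod (\<lambda>t. c (- t)) M N"
  using hgeodD[OF assms] by (simp add: hgeod_def)

text \<open>Equal ends leave scalars k and l with \<open>N' = k *\<^sub>R N\<close> and
  \<open>M' = l *\<^sub>R M\<close>. Unit speed gives k l = 1, a shift of the parameter, and having
  the same nearest-point parameter 0 gives k = l.\<close>

lemma sublinear_nearest_unique:
  assumes c: "hgeod c N M" and c': "hgeod c' N' M'" and v: "v > 0"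
    and lim: "(\<lambda>n. hdist (c (real n * v)) (c' (real n * v)) / real n) \<longlonglongrightarrow> 0"
    and lim': "(\<lambda>n. hdist (c (- real n * v)) (c' (- real n * v)) / real n) \<longlonglongrightarrow> 0"
    and z: "Im z > 0"
    and near: "hdist z (c 0) = (INF t. hdist z (c t))" "hdist z (c' 0) = (INF t. hdist z (c' t))"
  shows "c = c'"
proof -
  define k l where "k = fst N' / fst N" and "l = fst M' / fst M"
  have N: "N' = k *\<^sub>R N" and M: "M' = l *\<^sub>R M"
    using sublinear_ends_proportional[OF c c' v lim]
      sublinear_ends_proportional[OF hgeod_reverse[OF c] hgeod_reverse[OF c'] v] lim'
    by (simp_all add: k_def l_def)
  have "mink (hyp z) N = mink (hyp z) M" "mink (hyp z) N' = mink (hyp z) M'"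
    using hgeod_nearest_iff[OF c z] hgeod_nearest_iff[OF c' z] near by simp_all
  moreover have "mink (hyp z) N > 0"
    using mink_hyp_null_pos[OF z] hgeodD(1)[OF c] hgeod_fst_pos[OF c] by blast
  ultimately have "k = l"
    by (simp add: N M mink_simps)
  moreover have "k * l = 1"
  proof -
    have "mink N' M' = (k * l) * mink N M"
      by (simp add: N M mink_simps)
    then show ?thesis
      unfolding hgeodD(3)[OF c] hgeodD(3)[OF c'] by simp
  qed
  moreover have "k > 0"
    using hgeod_fst_pos c c' by (simp add: k_def)
  ultimately have "k = 1" "l = 1"
    by (auto simp: square_eq_1_iff)
  then show ?thesis
    using c c' hgeod_unique by (simp add: N M)
qed

section \<open>Sublinear tracking\<close>

lemma geometric_steps_convergent:
  fixes f :: "nat \<Rightarrow> 'a::banach"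
  assumes q: "0 < q" "q < 1" and K: "K \<ge> 0"
    and step: "\<And>n. n \<ge> n0 \<Longrightarrow> norm (f n - f (Suc n)) \<le> K * q ^ n"
  obtains L where "f \<longlonglongrightarrow> L" "\<And>n. n \<ge> n0 \<Longrightarrow> norm (f n - L) \<le> K / (1 - q) * q ^ n"
proof -
  \<comment> \<open>The factor \<open>1 - q ^ k\<close> is the partial geometric sum; it is kept
    because the induction does not close with the weaker bound that drops it.\<close>
  have far: "norm (f n - f (n + k)) \<le> K / (1 - q) * q ^ n * (1 - q ^ k)" if "n \<ge> n0" for n k
  proof (induction k)
    case (Suc k)
    have "norm (f n - f (n + Suc k)) \<le> norm (f n - f (n + k)) + norm (f (n + k) - f (Suc (n + k)))"
      using norm_triangle_ineq[of "f n - f (n + k)" "f (n + k) - f (Suc (n + k))"] by simp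
    also have "\<dots> \<le> K / (1 - q) * q ^ n * (1 - q ^ k) + K * q ^ (n + k)"
      using Suc step[of "n + k"] that by (intro add_mono) auto
    also have "\<dots> = K / (1 - q) * q ^ n * (1 - q ^ Suc k)"
      using q by (simp add: divide_simps power_add) (simp add: algebra_simps)
    finally show ?case .
  qed simp
  have bound: "norm (f n - f m) \<le> K / (1 - q) * q ^ n" if "n \<ge> n0" "m \<ge> n" for n m
  proof -
    have "norm (f n - f m) \<le> K / (1 - q) * q ^ n * (1 - q ^ (m - n))"
      using far[OF that(1), of "m - n"] that(2) by simp
    also have "\<dots> \<le> K / (1 - q) * q ^ n * 1"
      using q K by (intro mult_left_mono) auto
    finally show ?thesis by simp
  qed
  have lim0: "(\<lambda>n. K / (1 - q) * q ^ n) \<longlonglongrightarrow> 0"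
    using q by (intro tendsto_mult_right_zero LIMSEQ_realpow_zero) auto
  have "Cauchy f"
    unfolding Cauchy_altdef
  proof (intro allI impI)
    fix e :: real assume "e > 0"
    then obtain M where M: "\<And>n. n \<ge> M \<Longrightarrow> K / (1 - q) * q ^ n < e"
      using order_tendstoD(2)[OF lim0] unfolding eventually_sequentially by blast
    show "\<exists>M. \<forall>m\<ge>M. \<forall>n>m. dist (f m) (f n) < e"
    proof (intro exI[of _ "max M n0"] allI impI)
      fix m n assume "m \<ge> max M n0" "n > m"
      then have "norm (f m - f n) \<le> K / (1 - q) * q ^ m" "K / (1 - q) * q ^ m < e"
        using bound[of m n] M[of m] by auto
      then show "dist (f m) (f n) < e"
        unfolding dist_norm by linarith
    qed
  qed
  then obtain L where L: "f \<longlonglongrightarrow> L"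
    using Cauchy_convergent convergent_def by blast
  show ?thesis
  proof (rule that[OF L])
    fix n assume n: "n \<ge> n0"
    have "(\<lambda>m. norm (f n - f m)) \<longlonglongrightarrow> norm (f n - L)"
      by (intro tendsto_intros L)
    then show "norm (f n - L) \<le> K / (1 - q) * q ^ n"
      by (rule tendsto_upperbound)
        (use bound n in \<open>auto simp: eventually_sequentially intro: exI[of _ n]\<close>)
  qed
qed

text \<open>Since exp d is at most 2 cosh d, the bound gives d n at most ln (2 K) + \<epsilon> n.
  The constant may depend on \<epsilon>, and the threshold \<delta> allows \<epsilon> to be taken
  below the speed.\<close>

lemma sublinearI:
  fixes d :: "nat \<Rightarrow> real"
  assumes nonneg: "\<And>n. d n \<ge> 0" and "\<delta> > 0"
    and le: "\<And>\<epsilon>. 0 < \<epsilon> \<Longrightarrow> \<epsilon> < \<delta> \<Longrightarrow> \<exists>K. \<forall>\<^sub>F n in sequentially. cosh (d n) \<le> K * exp (\<epsilon> * real n)"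
  shows "(\<lambda>n. d n / real n) \<longlonglongrightarrow> 0"
proof (rule order_tendstoI)
  fix a :: real assume "a < 0"
  then show "\<forall>\<^sub>F n in sequentially. a < d n / real n"
    using nonneg by (auto intro!: always_eventually less_le_trans[of a 0])
next
  fix a :: real assume a: "a > 0"
  define \<epsilon> where "\<epsilon> = min (a / 2) (\<delta> / 2)"
  have \<epsilon>: "0 < \<epsilon>" "\<epsilon> < \<delta>" "\<epsilon> < a"
    using a \<open>\<delta> > 0\<close> by (auto simp: \<epsilon>_def)
  obtain K where K: "\<forall>\<^sub>F n in sequentially. cosh (d n) \<le> K * exp (\<epsilon> * real n)"
    using le \<epsilon> by blast
  have "(\<lambda>n. ln (2 * K) / real n + \<epsilon>) \<longlonglongrightarrow> 0 + \<epsilon>"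
    by (intro tendsto_intros lim_const_over_n)
  then have "\<forall>\<^sub>F n in sequentially. ln (2 * K) / real n + \<epsilon> < a"
    using \<epsilon>(3) by (simp add: order_tendstoD(2))
  then show "\<forall>\<^sub>F n in sequentially. d n / real n < a"
    using K eventually_gt_at_top[of 0]
  proof eventually_elim
    case (elim n)
    \<comment> \<open>Positivity of \<open>K\<close>, required for its logarithm, is read off from
      the bound itself.\<close>
    have "0 < K * exp (\<epsilon> * real n)"
      using elim(2) cosh_real_pos[of "d n"] by linarith
    then have "K > 0"
      by (simp add: zero_less_mult_iff)
    have "exp (d n) \<le> 2 * K * exp (\<epsilon> * real n)"
      using exp_le_cosh[of "d n"] elim(2) by linarith
    then have "d n \<le> ln (2 * K * exp (\<epsilon> * real n))"
      using \<open>K > 0\<close> by (simp add: ln_ge_iff)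
    also have "\<dots> = ln (2 * K) + \<epsilon> * real n"
      using \<open>K > 0\<close> by (simp add: ln_mult)
    finally have "d n / real n \<le> (ln (2 * K) + \<epsilon> * real n) / real n"
      by (rule divide_right_mono) simp
    also have "\<dots> = ln (2 * K) / real n + \<epsilon>"
      using elim(3) by (simp add: add_divide_distrib)
    finally show ?case
      using elim(1) by linarith
  qed
qed

text \<open>The point \<open>w\<close>, scaled so as to have height 1 over \<open>z\<close>: as \<open>w\<close> tends to a point
  at infinity, \<open>dirvec z w\<close> tends to a null vector representing it.\<close>

definition dirvec :: "complex \<Rightarrow> complex \<Rightarrow> real \<times> complex"
  where "dirvec z w = (1 / mink (hyp z) (hyp w)) *\<^sub>R hyp w"

definition enddir :: "complex \<Rightarrow> (nat \<Rightarrow> complex) \<Rightarrow> real \<times> complex"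
  where "enddir z x = lim (\<lambda>n. dirvec z (x n))"

section \<open>A half-orbit escaping at linear speed\<close>

locale linear_drift =
  fixes z :: complex and x :: "nat \<Rightarrow> complex" and v C :: real
  assumes z: "Im z > 0" and x: "\<And>n. Im (x n) > 0"
    and step: "\<And>n. hdist (x n) (x (Suc n)) \<le> C"
    and v: "v > 0" and drift: "(\<lambda>n. hdist z (x n) / real n) \<longlonglongrightarrow> v"
begin

abbreviation r :: "nat \<Rightarrow> real" where "r n \<equiv> hdist z (x n)"
abbreviation P :: "nat \<Rightarrow> real \<times> complex" where "P n \<equiv> dirvec z (x n)"

definition N :: "real \<times> complex" where "N = enddir z x"

lemma mink_z: "mink (hyp z) (hyp (x n)) = cosh (r n)"
  using z x by (simp add: cosh_hdist)

lemma P_def: "P n = (1 / cosh (r n)) *\<^sub>R hyp (x n)"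
  by (simp add: dirvec_def mink_z)

lemma mink_z_P: "mink (hyp z) (P n) = 1"
  by (simp add: P_def mink_simps mink_z)

lemma mink_P_P: "mink (P n) (P n) = 1 / (cosh (r n))\<^sup>2"
  using x by (simp add: P_def mink_simps mink_hyp_self power2_eq_square)

lemma r_nonneg: "r n \<ge> 0"
  using z x by (simp add: hdist_nonneg)

lemma r_lower:
  assumes "\<epsilon> > 0"
  shows "\<forall>\<^sub>F n in sequentially. (v - \<epsilon>) * real n \<le> r n"
proof -
  have "\<forall>\<^sub>F n in sequentially. v - \<epsilon> < r n / real n"
    using order_tendstoD(1)[OF drift, of "v - \<epsilon>"] assms by simp
  then show ?thesis
    using eventually_gt_at_top[of 0] by eventually_elim (simp add: field_simps)
qed

lemma r_upper:
  assumes "\<epsilon> > 0"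
  shows "\<forall>\<^sub>F n in sequentially. r n \<le> (v + \<epsilon>) * real n"
proof -
  have "\<forall>\<^sub>F n in sequentially. r n / real n < v + \<epsilon>"
    using order_tendstoD(2)[OF drift, of "v + \<epsilon>"] assms by simp
  then show ?thesis
    using eventually_gt_at_top[of 0] by eventually_elim (simp add: field_simps)
qed

lemma inverse_cosh_le: "1 / cosh t \<le> 2 * exp (- t)" for t :: real
  using exp_le_cosh[of t] by (simp add: exp_minus field_simps)

text \<open>All \<open>P n\<close> have height 1 over \<open>z\<close>, so consecutive ones differ
  by a vector orthogonal to \<open>hyp z\<close>, where the Minkowski length controls the norm. Its
  square is at most twice \<open>mink (P n) (P (Suc n))\<close>, which is the cosh of a bounded step
  divided by the two cosh heights.\<close>

lemma P_step: "norm (P n - P (Suc n)) \<le> 2 * \<bar>fst (hyp z)\<bar> * sqrt (8 * cosh C) * exp (- (r n + r (Suc n)) / 2)"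
proof -
  define V where "V = P n - P (Suc n)"
  have "mink V (hyp z) = 0"
    using mink_z_P by (simp add: V_def mink_simps mink_commute[of _ "hyp z"])
  then have "norm V \<le> 2 * \<bar>fst (hyp z)\<bar> * sqrt (- mink V V)"
    using spacelike_bounds(3) mink_hyp_self[OF z] by blast
  also have "- mink V V \<le> 2 * mink (P n) (P (Suc n))"
  proof -
    have "- mink V V = 2 * mink (P n) (P (Suc n)) - 1 / (cosh (r n))\<^sup>2 - 1 / (cosh (r (Suc n)))\<^sup>2"
      by (simp add: V_def mink_simps mink_P_P mink_commute[of "P (Suc n)" "P n"])
    then show ?thesis
      by (simp add: diff_le_eq add_increasing2)
  qed
  also have "mink (P n) (P (Suc n)) = cosh (hdist (x n) (x (Suc n))) * ((1 / cosh (r n)) * (1 / cosh (r (Suc n))))"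
    using x by (simp add: P_def mink_simps cosh_hdist)
  also have "\<dots> \<le> cosh C * ((2 * exp (- r n)) * (2 * exp (- r (Suc n))))"
    using step[of n] x hdist_nonneg[of "x n" "x (Suc n)"]
    by (intro mult_mono inverse_cosh_le) (auto simp: cosh_real_nonneg_le_iff)
  \<comment> \<open>The 8 collects the leading factor 2 and the factor 2 lost in each of the two
    bounds for 1 / cosh.\<close>
  also have "2 * \<dots> = 8 * cosh C * (exp (- (r n + r (Suc n)) / 2))\<^sup>2"
    by (simp add: power2_eq_square flip: exp_add)
  finally have "norm V \<le> 2 * \<bar>fst (hyp z)\<bar> * sqrt (8 * cosh C * (exp (- (r n + r (Suc n)) / 2))\<^sup>2)"
    by (simp add: mult_left_mono)
  also have "sqrt (8 * cosh C * (exp (- (r n + r (Suc n)) / 2))\<^sup>2) = sqrt (8 * cosh C) * exp (- (r n + r (Suc n)) / 2)"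
    by (simp only: real_sqrt_mult real_sqrt_abs abs_exp_cancel)
  finally show ?thesis
    by (simp add: V_def mult.assoc)
qed

text \<open>For large n both \<open>r n\<close> and \<open>r (Suc n)\<close> are at least (v -
  \<epsilon>) n, so the steps are dominated by a geometric series with ratio exp (- (v -
  \<epsilon>)), whose tail gives the rate.\<close>

lemma P_converges_exp:
  assumes \<epsilon>: "0 < \<epsilon>" "\<epsilon> < v"
  shows "\<exists>L K. P \<longlonglongrightarrow> L \<and> (\<forall>\<^sub>F n in sequentially. norm (P n - L) \<le> K * exp (- (v - \<epsilon>) * real n))"
proof -
  define q where "q = exp (- (v - \<epsilon>))"
  define K where "K = 2 * \<bar>fst (hyp z)\<bar> * sqrt (8 * cosh C)"
  have q: "0 < q" "q < 1" and K: "K \<ge> 0"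
    using \<epsilon> by (auto simp: q_def K_def)
  have qn: "q ^ n = exp (- (v - \<epsilon>) * real n)" for n
    by (simp add: q_def mult.commute flip: exp_of_nat_mult)
  obtain n0 where n0: "\<And>n. n \<ge> n0 \<Longrightarrow> (v - \<epsilon>) * real n \<le> r n"
    using r_lower[OF \<epsilon>(1)] unfolding eventually_sequentially by blast
  have "norm (P n - P (Suc n)) \<le> K * q ^ n" if "n \<ge> n0" for n
  proof -
    have aux: "u \<le> a \<Longrightarrow> u \<le> b \<Longrightarrow> - (a + b) / 2 \<le> - u" for u a b :: real
      by simp
    have "(v - \<epsilon>) * real n \<le> (v - \<epsilon>) * real (Suc n)"
      using \<epsilon> by (intro mult_left_mono) auto
    then have "- (r n + r (Suc n)) / 2 \<le> - (v - \<epsilon>) * real n"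
      using n0[OF that] n0[OF le_SucI[OF that]] aux by (metis mult_minus_left order_trans)
    then have "exp (- (r n + r (Suc n)) / 2) \<le> q ^ n"
      unfolding qn by (simp only: exp_le_cancel_iff)
    then show ?thesis
      using P_step[of n] K unfolding K_def[symmetric] by (meson mult_left_mono order_trans)
  qed
  from geometric_steps_convergent[OF q K this]
  obtain L where L: "P \<longlonglongrightarrow> L" "\<And>n. n \<ge> n0 \<Longrightarrow> norm (P n - L) \<le> K / (1 - q) * q ^ n"
    by blast
  then show ?thesis
    unfolding qn eventually_sequentially by blast
qed

lemma P_tendsto_N: "P \<longlonglongrightarrow> N"
proof -
  obtain L where "P \<longlonglongrightarrow> L"
    using P_converges_exp[of "v / 2"] v by auto
  then show ?thesis
    unfolding N_def enddir_def by (simp add: limI)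
qed

lemma P_N_exp:
  assumes "0 < \<epsilon>" "\<epsilon> < v"
  obtains K where "\<forall>\<^sub>F n in sequentially. norm (P n - N) \<le> K * exp (- (v - \<epsilon>) * real n)"
  using P_converges_exp[OF assms] P_tendsto_N LIMSEQ_unique by blast

lemma inverse_cosh_r_exp:
  assumes "\<epsilon> > 0"
  shows "\<forall>\<^sub>F n in sequentially. 1 / (cosh (r n))\<^sup>2 \<le> 4 * exp (- 2 * (v - \<epsilon>) * real n)"
  using r_lower[OF assms]
proof eventually_elim
  case (elim n)
  have "1 / cosh (r n) \<le> 2 * exp (- r n)"
    by (rule inverse_cosh_le)
  also have "\<dots> \<le> 2 * exp (- (v - \<epsilon>) * real n)"
    using elim unfolding mult_minus_left by simp
  finally have "(1 / cosh (r n))\<^sup>2 \<le> (2 * exp (- (v - \<epsilon>) * real n))\<^sup>2"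
    by (intro power_mono) auto
  also have "\<dots> = 4 * exp (- 2 * (v - \<epsilon>) * real n)"
    by (simp add: power2_eq_square flip: exp_add)
  finally show ?case
    by (simp add: power_divide)
qed

lemma N_null: "mink N N = 0"
proof (rule LIMSEQ_unique)
  show "(\<lambda>n. mink (P n) (P n)) \<longlonglongrightarrow> mink N N"
    by (intro tendsto_intros P_tendsto_N)
  have "(\<lambda>n. exp (- v) ^ n) \<longlonglongrightarrow> 0"
    using v by (intro LIMSEQ_realpow_zero) auto
  then have lim: "(\<lambda>n. 4 * exp (- v) ^ n) \<longlonglongrightarrow> 0"
    by (rule tendsto_mult_right_zero)
  \<comment> \<open>The choice \<epsilon> = v / 2 turns the exponent -2 (v - \<epsilon>) into
    -v.\<close>
  have upper: "\<forall>\<^sub>F n in sequentially. mink (P n) (P n) \<le> 4 * exp (- v) ^ n"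
    using inverse_cosh_r_exp[of "v / 2"] v
    by (simp add: mink_P_P mult.commute exp_of_nat_mult[symmetric])
  have lower: "\<forall>\<^sub>F n in sequentially. 0 \<le> mink (P n) (P n)"
    by (simp add: mink_P_P)
  show "(\<lambda>n. mink (P n) (P n)) \<longlonglongrightarrow> 0"
    by (rule tendsto_sandwich[OF lower upper tendsto_const lim])
qed

lemma mink_z_N: "mink (hyp z) N = 1"
proof (rule LIMSEQ_unique)
  show "(\<lambda>n. mink (hyp z) (P n)) \<longlonglongrightarrow> mink (hyp z) N"
    by (intro tendsto_intros P_tendsto_N)
qed (simp add: mink_z_P)

lemma N_pos: "fst N > 0"
proof -
  have "(\<lambda>n. fst (P n)) \<longlonglongrightarrow> fst N"
    by (intro tendsto_intros P_tendsto_N)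
  moreover have "fst (P n) \<ge> 0" for n
    using fst_hyp_pos[OF x, of n] by (simp add: P_def)
  ultimately have nonneg: "fst N \<ge> 0"
    by (intro tendsto_lowerbound[of "\<lambda>n. fst (P n)"]) auto
  moreover have "fst N \<noteq> 0"
    using fst_null[OF N_null nonneg] mink_z_N by (auto simp: mink_def)
  ultimately show ?thesis
    by simp
qed

text \<open>The rate doubles compared with \<open>P_N_exp\<close>: since \<open>N\<close> is null,
  polarization expresses \<open>mink (P n) N\<close> through \<open>mink (P n) (P n)\<close> and the
  square of the error \<open>P n - N\<close>, both of the doubled order.\<close>

lemma mink_P_N_exp:
  assumes \<epsilon>: "0 < \<epsilon>" "\<epsilon> < v"
  obtains K where "K \<ge> 0" "\<forall>\<^sub>F n in sequentially. mink (P n) N \<le> K * exp (- 2 * (v - \<epsilon>) * real n)"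
proof -
  obtain K where K: "\<forall>\<^sub>F n in sequentially. norm (P n - N) \<le> K * exp (- (v - \<epsilon>) * real n)"
    using P_N_exp[OF \<epsilon>] by blast
  have "\<forall>\<^sub>F n in sequentially. mink (P n) N \<le> (2 + K\<^sup>2 / 2) * exp (- 2 * (v - \<epsilon>) * real n)"
    using K inverse_cosh_r_exp[OF \<epsilon>(1)]
  proof eventually_elim
    case (elim n)
    have "(norm (P n - N))\<^sup>2 \<le> (K * exp (- (v - \<epsilon>) * real n))\<^sup>2"
      using elim(1) by (intro power_mono) auto
    also have "\<dots> = K\<^sup>2 * exp (- 2 * (v - \<epsilon>) * real n)"
      by (simp add: power2_eq_square flip: exp_add)
    finally have 1: "- mink (P n - N) (P n - N) \<le> K\<^sup>2 * exp (- 2 * (v - \<epsilon>) * real n)"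
      using mink_self_ge(2)[of "P n - N"] by linarith
    have "2 * mink (P n) N = 1 / (cosh (r n))\<^sup>2 - mink (P n - N) (P n - N)"
      by (simp add: mink_simps mink_P_P N_null mink_commute[of N "P n"])
    then have "2 * mink (P n) N \<le> 4 * exp (- 2 * (v - \<epsilon>) * real n) + K\<^sup>2 * exp (- 2 * (v - \<epsilon>) * real n)"
      using 1 elim(2) by linarith
    then show ?case
      by (simp add: algebra_simps)
  qed
  then show ?thesis
    by (intro that[of "2 + K\<^sup>2 / 2"]) auto
qed

text \<open>The cosh of the distance is cosh (r n) times two terms. The \<open>N\<close> term has
  the growing factor exp (n v), compensated by the doubled decay of \<open>mink (P n) N\<close>; the
  \<open>M\<close> term has exp (- n v) against cosh (r n). The scale a and the other end
  \<open>M\<close> affect only constants.\<close>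

lemma tracking:
  assumes c: "hgeod c (a *\<^sub>R N) M"
  shows "(\<lambda>n. hdist (x n) (c (real n * v)) / real n) \<longlonglongrightarrow> 0"
proof (rule sublinearI[of _ "3 * v"])
  note h = hgeodD[OF c]
  show "0 \<le> hdist (x n) (c (real n * v))" for n
    using x h(5) by (simp add: hdist_nonneg)
  have a: "a > 0"
    using hgeod_fst_pos(1)[OF c] N_pos by (simp add: zero_less_mult_iff)
  fix \<delta> :: real assume \<delta>: "0 < \<delta>" "\<delta> < 3 * v"
  \<comment> \<open>The exponents of the \<open>N\<close> term add up to (v + \<epsilon>) + v - 2 (v
    - \<epsilon>) = 3 \<epsilon>. The threshold 3 v for \<delta> ensures \<epsilon> < v.\<close>
  define \<epsilon> where "\<epsilon> = \<delta> / 3"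
  have \<epsilon>: "0 < \<epsilon>" "\<epsilon> < v"
    using \<delta> by (auto simp: \<epsilon>_def)
  obtain K where K: "K \<ge> 0" "\<forall>\<^sub>F n in sequentially. mink (P n) N \<le> K * exp (- 2 * (v - \<epsilon>) * real n)"
    using mink_P_N_exp[OF \<epsilon>] by blast
  have "(\<lambda>n. mink (P n) M) \<longlonglongrightarrow> mink N M"
    by (intro tendsto_intros P_tendsto_N)
  then have "\<forall>\<^sub>F n in sequentially. mink (P n) M < \<bar>mink N M\<bar> + 1"
    by (rule order_tendstoD) auto
  then have "\<forall>\<^sub>F n in sequentially. cosh (hdist (x n) (c (real n * v)))
      \<le> (a * K + (\<bar>mink N M\<bar> + 1)) * exp (\<delta> * real n)"
    using K(2) r_upper[OF \<epsilon>(1)]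
  proof eventually_elim
    case (elim n)
    define t where "t = real n * v"
    have "hyp (x n) = cosh (r n) *\<^sub>R P n"
      by (simp add: P_def)
    then have "cosh (hdist (x n) (c t)) = cosh (r n) * (exp t * a * mink (P n) N + exp (- t) * mink (P n) M)"
      using x h(5) by (simp add: cosh_hdist h(6) mink_simps algebra_simps)
    also have "\<dots> \<le> cosh (r n) * (exp t * a * (K * exp (- 2 * (v - \<epsilon>) * real n)) + exp (- t) * (\<bar>mink N M\<bar> + 1))"
      using elim a by (intro mult_left_mono add_mono) auto
    also have "\<dots> \<le> exp ((v + \<epsilon>) * real n) *
        (exp t * a * (K * exp (- 2 * (v - \<epsilon>) * real n)) + exp (- t) * (\<bar>mink N M\<bar> + 1))"
      using elim(3) cosh_le_exp[OF r_nonneg[of n]] a K(1)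
      by (intro mult_right_mono) (auto intro: order_trans)
    also have "\<dots> = a * K * (exp ((v + \<epsilon>) * real n) * exp t * exp (- 2 * (v - \<epsilon>) * real n)) +
        (\<bar>mink N M\<bar> + 1) * (exp ((v + \<epsilon>) * real n) * exp (- t))"
      by (simp add: algebra_simps)
    also have "exp ((v + \<epsilon>) * real n) * exp t * exp (- 2 * (v - \<epsilon>) * real n) = exp (\<delta> * real n)"
      unfolding exp_add[symmetric] by (simp add: t_def \<epsilon>_def algebra_simps)
    also have "exp ((v + \<epsilon>) * real n) * exp (- t) = exp (\<epsilon> * real n)"
      unfolding exp_add[symmetric] by (simp add: t_def algebra_simps)
    also have "exp (\<epsilon> * real n) \<le> exp (\<delta> * real n)"
      using \<delta> by (simp add: \<epsilon>_def mult_right_mono)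
    also have "a * K * exp (\<delta> * real n) + (\<bar>mink N M\<bar> + 1) * exp (\<delta> * real n)
        = (a * K + (\<bar>mink N M\<bar> + 1)) * exp (\<delta> * real n)"
      by (simp add: algebra_simps)
    finally show ?case
      by (simp add: t_def mult_left_mono)
  qed
  then show "\<exists>K. \<forall>\<^sub>F n in sequentially. cosh (hdist (x n) (c (real n * v))) \<le> K * exp (\<delta> * real n)"
    by blast
qed (use v in simp)

end

section \<open>Two half-orbits with a common base point and speed\<close>

locale two_drifts = X: linear_drift z x v C + Y: linear_drift z y v D for z x y v C D
begin

text \<open>Both rescaled points lie within exp (- (v - \<epsilon>) n) of the same null vector, so
  by polarization their product has twice that decay, which cancels the product of the two cosh
  heights up to a small exponential.\<close>

lemma same_end_imp_sublinear:
  assumes eq: "X.N = Y.N"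
  shows "(\<lambda>n. hdist (x n) (y n) / real n) \<longlonglongrightarrow> 0"
proof (rule sublinearI[of _ "4 * v"])
  show "0 \<le> hdist (x n) (y n)" for n
    using X.x Y.x by (simp add: hdist_nonneg)
  fix \<delta> :: real assume \<delta>: "0 < \<delta>" "\<delta> < 4 * v"
  \<comment> \<open>The exponent that remains is 2 (v + \<epsilon>) - 2 (v - \<epsilon>) = 4
    \<epsilon>.\<close>
  define \<epsilon> where "\<epsilon> = \<delta> / 4"
  have \<epsilon>: "0 < \<epsilon>" "\<epsilon> < v"
    using \<delta> by (auto simp: \<epsilon>_def)
  obtain K where K: "\<forall>\<^sub>F n in sequentially. norm (X.P n - X.N) \<le> K * exp (- (v - \<epsilon>) * real n)"
    using X.P_N_exp[OF \<epsilon>] by blast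
  obtain L where L: "\<forall>\<^sub>F n in sequentially. norm (Y.P n - X.N) \<le> L * exp (- (v - \<epsilon>) * real n)"
    unfolding eq using Y.P_N_exp[OF \<epsilon>] by blast
  have "\<forall>\<^sub>F n in sequentially. cosh (hdist (x n) (y n)) \<le> (4 + (K + L)\<^sup>2 / 2) * exp (\<delta> * real n)"
    using K L X.inverse_cosh_r_exp[OF \<epsilon>(1)] Y.inverse_cosh_r_exp[OF \<epsilon>(1)]
      X.r_upper[OF \<epsilon>(1)] Y.r_upper[OF \<epsilon>(1)]
  proof eventually_elim
    case (elim n)
    define e where "e = exp (- 2 * (v - \<epsilon>) * real n)"
    have "norm (X.P n - Y.P n) \<le> norm (X.P n - X.N) + norm (Y.P n - X.N)"
      by (metis norm_triangle_ineq4 diff_diff_eq2 diff_add_cancel add_diff_cancel_right)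
    also have "\<dots> \<le> (K + L) * exp (- (v - \<epsilon>) * real n)"
      using elim(1,2) by (simp add: algebra_simps)
    finally have "(norm (X.P n - Y.P n))\<^sup>2 \<le> ((K + L) * exp (- (v - \<epsilon>) * real n))\<^sup>2"
      by (intro power_mono) auto
    also have "\<dots> = (K + L)\<^sup>2 * e"
      by (simp add: power2_eq_square e_def flip: exp_add)
    finally have 1: "- mink (X.P n - Y.P n) (X.P n - Y.P n) \<le> (K + L)\<^sup>2 * e"
      using mink_self_ge(2)[of "X.P n - Y.P n"] by linarith
    have "2 * mink (X.P n) (Y.P n) = 1 / (cosh (X.r n))\<^sup>2 + 1 / (cosh (Y.r n))\<^sup>2
        - mink (X.P n - Y.P n) (X.P n - Y.P n)"
      by (simp add: mink_simps X.mink_P_P Y.mink_P_P mink_commute[of "Y.P n" "X.P n"])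
    then have PP: "mink (X.P n) (Y.P n) \<le> (4 + (K + L)\<^sup>2 / 2) * e"
      using 1 elim(3,4) by (simp add: e_def algebra_simps)
    have "hyp (x n) = cosh (X.r n) *\<^sub>R X.P n" "hyp (y n) = cosh (Y.r n) *\<^sub>R Y.P n"
      by (simp_all add: X.P_def Y.P_def)
    then have "cosh (hdist (x n) (y n)) = cosh (X.r n) * cosh (Y.r n) * mink (X.P n) (Y.P n)"
      using X.x Y.x by (simp add: cosh_hdist mink_simps)
    also have "\<dots> \<le> cosh (X.r n) * cosh (Y.r n) * ((4 + (K + L)\<^sup>2 / 2) * e)"
      using PP by (intro mult_left_mono) auto
    also have "\<dots> \<le> exp ((v + \<epsilon>) * real n) * exp ((v + \<epsilon>) * real n) * ((4 + (K + L)\<^sup>2 / 2) * e)"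
      using elim(5,6) cosh_le_exp[OF X.r_nonneg[of n]] cosh_le_exp[OF Y.r_nonneg[of n]]
      by (intro mult_right_mono mult_mono) (auto intro: order_trans simp: e_def add_nonneg_nonneg)
    also have "\<dots> = (4 + (K + L)\<^sup>2 / 2) * (exp ((v + \<epsilon>) * real n) * exp ((v + \<epsilon>) * real n) * e)"
      by simp
    also have "exp ((v + \<epsilon>) * real n) * exp ((v + \<epsilon>) * real n) * e = exp (\<delta> * real n)"
      unfolding e_def exp_add[symmetric] by (simp add: \<epsilon>_def algebra_simps)
    finally show ?case .
  qed
  then show "\<exists>K. \<forall>\<^sub>F n in sequentially. cosh (hdist (x n) (y n)) \<le> K * exp (\<delta> * real n)"
    by blast
qed (use X.v in simp)

text \<open>Orthogonality gives proportionality, and the common height 1 over \<open>z\<close> fixes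
  the factor. The product is thus a numerical test for coincident ends.\<close>

lemma ends_eq_iff: "X.N = Y.N \<longleftrightarrow> mink X.N Y.N = 0"
proof
  assume "mink X.N Y.N = 0"
  then have eq: "Y.N = (fst Y.N / fst X.N) *\<^sub>R X.N"
    using X.N_null X.N_pos Y.N_null Y.N_pos null_orthogonal_imp_proportional by blast
  then have "mink (hyp z) Y.N = (fst Y.N / fst X.N) * mink (hyp z) X.N"
    by (metis mink_scaleR_right)
  then show "X.N = Y.N"
    using eq X.mink_z_N Y.mink_z_N by simp
qed (simp add: Y.N_null)

lemma mink_ends_nonneg: "mink X.N Y.N \<ge> 0"
  using X.N_null X.N_pos Y.N_null Y.N_pos by (intro mink_null_nonneg) auto

text \<open>The common factor that brings the product of the ends to 1/2, as unit speed requires.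
  Using the same factor on both ends keeps their heights over \<open>z\<close> equal, so that
  parameter 0 is nearest to \<open>z\<close>.\<close>

definition k where "k = 1 / sqrt (2 * mink X.N Y.N)"

lemma connecting_hgeod:
  assumes "X.N \<noteq> Y.N"
  shows "hgeod (geo (k *\<^sub>R X.N) (k *\<^sub>R Y.N)) (k *\<^sub>R X.N) (k *\<^sub>R Y.N)"
proof -
  have pos: "mink X.N Y.N > 0"
    using assms ends_eq_iff mink_ends_nonneg by simp
  then have "k > 0" "k * k = 1 / (2 * mink X.N Y.N)"
    by (simp_all add: k_def)
  then show ?thesis
    using pos X.N_null X.N_pos Y.N_null Y.N_pos
    by (intro hgeod_geo) (simp_all add: mink_simps flip: mult.assoc)
qed

lemma connecting_tracks:
  assumes "X.N \<noteq> Y.N"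
  defines "c \<equiv> geo (k *\<^sub>R X.N) (k *\<^sub>R Y.N)"
  shows "(\<lambda>n. hdist (x n) (c (real n * v)) / real n) \<longlonglongrightarrow> 0"
    "(\<lambda>n. hdist (y n) (c (- real n * v)) / real n) \<longlonglongrightarrow> 0"
    "hdist z (c 0) = (INF t. hdist z (c t))"
  using X.tracking[OF connecting_hgeod] Y.tracking[OF hgeod_reverse[OF connecting_hgeod]] assms
    hgeod_nearest_iff[OF connecting_hgeod X.z] X.mink_z_N Y.mink_z_N
  by (simp_all add: mink_simps)

text \<open>The points of the geodesic at times n v and - n v are exactly 2 v n apart, and the
  triangle inequality in both directions transfers this to the orbits with error o(n).\<close>

lemma tracked_imp_apart:
  assumes c: "hgeod c N' M'"
    and "(\<lambda>n. hdist (x n) (c (real n * v)) / real n) \<longlonglongrightarrow> 0"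
    and "(\<lambda>n. hdist (y n) (c (- real n * v)) / real n) \<longlonglongrightarrow> 0"
  shows "(\<lambda>n. hdist (x n) (y n) / real n) \<longlonglongrightarrow> 2 * v"
proof -
  define e where "e n = hdist (x n) (c (real n * v)) / real n + hdist (y n) (c (- real n * v)) / real n" for n
  have "e \<longlonglongrightarrow> 0 + 0"
    unfolding e_def by (intro tendsto_add assms)
  then have e: "e \<longlonglongrightarrow> 0"
    by simp
  have "norm (hdist (x n) (y n) / real n - 2 * v) \<le> e n" if "n > 0" for n
  proof -
    define p q where "p = c (real n * v)" and "q = c (- real n * v)"
    have pos: "Im p > 0" "Im q > 0"
      using hgeodD(5)[OF c] by (simp_all add: p_def q_def)
    have "hdist p q = 2 * v * real n"
      using X.v by (simp add: p_def q_def hgeod_hdist[OF c] abs_mult)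
    moreover have "hdist (x n) (y n) \<le> hdist (x n) p + hdist p q + hdist (y n) q"
      using hdist_triangle[OF X.x pos(1) Y.x, of n n] hdist_triangle[OF pos Y.x, of n]
      by (simp add: hdist_commute)
    moreover have "hdist p q \<le> hdist (x n) p + hdist (x n) (y n) + hdist (y n) q"
      using hdist_triangle[OF pos(1) X.x pos(2), of n] hdist_triangle[OF X.x Y.x pos(2), of n n]
      by (simp add: hdist_commute)
    ultimately have "\<bar>hdist (x n) (y n) - 2 * v * real n\<bar> \<le> hdist (x n) p + hdist (y n) q"
      by linarith
    then have "\<bar>hdist (x n) (y n) - 2 * v * real n\<bar> / real n \<le> (hdist (x n) p + hdist (y n) q) / real n"
      by (rule divide_right_mono) simp
    moreover have "hdist (x n) (y n) / real n - 2 * v = (hdist (x n) (y n) - 2 * v * real n) / real n"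
      using that by (simp add: diff_divide_distrib)
    ultimately show ?thesis
      by (simp add: e_def p_def q_def add_divide_distrib)
  qed
  then have "\<forall>\<^sub>F n in sequentially. norm (hdist (x n) (y n) / real n - 2 * v) \<le> e n"
    by (intro eventually_mono[OF eventually_gt_at_top[of 0]])
  from Lim_null_comparison[OF this e] show ?thesis
    by (simp add: Lim_null[symmetric])
qed

lemma tracked_imp_ends_neq:
  assumes "hgeod c N' M'"
    and "(\<lambda>n. hdist (x n) (c (real n * v)) / real n) \<longlonglongrightarrow> 0"
    and "(\<lambda>n. hdist (y n) (c (- real n * v)) / real n) \<longlonglongrightarrow> 0"
  shows "X.N \<noteq> Y.N"
proof
  assume "X.N = Y.N"
  then show False
    using LIMSEQ_unique[OF same_end_imp_sublinear tracked_imp_apart[OF assms]] X.v by simp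
qed

text \<open>Together with \<open>same_end_imp_sublinear\<close> this is a dichotomy: the mutual
  distance of the two half-orbits has linear rate 0 or 2 v, nothing in between.\<close>

lemma ends_neq_imp_apart:
  assumes "X.N \<noteq> Y.N"
  shows "(\<lambda>n. hdist (x n) (y n) / real n) \<longlonglongrightarrow> 2 * v"
  using tracked_imp_apart[OF connecting_hgeod connecting_tracks(1,2)] assms by blast

end

section \<open>Lifting to coverings of metric spaces\<close>

text \<open>The lifting theorems of the library are stated for subsets of normed spaces. A metric space
  embeds isometrically into the space of bounded continuous functions on it (Kuratowski).\<close>

definition kuratowski :: "'a \<Rightarrow> 'a::metric_space \<Rightarrow> ('a \<Rightarrow>\<^sub>C real)"
  where "kuratowski a x = Bcontfun (\<lambda>y. dist x y - dist a y)"

lemma kuratowski_apply: "apply_bcontfun (kuratowski a x) = (\<lambda>y. dist x y - dist a y)"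
proof -
  have "\<bar>dist x y - dist a y\<bar> \<le> dist x a" for y
    using dist_triangle[of x y a] dist_triangle[of a y x] by (simp add: dist_commute)
  then have "(\<lambda>y. dist x y - dist a y) \<in> bcontfun"
    unfolding bcontfun_def bounded_iff by (auto intro!: continuous_intros)
  then show ?thesis
    by (simp add: kuratowski_def Bcontfun_inverse)
qed

lemma dist_kuratowski: "dist (kuratowski a x) (kuratowski a x') = dist x x'"
proof (rule antisym)
  show "dist (kuratowski a x) (kuratowski a x') \<le> dist x x'"
  proof (rule dist_bound)
    show "dist (kuratowski a x y) (kuratowski a x' y) \<le> dist x x'" for y
      using dist_triangle[of x y x'] dist_triangle[of x' y x]
      by (simp add: kuratowski_apply dist_real_def dist_commute)
  qed
  show "dist x x' \<le> dist (kuratowski a x) (kuratowski a x')"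
    using dist_bounded[of "kuratowski a x" x' "kuratowski a x'"]
    by (simp add: kuratowski_apply dist_real_def)
qed

lemma continuous_on_kuratowski:
  "continuous_on A f \<Longrightarrow> continuous_on A (\<lambda>x. kuratowski a (f x))"
  by (simp add: continuous_on_def tendsto_iff dist_kuratowski)

lemma kuratowski_inject: "kuratowski a x = kuratowski a y \<longleftrightarrow> x = y"
  by (metis dist_kuratowski dist_eq_0_iff)

lemma homeomorphism_kuratowski:
  "homeomorphism A (kuratowski a ` A) (kuratowski a) (inv (kuratowski a))"
proof
  have inv: "inv (kuratowski a) (kuratowski a x) = x" for x
    by (rule inv_f_f) (simp add: inj_def kuratowski_inject)
  show "continuous_on (kuratowski a ` A) (inv (kuratowski a))"
    unfolding continuous_on_iff by (auto simp: inv dist_kuratowski)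
qed (auto intro!: continuous_on_kuratowski continuous_on_id simp: inv_f_f inj_def kuratowski_inject)

lemma covering_space_compose_homeomorphism:
  assumes cov: "covering_space C p S" and h: "homeomorphism S S' h k"
  shows "covering_space C (h \<circ> p) S'"
proof
  have pC: "p ` C = S" and hS: "h ` S = S'" "k ` S' = S"
    using covering_space_imp_surjective[OF cov] h by (auto simp: homeomorphism_def)
  show "continuous_on C (h \<circ> p)"
    using covering_space_imp_continuous[OF cov] h pC
    by (intro continuous_on_compose) (auto simp: homeomorphism_def)
  show "(h \<circ> p) ` C = S'"
    unfolding image_comp[symmetric] pC by (rule hS)
  fix x assume x: "x \<in> S'"
  then have "k x \<in> S"
    using hS by auto
  then obtain T v where T: "k x \<in> T" "openin (top_of_set S) T" and v: "\<Union>v = C \<inter> p -` T"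
    "\<forall>u\<in>v. openin (top_of_set C) u" "pairwise disjnt v" "\<forall>u\<in>v. \<exists>q. homeomorphism u T p q"
    using cov unfolding covering_space_def by blast
  have TS: "T \<subseteq> S"
    using T(2) openin_imp_subset by blast
  have hT: "homeomorphism T (h ` T) h k"
    by (rule homeomorphism_of_subsets[OF h TS]) (use TS hS in auto)
  have "x \<in> h ` T"
    using T(1) x h by (metis homeomorphism_apply2 imageI)
  moreover have "openin (top_of_set S') (h ` T)"
    using homeomorphism_imp_open_map[OF h T(2)] .
  moreover have "\<Union>v = C \<inter> (h \<circ> p) -` (h ` T)"
  proof -
    have "p z \<in> T" if "z \<in> C" "h (p z) \<in> h ` T" for z
    proof -
      have "k (h (p z)) = p z"
        using that(1) pC by (intro homeomorphism_apply1[OF h]) auto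
      moreover have "k (h (p z)) \<in> T"
        using that(2) homeomorphism_apply1[OF hT] by auto
      ultimately show ?thesis
        by simp
    qed
    then show ?thesis
      unfolding v(1) by auto
  qed
  moreover have "\<forall>u\<in>v. \<exists>q. homeomorphism u (h ` T) (h \<circ> p) q"
    using v(4) homeomorphism_compose[OF _ hT] by blast
  ultimately show "\<exists>T. x \<in> T \<and> openin (top_of_set S') T \<and>
      (\<exists>v. \<Union>v = C \<inter> (h \<circ> p) -` T \<and> (\<forall>u\<in>v. openin (top_of_set C) u) \<and> pairwise disjnt v \<and>
        (\<forall>u\<in>v. \<exists>q. homeomorphism u T (h \<circ> p) q))"
    using v(2,3) by blast
qed

lemma covering_space_lift_metric:
  fixes p :: "'b::real_normed_vector \<Rightarrow> 'a::metric_space" and f :: "'c::real_normed_vector \<Rightarrow> 'a"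
  assumes cov: "covering_space C p S" and a: "a \<in> C" "z \<in> U"
    and U: "simply_connected U" "locally path_connected U"
    and f: "continuous_on U f" "f \<in> U \<rightarrow> S" "f z = p a"
  obtains g where "continuous_on U g" "g \<in> U \<rightarrow> C" "g z = a" "\<And>y. y \<in> U \<Longrightarrow> p (g y) = f y"
proof -
  define h :: "'a \<Rightarrow> 'a \<Rightarrow>\<^sub>C real" where "h = kuratowski (f z)"
  have h: "homeomorphism S (h ` S) h (inv h)"
    unfolding h_def by (rule homeomorphism_kuratowski)
  obtain g where g: "continuous_on U g" "g \<in> U \<rightarrow> C" "g z = a" "\<And>y. y \<in> U \<Longrightarrow> (h \<circ> p) (g y) = (h \<circ> f) y"
    by (rule covering_space_lift_strong[OF covering_space_compose_homeomorphism[OF cov h] a U, of "h \<circ> f"])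
      (use f in \<open>auto simp: h_def intro!: continuous_on_kuratowski\<close>)
  show ?thesis
    by (rule that[OF g(1-3)]) (use g(4) in \<open>auto simp: h_def kuratowski_inject\<close>)
qed

lemma covering_space_lift_homotopy_metric:
  fixes p :: "'b::real_normed_vector \<Rightarrow> 'a::metric_space" and h :: "real \<times> 'c::real_normed_vector \<Rightarrow> 'a"
  assumes cov: "covering_space C p S"
    and h: "continuous_on ({0..1} \<times> U) h" "h \<in> ({0..1} \<times> U) \<rightarrow> S"
    and f: "\<And>y. y \<in> U \<Longrightarrow> h (0, y) = p (f y)" "continuous_on U f" "f \<in> U \<rightarrow> C"
  obtains k where "continuous_on ({0..1} \<times> U) k" "k \<in> ({0..1} \<times> U) \<rightarrow> C"
    "\<And>y. y \<in> U \<Longrightarrow> k (0, y) = f y" "\<And>z. z \<in> {0..1} \<times> U \<Longrightarrow> h z = p (k z)"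
proof -
  define e :: "'a \<Rightarrow> 'a \<Rightarrow>\<^sub>C real" where "e = kuratowski (p undefined)"
  have e: "homeomorphism S (e ` S) e (inv e)"
    unfolding e_def by (rule homeomorphism_kuratowski)
  obtain k where k: "continuous_on ({0..1} \<times> U) k" "k \<in> ({0..1} \<times> U) \<rightarrow> C"
    "\<And>y. y \<in> U \<Longrightarrow> k (0, y) = f y" "\<And>z. z \<in> {0..1} \<times> U \<Longrightarrow> (e \<circ> h) z = (e \<circ> p) (k z)"
    by (rule covering_space_lift_homotopy[OF covering_space_compose_homeomorphism[OF cov e],
          where h = "e \<circ> h" and f = f and U = U])
      (use h f in \<open>auto simp: e_def intro!: continuous_on_kuratowski\<close>)
  show ?thesis
    by (rule that[OF k(1-3)]) (use k(4) in \<open>auto simp: e_def kuratowski_inject\<close>)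
qed


section \<open>Moebius transformations as hyperbolic isometries\<close>

lemma open_hplane: "open hplane"
  unfolding hplane_def by (rule open_halfspace_Im_gt)

lemma convex_hplane: "convex hplane"
  unfolding hplane_def by (rule convex_halfspace_Im_gt)

lemma hplane_topology:
  "connected hplane" "simply_connected hplane" "locally path_connected hplane" "\<i> \<in> hplane"
  using convex_hplane open_hplane
  by (auto simp: convex_connected convex_imp_simply_connected open_imp_locally_path_connected)

lemma moebius_hplane:
  fixes a b c d :: real
  assumes det: "a * d - b * c = 1" and z: "Im z > 0"
  shows "of_real c * z + of_real d \<noteq> 0"
    and "Im (moebius (of_real a) (of_real b) (of_real c) (of_real d) z) = Im z / (cmod (of_real c * z + of_real d))\<^sup>2"
proof -
  show nz: "of_real c * z + of_real d \<noteq> 0"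
  proof
    assume *: "of_real c * z + of_real d = 0"
    then have "Im (of_real c * z + of_real d) = 0" "Re (of_real c * z + of_real d) = 0"
      by simp_all
    then have "c = 0" "d = 0"
      using z by auto
    then show False
      using det by simp
  qed
  have "Im (moebius (of_real a) (of_real b) (of_real c) (of_real d) z) =
      ((a * Im z) * (c * Re z + d) - (a * Re z + b) * (c * Im z)) / (cmod (of_real c * z + of_real d))\<^sup>2"
    by (simp add: moebius_def Im_divide cmod_power2)
  also have "(a * Im z) * (c * Re z + d) - (a * Re z + b) * (c * Im z) = (a * d - b * c) * Im z"
    by (simp add: algebra_simps)
  finally show "Im (moebius (of_real a) (of_real b) (of_real c) (of_real d) z) = Im z / (cmod (of_real c * z + of_real d))\<^sup>2"
    by (simp add: det)
qed

lemma moebius_diff: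
  fixes a b c d z w :: complex
  assumes "a * d - b * c = 1" "c * z + d \<noteq> 0" "c * w + d \<noteq> 0"
  shows "moebius a b c d z - moebius a b c d w = (z - w) / ((c * z + d) * (c * w + d))"
proof -
  have "(a * z + b) * (c * w + d) - (a * w + b) * (c * z + d) = (a * d - b * c) * (z - w)"
    by (simp add: algebra_simps)
  then show ?thesis
    using assms by (simp add: moebius_def diff_frac_eq)
qed

lemma orientation_preserving_isometry_hdist:
  assumes "orientation_preserving_isometry g" "Im z > 0" "Im w > 0"
  shows "hdist (g z) (g w) = hdist z w"
proof -
  obtain a b c d :: real where det: "a * d - b * c = 1"
    and g: "\<forall>z\<in>hplane. g z = moebius (of_real a) (of_real b) (of_real c) (of_real d) z"
    using assms(1) unfolding orientation_preserving_isometry_def by blast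
  define m n where "m = cmod (of_real c * z + of_real d)" and "n = cmod (of_real c * w + of_real d)"
  note mz = moebius_hplane[OF det assms(2)] and mw = moebius_hplane[OF det assms(3)]
  have mn: "m > 0" "n > 0"
    using mz(1) mw(1) by (simp_all add: m_def n_def)
  have "complex_of_real a * of_real d - of_real b * of_real c = 1"
    by (metis det of_real_1 of_real_diff of_real_mult)
  then have "cmod (g z - g w) = cmod (z - w) / (m * n)"
    using moebius_diff mz(1) mw(1) g assms(2,3) by (simp add: norm_divide norm_mult m_def n_def)
  moreover have "Im (g z) = Im z / m\<^sup>2" "Im (g w) = Im w / n\<^sup>2"
    using mz(2) mw(2) g assms(2,3) by (simp_all add: m_def n_def)
  ultimately show ?thesis
    using mn unfolding hdist_def by (simp add: power_divide power_mult_distrib)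
qed

lemma orientation_preserving_isometry_deriv:
  assumes "orientation_preserving_isometry g" "Im z > 0"
  shows "(g has_field_derivative deriv g z) (at z)"
proof -
  obtain a b c d :: real where det: "a * d - b * c = 1"
    and g: "\<forall>z\<in>hplane. g z = moebius (of_real a) (of_real b) (of_real c) (of_real d) z"
    using assms(1) unfolding orientation_preserving_isometry_def by blast
  have "moebius (of_real a) (of_real b) (of_real c) (of_real d) field_differentiable at z"
    unfolding moebius_def using moebius_hplane(1)[OF det assms(2)]
    by (intro derivative_intros) auto
  then obtain D where "(moebius (of_real a) (of_real b) (of_real c) (of_real d) has_field_derivative D) (at z)"
    unfolding field_differentiable_def by blast
  then have "(g has_field_derivative D) (at z)"
    by (rule has_field_derivative_transform_within_open[OF _ open_hplane]) (use g assms(2) in auto)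
  then show ?thesis
    using DERIV_imp_deriv by blast
qed

text \<open>A bound on the displacement of \<open>z \<mapsto> (a z + b) / (c z + d)\<close> forces \<open>c z\<^sup>2 + (d - a) z - b\<close>
  to vanish on the boundary.\<close>

lemma bounded_displacement_imp_id:
  assumes g: "orientation_preserving_isometry g"
    and bound: "\<And>z. Im z > 0 \<Longrightarrow> hdist z (g z) \<le> K"
    and z: "Im z > 0"
  shows "g z = z"
proof -
  obtain a b c d :: real where det: "a * d - b * c = 1"
    and g: "\<forall>z\<in>hplane. g z = moebius (of_real a) (of_real b) (of_real c) (of_real d) z"
    using g unfolding orientation_preserving_isometry_def by blast
  define q where "q w = of_real c * w * w + of_real (d - a) * w - of_real b" for w :: complex
  define L where "L = 2 * (cosh K - 1)"
  have q: "(cmod (q w))\<^sup>2 \<le> L * (Im w)\<^sup>2" if w: "Im w > 0" for w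
  proof -
    define m where "m = of_real c * w + of_real d"
    have m: "m \<noteq> 0" and Im: "Im (g w) = Im w / (cmod m)\<^sup>2"
      using moebius_hplane[OF det w] g w by (auto simp: m_def)
    have pos: "Im (g w) > 0"
      using w m by (simp add: Im)
    have "cosh (hdist w (g w)) \<le> cosh K"
      using bound[OF w] hdist_nonneg[OF w pos] by (subst cosh_real_nonneg_le_iff) auto
    then have "(cmod (w - g w))\<^sup>2 / (2 * Im w * Im (g w)) \<le> cosh K - 1"
      using w pos by (simp add: cosh_hdist mink_hyp)
    then have "(cmod (w - g w))\<^sup>2 \<le> L * (Im w)\<^sup>2 / (cmod m)\<^sup>2"
      using w pos m by (simp add: L_def Im field_simps power2_eq_square)
    moreover have "g w * m = of_real a * w + of_real b"
      using g w m by (simp add: moebius_def m_def)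
    \<comment> \<open>Clearing the denominator turns the Euclidean displacement into a polynomial;
      the bound on the hyperbolic displacement makes this polynomial of order Im w.\<close>
    then have "q w = (w - g w) * m"
      by (simp add: q_def left_diff_distrib) (simp add: m_def algebra_simps)
    then have "(cmod (q w))\<^sup>2 = (cmod (w - g w))\<^sup>2 * (cmod m)\<^sup>2"
      by (simp add: norm_mult power_mult_distrib)
    ultimately show ?thesis
      using m by (simp add: field_simps)
  qed
  have q0: "q (of_real x) = 0" for x :: real
  proof -
    have "((\<lambda>y. (cmod (q (Complex x y)))\<^sup>2) \<longlongrightarrow> (cmod (q (Complex x 0)))\<^sup>2) (at_right 0)"
      unfolding q_def Complex_eq by (intro tendsto_intros)
    moreover have "((\<lambda>y. L * y\<^sup>2) \<longlongrightarrow> L * 0\<^sup>2) (at_right 0)"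
      by (intro tendsto_intros)
    moreover have "\<forall>\<^sub>F y in at_right 0. (cmod (q (Complex x y)))\<^sup>2 \<le> L * y\<^sup>2"
      by (rule eventually_mono[OF eventually_at_right_less]) (use q[of "Complex x _"] in simp)
    ultimately have "(cmod (q (Complex x 0)))\<^sup>2 \<le> L * 0\<^sup>2"
      using tendsto_le trivial_limit_at_right_real by blast
    then show ?thesis
      by (simp add: complex_of_real_def)
  qed
  have real: "c * x * x + (d - a) * x - b = 0" for x
    using q0[of x] unfolding q_def by (metis of_real_add of_real_diff of_real_eq_0_iff of_real_mult)
  \<comment> \<open>A polynomial of degree at most two with three zeros vanishes. The determinant
    then leaves a = d = 1 or a = d = -1, both of which act trivially.\<close>
  have "b = 0" "c = 0" "d = a"
    using real[of 0] real[of 1] real[of "-1"] by auto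
  then show ?thesis
    using det g z by (auto simp: moebius_def)
qed


section \<open>The deck group\<close>

locale hyperbolic_surface =
  fixes S :: "'a::metric_space set" and p :: "complex \<Rightarrow> 'a"
  assumes surface: "closed_orientable_hyperbolic_surface S p"
begin

lemma compact_S: "compact S"
  and cov: "covering_space hplane p S"
  and dist_p: "z \<in> hplane \<Longrightarrow> w \<in> hplane \<Longrightarrow> dist (p z) (p w) = (INF w'\<in>{w'\<in>hplane. p w' = p w}. hdist z w')"
  and deck_isometry: "g \<in> deck_group p \<Longrightarrow> orientation_preserving_isometry g"
  using surface unfolding closed_orientable_hyperbolic_surface_def by blast+

lemma p_surj: "p ` hplane = S"
  using cov by (rule covering_space_imp_surjective)

lemma p_in_S: "Im z > 0 \<Longrightarrow> p z \<in> S"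
  using p_surj by auto

lemma p_cont: "continuous_on hplane p"
  using cov by (rule covering_space_imp_continuous)

lemma lift_unique:
  fixes g h :: "'c::topological_space \<Rightarrow> complex"
  assumes "g a = h a" "continuous_on T g" "g ` T \<subseteq> hplane" "continuous_on T h" "h ` T \<subseteq> hplane"
    and "\<And>x. x \<in> T \<Longrightarrow> p (g x) = p (h x)" "connected T" "a \<in> T" "x \<in> T"
  shows "g x = h x"
proof (rule covering_space_lift_unique[OF cov, where f = "p \<circ> g"])
  show "continuous_on T (p \<circ> g)"
    using assms by (intro continuous_on_compose continuous_on_subset[OF p_cont]) auto
qed (use assms p_in_S in auto)

lemma deckD:
  assumes "g \<in> deck_group p"
  shows "z \<in> hplane \<Longrightarrow> Im (g z) > 0" "z \<in> hplane \<Longrightarrow> p (g z) = p z" "continuous_on hplane g"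
  using assms unfolding deck_group_def homeomorphism_def by (auto simp: hplane_def)

lemma deck_hdist:
  "g \<in> deck_group p \<Longrightarrow> Im z > 0 \<Longrightarrow> Im w > 0 \<Longrightarrow> hdist (g z) (g w) = hdist z w"
  using deck_isometry orientation_preserving_isometry_hdist by blast

text \<open>The half-plane is simply connected, so \<open>p\<close> lifts through itself to a map
  taking z to w and to one taking w to z. The two composites are lifts of \<open>p\<close> with a
  fixed point, hence identities.\<close>

lemma deck_transitive:
  assumes z: "Im z > 0" and w: "Im w > 0" and eq: "p z = p w"
  obtains g where "g \<in> deck_group p" "g z = w"
proof -
  have *: "\<exists>g. continuous_on hplane g \<and> g \<in> hplane \<rightarrow> hplane \<and> g z = w \<and> (\<forall>y\<in>hplane. p (g y) = p y)"
    if "Im z > 0" "Im w > 0" "p z = p w" for z w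
    by (rule covering_space_lift_metric[OF cov, of w z hplane p])
      (use that hplane_topology p_cont p_in_S in auto)
  obtain g where g: "continuous_on hplane g" "g \<in> hplane \<rightarrow> hplane" "g z = w" "\<forall>y\<in>hplane. p (g y) = p y"
    using *[OF z w eq] by blast
  obtain h where h: "continuous_on hplane h" "h \<in> hplane \<rightarrow> hplane" "h w = z" "\<forall>y\<in>hplane. p (h y) = p y"
    using *[OF w z eq[symmetric]] by blast
  have **: "h (g y) = y"
    if g: "continuous_on hplane g" "g \<in> hplane \<rightarrow> hplane" "\<forall>y\<in>hplane. p (g y) = p y"
      and h: "continuous_on hplane h" "h \<in> hplane \<rightarrow> hplane" "\<forall>y\<in>hplane. p (h y) = p y"
      and a: "h (g a) = a" "Im a > 0" "Im y > 0" for g h a y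
  proof (rule lift_unique[where T = hplane and a = a and g = "\<lambda>y. h (g y)" and h = "\<lambda>y. y"])
    show "continuous_on hplane (\<lambda>y. h (g y))"
      using continuous_on_compose2[OF h(1) g(1)] g(2) by (auto simp del: hplane_iff)
    show "p (h (g x)) = p x" if "x \<in> hplane" for x
      using g(2,3) h(3) that by (metis PiE)
  qed (use a g(2) h(2) hplane_topology(1) in \<open>auto simp: Pi_iff\<close>)
  have "h (g y) = y" "g (h y) = y" if "y \<in> hplane" for y
    using **[of g h z y] **[of h g w y] that g h z w by auto
  then have "homeomorphism hplane hplane g h"
    using g h by (intro homeomorphismI) auto
  then have "g \<in> deck_group p"
    using g(4) unfolding deck_group_def by blast
  then show ?thesis
    using that g(3) by blast
qed

lemma inv_into_p:
  assumes "x \<in> S"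
  shows "Im (inv_into hplane p x) > 0" "p (inv_into hplane p x) = x"
  using inv_into_into[of x p hplane] f_inv_into_f[of x p hplane] assms p_surj by auto

text \<open>Transitivity on fibres makes the value independent of the lift. Since \<open>p\<close>
  is an open map, the preimage of an open set downstairs is the image of an open set
  upstairs.\<close>

lemma continuous_invariant_descends:
  fixes \<phi> :: "complex \<Rightarrow> 'b::topological_space"
  assumes \<phi>: "continuous_on hplane \<phi>"
    and inv: "\<And>z g. Im z > 0 \<Longrightarrow> g \<in> deck_group p \<Longrightarrow> \<phi> (g z) = \<phi> z"
  obtains \<psi> where "continuous_on S \<psi>" "\<And>z. Im z > 0 \<Longrightarrow> \<psi> (p z) = \<phi> z"
proof -
  define \<psi> where "\<psi> x = \<phi> (inv_into hplane p x)" for x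
  have eq: "\<psi> (p z) = \<phi> z" if z: "Im z > 0" for z
  proof -
    obtain g where "g \<in> deck_group p" "g z = inv_into hplane p (p z)"
      using deck_transitive[OF z inv_into_p(1)[OF p_in_S[OF z]]] inv_into_p(2)[OF p_in_S[OF z]] by metis
    then show ?thesis
      unfolding \<psi>_def using inv[OF z] by metis
  qed
  have "continuous_on S \<psi>"
  proof (subst continuous_on_open_gen[of _ _ UNIV], simp, intro allI impI)
    fix U :: "'b set" assume "openin (top_of_set UNIV) U"
    then have "openin (top_of_set hplane) (hplane \<inter> \<phi> -` U)"
      using \<phi> by (simp add: continuous_openin_preimage_gen)
    then have "openin (top_of_set S) (p ` (hplane \<inter> \<phi> -` U))"
      by (rule covering_space_open_map[OF cov])
    also have "p ` (hplane \<inter> \<phi> -` U) = S \<inter> \<psi> -` U"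
      using eq p_in_S p_surj by (auto simp: image_iff)
    finally show "openin (top_of_set S) (S \<inter> \<psi> -` U)" .
  qed
  then show ?thesis
    using that eq by blast
qed

end

section \<open>The canonical lift\<close>

context hyperbolic_surface
begin

lemma invariant_bounded:
  fixes \<phi> :: "complex \<Rightarrow> real"
  assumes "continuous_on hplane \<phi>"
    and "\<And>z g. Im z > 0 \<Longrightarrow> g \<in> deck_group p \<Longrightarrow> \<phi> (g z) = \<phi> z"
  obtains K where "\<And>z. Im z > 0 \<Longrightarrow> \<phi> z \<le> K"
proof -
  obtain \<psi> where \<psi>: "continuous_on S \<psi>" "\<And>z. Im z > 0 \<Longrightarrow> \<psi> (p z) = \<phi> z"
    using continuous_invariant_descends assms by blast
  have "bounded (\<psi> ` S)"
    using compact_continuous_image[OF \<psi>(1) compact_S] by (rule compact_imp_bounded)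
  then obtain K where "\<And>x. x \<in> S \<Longrightarrow> \<bar>\<psi> x\<bar> \<le> K"
    unfolding bounded_iff by auto
  then have "\<phi> z \<le> K" if "Im z > 0" for z
    using \<psi>(2)[OF that] p_in_S[OF that] by (metis abs_le_D1)
  then show ?thesis
    by (rule that)
qed

text \<open>A central deck transformation has invariant, hence bounded, displacement.\<close>

lemma deck_center_trivial:
  assumes g: "g \<in> deck_group p"
    and central: "\<And>h z. h \<in> deck_group p \<Longrightarrow> Im z > 0 \<Longrightarrow> g (h z) = h (g z)"
    and z: "Im z > 0"
  shows "g z = z"
proof -
  obtain K where "\<And>z. Im z > 0 \<Longrightarrow> hdist z (g z) \<le> K"
  proof (rule invariant_bounded[of "\<lambda>z. hdist z (g z)"])
    show "continuous_on hplane (\<lambda>z. hdist z (g z))"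
      using deckD[OF g] by (intro continuous_on_hdist continuous_on_id) auto
    show "hdist (h w) (g (h w)) = hdist w (g w)" if "Im w > 0" "h \<in> deck_group p" for w h
      using central[OF that(2,1)] deck_hdist[OF that(2,1), of "g w"] deckD(1)[OF g, of w] that by simp
  qed blast
  then show ?thesis
    using bounded_displacement_imp_id deck_isometry[OF g] z by blast
qed

end

locale surface_homeo = hyperbolic_surface S p for S :: "'a::metric_space set" and p +
  fixes f :: "'a \<Rightarrow> 'a"
  assumes f: "f \<in> Homeo\<^sub>0 S"
begin

definition equivariant_lift :: "(complex \<Rightarrow> complex) \<Rightarrow> bool"
  where "equivariant_lift F \<longleftrightarrow> F \<in> hplane \<rightarrow>\<^sub>E hplane \<and> continuous_on hplane F \<and>
       (\<forall>z\<in>hplane. p (F z) = f (p z)) \<and>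
       (\<forall>g\<in>deck_group p. \<forall>z\<in>hplane. F (g z) = g (F z))"

lemma homotopy:
  obtains h where "continuous_on ({0..1::real} \<times> S) h" "h \<in> {0..1} \<times> S \<rightarrow> S"
    "\<And>x. h (0, x) = x" "\<And>x. h (1, x) = f x" "\<exists>f'. homeomorphism S S f f'"
proof -
  obtain h where h: "continuous_map (prod_topology (top_of_set {0..1::real}) (top_of_set S)) (top_of_set S) h"
    "\<forall>x. h (0, x) = id x" "\<forall>x. h (1, x) = f x"
    "\<forall>t\<in>{0..1}. \<exists>g'. homeomorphism S S (\<lambda>x. h (t, x)) g'"
    using f unfolding Homeo\<^sub>0_def homotopic_with_def by blast
  have "continuous_on ({0..1} \<times> S) h" "h \<in> {0..1} \<times> S \<rightarrow> S"
    using h(1) by (auto simp: Pi_iff)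
  moreover have "(\<lambda>x. h (1, x)) = f"
    using h(3) by auto
  then have "\<exists>f'. homeomorphism S S f f'"
    using bspec[OF h(4), of 1] by simp
  ultimately show ?thesis
    using that h(2,3) by simp
qed

text \<open>The isotopy lifts to one starting at the identity, and its time-one map lifts f.
  Commutation with the deck group is trivial at time 0 and persists by uniqueness of path
  lifting.\<close>

lemma equivariant_lift_exists: "\<exists>F. equivariant_lift F"
proof -
  obtain h where h: "continuous_on ({0..1::real} \<times> S) h" "h \<in> {0..1} \<times> S \<rightarrow> S"
    "\<And>x. h (0, x) = x" "\<And>x. h (1, x) = f x"
    by (rule homotopy) blast
  have cont: "continuous_on ({0..1} \<times> hplane) (\<lambda>u. h (fst u, p (snd u)))"
    using p_in_S
    by (intro continuous_on_compose2[OF h(1)] continuous_intros continuous_on_compose2[OF p_cont]) auto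
  obtain k where k: "continuous_on ({0..1} \<times> hplane) k" "k \<in> ({0..1} \<times> hplane) \<rightarrow> hplane"
    "\<And>y. y \<in> hplane \<Longrightarrow> k (0, y) = y"
    "\<And>u. u \<in> {0..1} \<times> hplane \<Longrightarrow> h (fst u, p (snd u)) = p (k u)"
    by (rule covering_space_lift_homotopy_metric[OF cov cont, of "\<lambda>y. y"])
      (use h p_in_S in \<open>auto simp: Pi_iff\<close>)
  have kcont: "continuous_on A (\<lambda>u. k (a u, b u))"
    if "continuous_on A a" "continuous_on A b" "a ` A \<subseteq> {0..1}" "b ` A \<subseteq> hplane" for A a b
    using that by (intro continuous_on_compose2[OF k(1)] continuous_intros) (auto simp del: hplane_iff)
  have kin: "Im (k (t, z)) > 0" if "t \<in> {0..1}" "Im z > 0" for t z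
    using k(2) that by (auto simp: Pi_iff)
  \<comment> \<open>Both sides, with 1 replaced by t, lift the same path in \<open>S\<close> and
    start at \<open>g z\<close>.\<close>
  have comm: "k (1, g z) = g (k (1, z))" if g: "g \<in> deck_group p" and z: "Im z > 0" for g z
  proof (rule lift_unique[where T = "{0..1}" and a = 0 and g = "\<lambda>t. k (t, g z)" and h = "\<lambda>t. g (k (t, z))"])
    show "k (0, g z) = g (k (0, z))"
      using k(3) deckD(1)[OF g] z by simp
    show "continuous_on {0..1} (\<lambda>t. k (t, g z))"
      using deckD(1)[OF g] z by (intro kcont continuous_intros) auto
    show "continuous_on {0..1} (\<lambda>t. g (k (t, z)))"
      using z kin by (intro continuous_on_compose2[OF deckD(3)[OF g]] kcont continuous_intros) auto
    show "p (k (t, g z)) = p (g (k (t, z)))" if "t \<in> {0..1}" for t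
      using k(4)[of "(t, g z)"] k(4)[of "(t, z)"] kin[OF that z] that z deckD[OF g] by simp
  qed (use kin z deckD(1)[OF g] in auto)
  define F where "F = restrict (\<lambda>z. k (1, z)) hplane"
  have "continuous_on hplane (\<lambda>z. k (1, z))"
    by (intro kcont continuous_intros) auto
  then have "continuous_on hplane F"
    by (rule continuous_on_eq) (simp add: F_def)
  moreover have "p (F z) = f (p z)" if "Im z > 0" for z
    using k(4)[of "(1, z)"] that h(4) by (simp add: F_def)
  ultimately have "equivariant_lift F"
    using comm kin deckD(1) unfolding equivariant_lift_def by (auto simp: F_def)
  then show ?thesis
    by blast
qed

text \<open>Two lifts of the same map differ by one deck transformation g. Since both commute with
  all deck transformations, g is central and therefore trivial.\<close>

lemma equivariant_lift_unique:
  assumes F: "equivariant_lift F" and F': "equivariant_lift F'"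
  shows "F = F'"
proof (rule extensionalityI[of F hplane])
  have in_hplane: "Im (F z) > 0" "Im (F' z) > 0" if "Im z > 0" for z
    using F F' that by (auto simp: equivariant_lift_def PiE_iff)
  have pF: "p (F z) = f (p z)" "p (F' z) = f (p z)" if "Im z > 0" for z
    using F F' that by (auto simp: equivariant_lift_def)
  have comm: "F (h z) = h (F z)" "F' (h z) = h (F' z)" if "h \<in> deck_group p" "Im z > 0" for h z
    using F F' that by (auto simp: equivariant_lift_def)
  obtain g where g: "g \<in> deck_group p" "g (F \<i>) = F' \<i>"
    using deck_transitive[of "F \<i>" "F' \<i>"] in_hplane[of \<i>] pF[of \<i>] by auto
  have gF: "g (F z) = F' z" if "Im z > 0" for z
  proof (rule lift_unique[where T = hplane and a = \<i> and g = "\<lambda>z. g (F z)" and h = F'])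
    show "continuous_on hplane (\<lambda>z. g (F z))"
      using F in_hplane by (intro continuous_on_compose2[OF deckD(3)[OF g(1)]]) (auto simp: equivariant_lift_def)
    show "continuous_on hplane F'"
      using F' by (simp add: equivariant_lift_def)
  qed (use g in_hplane that pF deckD[OF g(1)] hplane_topology in auto)
  have "g w = w" if "Im w > 0" for w
  proof (rule deck_center_trivial[OF g(1) _ that])
    fix h z assume h: "h \<in> deck_group p" and z: "Im z > 0"
    \<comment> \<open>Both sides equal \<open>F' (h \<i>)\<close>. Uniqueness of lifts then extends
      the commutation from this point to the whole half-plane.\<close>
    have *: "g (h (F \<i>)) = h (g (F \<i>))"
      using comm[OF h, of \<i>] gF[of \<i>] gF[of "h \<i>"] deckD(1)[OF h, of \<i>] by simp
    show "g (h z) = h (g z)"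
    proof (rule lift_unique[where T = hplane and a = "F \<i>" and g = "\<lambda>z. g (h z)" and h = "\<lambda>z. h (g z)"])
      show "continuous_on hplane (\<lambda>z. g (h z))"
        by (rule continuous_on_compose2[OF deckD(3)[OF g(1)] deckD(3)[OF h]]) (use deckD(1)[OF h] in auto)
      show "continuous_on hplane (\<lambda>z. h (g z))"
        by (rule continuous_on_compose2[OF deckD(3)[OF h] deckD(3)[OF g(1)]]) (use deckD(1)[OF g(1)] in auto)
    qed (use * z in_hplane[of \<i>] deckD[OF g(1)] deckD[OF h] hplane_topology in auto)
  qed
  then show "F z = F' z" if "z \<in> hplane" for z
    using gF[of z] in_hplane[of z] that by simp
qed (use F F' in \<open>auto simp: equivariant_lift_def PiE_iff\<close>)

definition F where "F = canonical_lift p f"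
definition FI where "FI = inv_into hplane F"

lemma equivariant_lift_F: "equivariant_lift F"
proof -
  have "\<exists>!F. equivariant_lift F"
    using equivariant_lift_exists equivariant_lift_unique by blast
  then show ?thesis
    unfolding F_def canonical_lift_def equivariant_lift_def[symmetric] by (rule theI')
qed

lemma F_hplane: "Im z > 0 \<Longrightarrow> Im (F z) > 0"
  and F_cont: "continuous_on hplane F"
  and p_F: "Im z > 0 \<Longrightarrow> p (F z) = f (p z)"
  and F_deck: "g \<in> deck_group p \<Longrightarrow> Im z > 0 \<Longrightarrow> F (g z) = g (F z)"
  using equivariant_lift_F by (auto simp: equivariant_lift_def PiE_iff)

lemma f_homeo: "homeomorphism S S f (inv_into S f)"
proof -
  obtain f' where f': "homeomorphism S S f f'"
    by (rule homotopy) blast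
  then have "inj_on f S" "f ` S = S"
    unfolding homeomorphism_def by (auto intro: inj_on_inverseI)
  then have "inv_into S f y = f' y" if "y \<in> S" for y
    using f' that unfolding homeomorphism_def by (metis imageI inv_into_f_f)
  then show ?thesis
    by (intro homeomorphism_cong[OF f']) auto
qed

text \<open>\<open>FI\<close> is only a choice of preimages. It is identified with the lift of the
  inverse homeomorphism that sends \<open>F \<i>\<close> to \<i>, because both composites of that
  lift with \<open>F\<close> lift the identity and fix a point.\<close>

lemma
  shows FI_hplane: "Im z > 0 \<Longrightarrow> Im (FI z) > 0"
    and FI_cont: "continuous_on hplane FI"
    and F_FI: "Im z > 0 \<Longrightarrow> F (FI z) = z"
    and FI_F: "Im z > 0 \<Longrightarrow> FI (F z) = z"
proof -
  let ?f' = "inv_into S f"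
  have f': "continuous_on S ?f'" "\<And>x. x \<in> S \<Longrightarrow> ?f' x \<in> S" "\<And>x. x \<in> S \<Longrightarrow> ?f' (f x) = x"
    "\<And>x. x \<in> S \<Longrightarrow> f (?f' x) = x"
    using f_homeo unfolding homeomorphism_def by auto
  have cont: "continuous_on hplane (\<lambda>z. ?f' (p z))"
    using p_in_S by (intro continuous_on_compose2[OF f'(1) p_cont]) auto
  obtain G where G: "continuous_on hplane G" "G \<in> hplane \<rightarrow> hplane" "G (F \<i>) = \<i>"
    "\<And>y. y \<in> hplane \<Longrightarrow> p (G y) = ?f' (p y)"
    by (rule covering_space_lift_metric[OF cov, of \<i> "F \<i>" hplane "\<lambda>z. ?f' (p z)"])
      (use cont hplane_topology F_hplane p_in_S f' p_F in auto)
  have G': "Im (G z) > 0" "p (G z) = ?f' (p z)" if "Im z > 0" for z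
    using G that by (auto simp: Pi_iff)
  have FG: "F (G z) = z" if "Im z > 0" for z
  proof (rule lift_unique[where T = hplane and a = "F \<i>" and g = "\<lambda>z. F (G z)" and h = "\<lambda>z. z"])
    show "continuous_on hplane (\<lambda>z. F (G z))"
      by (rule continuous_on_compose2[OF F_cont G(1)]) (use G' in auto)
  qed (use that G' F_hplane G(3) p_F f' p_in_S hplane_topology in auto)
  have GF: "G (F z) = z" if "Im z > 0" for z
  proof (rule lift_unique[where T = hplane and a = \<i> and g = "\<lambda>z. G (F z)" and h = "\<lambda>z. z"])
    show "continuous_on hplane (\<lambda>z. G (F z))"
      by (rule continuous_on_compose2[OF G(1) F_cont]) (use F_hplane in auto)
  qed (use that G' F_hplane G(3) p_F f' p_in_S hplane_topology in auto)
  have eq: "FI z = G z" if "Im z > 0" for z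
  proof -
    have "inj_on F hplane"
      using GF by (intro inj_on_inverseI[of _ G]) auto
    then have "FI (F (G z)) = G z"
      unfolding FI_def using G'(1)[OF that] by (intro inv_into_f_f) auto
    then show ?thesis
      by (simp add: FG[OF that])
  qed
  show "Im (FI z) > 0" "F (FI z) = z" if "Im z > 0"
    using eq[OF that] G'[OF that] FG[OF that] by simp_all
  show "FI (F z) = z" if "Im z > 0"
    using eq[OF F_hplane[OF that]] GF[OF that] by simp
  show "continuous_on hplane FI"
    using G(1) by (rule continuous_on_eq) (use eq in auto)
qed

lemma p_FI: "Im z > 0 \<Longrightarrow> p (FI z) = inv_into S f (p z)"
  using p_F[OF FI_hplane, of z] F_FI[of z] f_homeo p_in_S[OF FI_hplane, of z]
  unfolding homeomorphism_def by metis

lemma FI_deck: "g \<in> deck_group p \<Longrightarrow> Im z > 0 \<Longrightarrow> FI (g z) = g (FI z)"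
  using F_deck[of g "FI z"] FI_hplane[of z] F_FI[of z] FI_F[of "g (FI z)"] deckD(1)[of g "FI z"] by simp

lemma f_S: "x \<in> S \<Longrightarrow> f x \<in> S" and finv_S: "x \<in> S \<Longrightarrow> inv_into S f x \<in> S"
  and finv_f: "x \<in> S \<Longrightarrow> inv_into S f (f x) = x"
  and f_cont: "continuous_on S f"
  using f_homeo unfolding homeomorphism_def by auto

lemma pow_hplane: "Im z > 0 \<Longrightarrow> Im ((F ^^ n) z) > 0" "Im z > 0 \<Longrightarrow> Im ((FI ^^ n) z) > 0"
  by (induction n) (auto simp: F_hplane FI_hplane)

lemma pow_deck:
  assumes "g \<in> deck_group p" "Im z > 0"
  shows "(F ^^ n) (g z) = g ((F ^^ n) z)" "(FI ^^ n) (g z) = g ((FI ^^ n) z)"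
  by (induction n) (use assms in \<open>auto simp: F_deck FI_deck pow_hplane\<close>)

lemma pow_cont: "continuous_on hplane (F ^^ n)" "continuous_on hplane (FI ^^ n)"
proof (induction n)
  case (Suc n)
  show "continuous_on hplane (F ^^ Suc n)" "continuous_on hplane (FI ^^ Suc n)"
    using Suc pow_hplane continuous_on_compose2[OF F_cont, of hplane "F ^^ n"]
      continuous_on_compose2[OF FI_cont, of hplane "FI ^^ n"] by (auto simp: o_def image_subset_iff)
qed auto

lemma p_pow:
  assumes "Im z > 0"
  shows "p ((F ^^ n) z) = (f ^^ n) (p z)" "p ((FI ^^ n) z) = (inv_into S f ^^ n) (p z)"
  by (induction n) (use assms in \<open>auto simp: p_F p_FI pow_hplane\<close>)

lemma F_pow_FI_pow: "Im z > 0 \<Longrightarrow> (F ^^ n) ((FI ^^ n) z) = z"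
proof (induction n)
  case (Suc n)
  have "(F ^^ Suc n) ((FI ^^ Suc n) z) = (F ^^ n) (F (FI ((FI ^^ n) z)))"
    by (subst funpow_Suc_right) simp
  then show ?case
    using Suc by (simp add: F_FI pow_hplane)
qed simp

section \<open>Rotation speed in terms of lifted orbits\<close>

lemma displacement_p:
  assumes z: "Im z > 0"
  shows "displacement p f n (p z) = hdist z ((F ^^ n) z)"
proof -
  define w where "w = inv_into hplane p (p z)"
  have w: "Im w > 0" "p w = p z"
    using inv_into_p[OF p_in_S[OF z]] by (simp_all add: w_def)
  obtain g where "g \<in> deck_group p" "g z = w"
    using deck_transitive[OF z w(1) w(2)[symmetric]] by blast
  then have "hdist w ((F ^^ n) w) = hdist z ((F ^^ n) z)"
    using pow_deck(1) deck_hdist z pow_hplane by metis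
  then show ?thesis
    by (simp add: displacement_def w_def F_def Let_def)
qed

text \<open>The n-th backward image of \<open>z\<close> lies over the n-th backward image of
  \<open>p z\<close>, and n steps of \<open>F\<close> bring it back to \<open>z\<close>. The second
  limit in the rotation speed is thus the drift of the backward orbit seen from
  \<open>z\<close>.\<close>

lemma displacement_backwards:
  assumes z: "Im z > 0"
  shows "displacement p f n ((inv_into S f ^^ n) (p z)) = hdist z ((FI ^^ n) z)"
  using displacement_p[OF pow_hplane(2)[OF z], of n n] z
  by (simp add: p_pow F_pow_FI_pow hdist_commute)

lemma has_rotation_speed_iff:
  assumes "Im z > 0"
  shows "has_rotation_speed S p f (p z) v \<longleftrightarrow>
    (\<lambda>n. hdist z ((F ^^ n) z) / real n) \<longlonglongrightarrow> v \<and> (\<lambda>n. hdist z ((FI ^^ n) z) / real n) \<longlonglongrightarrow> v"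
  using assms by (simp add: has_rotation_speed_def displacement_p displacement_backwards)

lemma has_rotation_speed_unique:
  "has_rotation_speed S p f x v \<Longrightarrow> has_rotation_speed S p f x v' \<Longrightarrow> v = v'"
  unfolding has_rotation_speed_def using LIMSEQ_unique by blast

lemma tracks_iff:
  "tracks p f v z c \<longleftrightarrow> (\<lambda>n. hdist ((F ^^ n) z) (c (real n * v)) / real n) \<longlonglongrightarrow> 0 \<and>
    (\<lambda>n. hdist ((FI ^^ n) z) (c (- real n * v)) / real n) \<longlonglongrightarrow> 0"
  by (simp add: tracks_def F_def FI_def Let_def)

lemma tracks_deck:
  assumes "tracks p f v z c" "g \<in> deck_group p" "Im z > 0" "\<And>t. Im (c t) > 0"
  shows "tracks p f v (g z) (\<lambda>t. g (c t))"
  using assms by (simp add: tracks_iff pow_deck deck_hdist pow_hplane)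

lemma bounded_displacement:
  "\<exists>C. \<forall>z. Im z > 0 \<longrightarrow> hdist z (F z) \<le> C \<and> hdist z (FI z) \<le> C"
proof -
  obtain C where C: "\<And>z. Im z > 0 \<Longrightarrow> hdist z (F z) \<le> C"
  proof (rule invariant_bounded[of "\<lambda>z. hdist z (F z)"])
    show "continuous_on hplane (\<lambda>z. hdist z (F z))"
      using F_hplane F_cont by (intro continuous_on_hdist continuous_on_id) auto
    show "hdist (g z) (F (g z)) = hdist z (F z)" if "Im z > 0" "g \<in> deck_group p" for z g
      using that by (simp add: F_deck deck_hdist F_hplane)
  qed blast
  moreover have "hdist z (FI z) \<le> C" if "Im z > 0" for z
    using C[OF FI_hplane[OF that]] that by (simp add: F_FI hdist_commute)
  ultimately show ?thesis
    by blast
qed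

lemma pow_steps:
  obtains C where "\<And>z n. Im z > 0 \<Longrightarrow> hdist ((F ^^ n) z) ((F ^^ Suc n) z) \<le> C"
    "\<And>z n. Im z > 0 \<Longrightarrow> hdist ((FI ^^ n) z) ((FI ^^ Suc n) z) \<le> C"
proof -
  obtain C where "\<And>z. Im z > 0 \<Longrightarrow> hdist z (F z) \<le> C" "\<And>z. Im z > 0 \<Longrightarrow> hdist z (FI z) \<le> C"
    using bounded_displacement by metis
  then show ?thesis
    by (intro that[of C]) (auto simp: pow_hplane)
qed

text \<open>The constant is uniform over the half-plane, so it serves later as the dominating
  function for the averaged displacements.\<close>

lemma displacement_le:
  obtains C where "C \<ge> 0" "\<And>z n. Im z > 0 \<Longrightarrow> hdist z ((F ^^ n) z) \<le> C * real n"
proof -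
  obtain C where C: "\<And>z. Im z > 0 \<Longrightarrow> hdist z (F z) \<le> C"
    "\<And>z. Im z > 0 \<Longrightarrow> hdist z (FI z) \<le> C"
    using bounded_displacement by metis
  have "hdist z ((F ^^ n) z) \<le> C * real n" if z: "Im z > 0" for z n
  proof (induction n)
    case (Suc n)
    have "hdist z ((F ^^ Suc n) z) \<le> hdist z ((F ^^ n) z) + hdist ((F ^^ n) z) (F ((F ^^ n) z))"
      using hdist_triangle[OF z pow_hplane(1)[OF z] F_hplane[OF pow_hplane(1)[OF z]]] by simp
    also have "\<dots> \<le> C * real n + C"
      using Suc C(1)[OF pow_hplane(1)[OF z]] by (intro add_mono)
    finally show ?case
      by (simp add: algebra_simps)
  qed simp
  moreover have "C \<ge> 0"
    using C(1)[of \<i>] hdist_nonneg[of \<i> "F \<i>"] F_hplane[of \<i>] by simp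
  ultimately show ?thesis
    using that by blast
qed

end

section \<open>Geodesics of the surface\<close>

lemma hgeod_continuous:
  assumes "hgeod c N M"
  shows "continuous_on UNIV c"
  unfolding continuous_on_iff
proof (intro ballI allI impI)
  fix t :: real and e :: real assume "e > 0"
  then obtain d where d: "d > 0" "\<And>w. Im w > 0 \<Longrightarrow> hdist (c t) w < d \<Longrightarrow> dist (c t) w < e"
    using hdist_small_imp_dist_small hgeodD(5)[OF assms] by metis
  show "\<exists>d>0. \<forall>s\<in>UNIV. dist s t < d \<longrightarrow> dist (c s) (c t) < e"
    using d hgeodD(5)[OF assms]
    by (intro exI[of _ d]) (auto simp: hgeod_hdist[OF assms] dist_real_def abs_minus_commute dist_commute)
qed

context hyperbolic_surface
begin

text \<open>Let \<open>p\<close> be injective on the ball of radius d. Points within d/3 of the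
  centre are less than 2d/3 apart, while any further point of the fibre lies outside the ball and so
  at distance more than 2d/3; the infimum defining the quotient distance is attained at
  \<open>w'\<close>.\<close>

lemma p_locally_isometric:
  assumes z: "Im z > 0"
  obtains e where "e > 0" "\<And>w w'. Im w > 0 \<Longrightarrow> Im w' > 0 \<Longrightarrow> hdist z w < e \<Longrightarrow> hdist z w' < e \<Longrightarrow>
    dist (p w) (p w') = hdist w w'"
proof -
  obtain T u q where T: "z \<in> T" "openin (top_of_set hplane) T" "homeomorphism T u p q"
    by (rule covering_space_local_homeomorphism[OF cov, of z]) (use z in auto)
  obtain \<delta> where \<delta>: "\<delta> > 0" "ball z \<delta> \<inter> hplane \<subseteq> T"
    using T(1,2) unfolding openin_contains_ball by blast
  obtain d where d: "d > 0" "\<And>w. Im w > 0 \<Longrightarrow> hdist z w < d \<Longrightarrow> dist z w < \<delta>"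
    using hdist_small_imp_dist_small[OF z \<delta>(1)] by blast
  have inj: "w = w'" if "Im w > 0" "Im w' > 0" "hdist z w < d" "hdist z w' < d" "p w = p w'" for w w'
  proof -
    have "w \<in> T" "w' \<in> T"
      using \<delta>(2) d(2) that by auto
    then show ?thesis
      using T(3) that(5) by (metis homeomorphism_apply1)
  qed
  show ?thesis
  proof (rule that[of "d / 3"])
    fix w w' assume w: "Im w > 0" "Im w' > 0" "hdist z w < d / 3" "hdist z w' < d / 3"
    define A where "A = {w''\<in>hplane. p w'' = p w'}"
    have least: "hdist w w' \<le> hdist w w''" if "w'' \<in> A" for w''
    proof (cases "hdist z w'' < d")
      case True
      then have "w'' = w'"
        using inj[of w'' w'] w that d(1) by (auto simp: A_def)
      then show ?thesis
        by simp
    next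
      case False
      have "Im w'' > 0"
        using that by (simp add: A_def)
      then have "hdist z w'' \<le> hdist z w + hdist w w''" "hdist w w' \<le> hdist w z + hdist z w'"
        using z w by (auto intro: hdist_triangle)
      then show ?thesis
        using False w by (simp add: hdist_commute)
    qed
    have "(INF w''\<in>A. hdist w w'') = hdist w w'"
    proof (rule antisym)
      show "(INF w''\<in>A. hdist w w'') \<le> hdist w w'"
        using w by (intro cINF_lower bdd_belowI[of _ 0]) (auto simp: A_def intro: hdist_nonneg)
      show "hdist w w' \<le> (INF w''\<in>A. hdist w w'')"
        using least w by (intro cINF_greatest) (auto simp: A_def)
    qed
    then show "dist (p w) (p w') = hdist w w'"
      using dist_p w by (simp add: A_def)
  qed (use d in simp)
qed

lemma is_path_liftD:
  assumes "is_path_lift p \<gamma> c"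
  shows "continuous_on UNIV c" "Im (c t) > 0" "p (c t) = \<gamma> t"
  using assms by (auto simp: is_path_lift_def image_subset_iff)

lemma is_path_lift_deck:
  assumes "is_path_lift p \<gamma> c" "g \<in> deck_group p"
  shows "is_path_lift p \<gamma> (\<lambda>t. g (c t))"
  using is_path_liftD[OF assms(1)] deckD[OF assms(2)] continuous_on_compose2[OF deckD(3)[OF assms(2)], of UNIV c]
  unfolding is_path_lift_def by (auto simp: image_subset_iff)

lemma path_lifts_related:
  assumes c: "is_path_lift p \<gamma> c" and c': "is_path_lift p \<gamma> c'"
    and g: "g \<in> deck_group p" "g (c s) = c' s"
  shows "c' = (\<lambda>t. g (c t))"
proof
  fix t
  show "c' t = g (c t)"
    by (rule lift_unique[where T = UNIV and a = s and h = "\<lambda>t. g (c t)"])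
      (use is_path_liftD[OF c'] is_path_liftD[OF is_path_lift_deck[OF c g(1)]] g(2)
        in \<open>auto simp: connected_UNIV\<close>)
qed

text \<open>Continuity keeps short pieces of c inside a ball on which \<open>p\<close> is isometric,
  so c inherits the local isometry property from \<gamma>, and local isometries into the half-plane
  are complete geodesics.\<close>

lemma geodesic_lift_hgeod:
  assumes \<gamma>: "\<gamma> \<in> geodesics S" and c: "is_path_lift p \<gamma> c"
  obtains N M where "hgeod c N M"
proof (rule local_isometry_imp_hgeod)
  note cD = is_path_liftD[OF c]
  show "Im (c t) > 0" for t
    by (rule cD(2))
  fix t
  obtain e where e: "e > 0" "\<And>w w'. Im w > 0 \<Longrightarrow> Im w' > 0 \<Longrightarrow> hdist (c t) w < e \<Longrightarrow>
      hdist (c t) w' < e \<Longrightarrow> dist (p w) (p w') = hdist w w'"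
    using p_locally_isometric[OF cD(2)] by metis
  have "continuous_on UNIV (\<lambda>s. hdist (c t) (c s))"
    using cD by (intro continuous_on_hdist continuous_on_const) auto
  then obtain d where d: "d > 0" "\<And>s. dist s t < d \<Longrightarrow> dist (hdist (c t) (c s)) (hdist (c t) (c t)) < e"
    unfolding continuous_on_iff using e(1) by blast
  obtain b where b: "b > 0" "\<forall>s\<in>ball t b. \<forall>u\<in>ball t b. dist (\<gamma> s) (\<gamma> u) = \<bar>s - u\<bar>"
    using \<gamma> unfolding geodesics_def by blast
  have "hdist (c s) (c u) = \<bar>s - u\<bar>" if "s \<in> ball t (min b d)" "u \<in> ball t (min b d)" for s u
  proof -
    have "hdist (c t) (c s) < e" "hdist (c t) (c u) < e"
      using d(2)[of s] d(2)[of u] that by (auto simp: dist_commute)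
    then have "hdist (c s) (c u) = dist (\<gamma> s) (\<gamma> u)"
      using e(2) cD by metis
    then show ?thesis
      using b(2) that by auto
  qed
  then show "\<exists>e>0. \<forall>s\<in>ball t e. \<forall>u\<in>ball t e. hdist (c s) (c u) = \<bar>s - u\<bar>"
    using b(1) d(1) by (intro exI[of _ "min b d"]) auto
qed (use that in blast)

lemma hgeod_path_lift:
  assumes "hgeod c N M"
  shows "is_path_lift p (\<lambda>t. p (c t)) c"
  using hgeodD(5)[OF assms] hgeod_continuous[OF assms] by (auto simp: is_path_lift_def)

lemma hgeod_projects_to_geodesic:
  assumes c: "hgeod c N M"
  shows "(\<lambda>t. p (c t)) \<in> geodesics S"
  unfolding geodesics_def
proof (intro CollectI conjI allI)
  show "range (\<lambda>t. p (c t)) \<subseteq> S"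
    using hgeodD(5)[OF c] p_in_S by auto
  fix t
  obtain e where e: "e > 0" "\<And>w w'. Im w > 0 \<Longrightarrow> Im w' > 0 \<Longrightarrow> hdist (c t) w < e \<Longrightarrow>
      hdist (c t) w' < e \<Longrightarrow> dist (p w) (p w') = hdist w w'"
    using p_locally_isometric[OF hgeodD(5)[OF c]] by metis
  show "\<exists>e>0. \<forall>s\<in>ball t e. \<forall>u\<in>ball t e. dist (p (c s)) (p (c u)) = \<bar>s - u\<bar>"
    using e hgeodD(5)[OF c] by (intro exI[of _ e]) (auto simp: hgeod_hdist[OF c] dist_real_def)
qed

text \<open>Every lift of the projected curve is a deck translate of c, and the chain rule
  identifies the initial vectors of the translates with the orbit of one vector under the
  differentials.\<close>

lemma initial_velocity_eq:
  assumes c: "hgeod c N M"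
  shows "initial_velocity p (\<lambda>t. p (c t)) = tangent_proj p (c 0, geo_velocity N M)"
proof -
  note lift = hgeod_path_lift[OF c]
  have deriv: "vector_derivative (\<lambda>t. g (c t)) (at 0) = deriv g (c 0) * geo_velocity N M"
    if g: "g \<in> deck_group p" for g
  proof -
    have "(g \<circ> c has_vector_derivative geo_velocity N M * deriv g (c 0)) (at 0)"
      using orientation_preserving_isometry_deriv[OF deck_isometry[OF g] hgeodD(5)[OF c]]
        geo_has_vector_derivative[OF c] by (intro field_vector_diff_chain_at)
    then show ?thesis
      by (simp add: o_def vector_derivative_at mult.commute)
  qed
  have "\<exists>g\<in>deck_group p. c' = (\<lambda>t. g (c t))" if c': "is_path_lift p (\<lambda>t. p (c t)) c'" for c'
  proof -
    obtain g where "g \<in> deck_group p" "g (c 0) = c' 0"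
      using deck_transitive[of "c 0" "c' 0"] is_path_liftD[OF c'] hgeodD(5)[OF c] by metis
    then show ?thesis
      using path_lifts_related[OF lift c'] by blast
  qed
  then have lifts: "{c'. is_path_lift p (\<lambda>t. p (c t)) c'} = {\<lambda>t. g (c t) | g. g \<in> deck_group p}"
    using is_path_lift_deck[OF lift] by blast
  have "initial_velocity p (\<lambda>t. p (c t)) =
      (\<lambda>c'. (c' 0, vector_derivative c' (at 0))) ` {c'. is_path_lift p (\<lambda>t. p (c t)) c'}"
    by (auto simp: initial_velocity_def)
  also have "\<dots> = {(g (c 0), vector_derivative (\<lambda>t. g (c t)) (at 0)) | g. g \<in> deck_group p}"
    unfolding lifts by auto
  also have "\<dots> = tangent_proj p (c 0, geo_velocity N M)"
    using deriv by (auto simp: tangent_proj_def)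
  finally show ?thesis .
qed

end

section \<open>Tracking geodesics\<close>

context surface_homeo
begin

definition end_plus :: "complex \<Rightarrow> real \<times> complex"
  where "end_plus z = enddir z (\<lambda>n. (F ^^ n) z)"

definition end_minus :: "complex \<Rightarrow> real \<times> complex"
  where "end_minus z = enddir z (\<lambda>n. (FI ^^ n) z)"

definition end_scale :: "complex \<Rightarrow> real"
  where "end_scale z = 1 / sqrt (2 * mink (end_plus z) (end_minus z))"

definition track_axis :: "complex \<Rightarrow> real \<Rightarrow> complex"
  where "track_axis z = geo (end_scale z *\<^sub>R end_plus z) (end_scale z *\<^sub>R end_minus z)"

lemma rotation_speed_two_drifts:
  assumes z: "Im z > 0" and v: "v > 0" "has_rotation_speed S p f (p z) v"
  obtains C where "two_drifts z (\<lambda>n. (F ^^ n) z) (\<lambda>n. (FI ^^ n) z) v C C"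
proof -
  obtain C where "\<And>n. hdist ((F ^^ n) z) ((F ^^ Suc n) z) \<le> C" "\<And>n. hdist ((FI ^^ n) z) ((FI ^^ Suc n) z) \<le> C"
    using pow_steps z by metis
  then have "two_drifts z (\<lambda>n. (F ^^ n) z) (\<lambda>n. (FI ^^ n) z) v C C"
    using z v has_rotation_speed_iff[OF z] pow_hplane[OF z]
    by (intro two_drifts.intro linear_drift.intro) auto
  then show ?thesis
    by (rule that)
qed

text \<open>The two ends are meaningful only when the rotation speed is positive; otherwise they may be
  junk values of \<open>lim\<close>.\<close>

definition has_axis :: "complex \<Rightarrow> bool"
  where "has_axis z \<longleftrightarrow> Im z > 0 \<and> (\<exists>v>0. has_rotation_speed S p f (p z) v) \<and>
    mink (end_plus z) (end_minus z) \<noteq> 0"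

lemma has_axisE:
  assumes "has_axis z"
  obtains v where "v > 0" "has_rotation_speed S p f (p z) v" "tracks p f v z (track_axis z)"
    "hgeod (track_axis z) (end_scale z *\<^sub>R end_plus z) (end_scale z *\<^sub>R end_minus z)"
    "hdist z (track_axis z 0) = (INF t. hdist z (track_axis z t))"
proof -
  have z: "Im z > 0"
    using assms by (simp add: has_axis_def)
  obtain v where v: "v > 0" "has_rotation_speed S p f (p z) v"
    using assms unfolding has_axis_def by blast
  obtain C where "two_drifts z (\<lambda>n. (F ^^ n) z) (\<lambda>n. (FI ^^ n) z) v C C"
    using rotation_speed_two_drifts[OF z v] by blast
  then interpret two_drifts z "\<lambda>n. (F ^^ n) z" "\<lambda>n. (FI ^^ n) z" v C C .
  have N: "X.N = end_plus z" "Y.N = end_minus z"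
    by (simp_all add: X.N_def Y.N_def end_plus_def end_minus_def)
  have neq: "end_plus z \<noteq> end_minus z"
    using assms ends_eq_iff unfolding N has_axis_def by blast
  have k: "k = end_scale z"
    by (simp add: k_def end_scale_def N)
  note connecting = connecting_hgeod[unfolded N k, OF neq] connecting_tracks[unfolded N k, OF neq]
  note connecting = connecting[folded track_axis_def]
  show ?thesis
    by (rule that[OF v]) (use connecting in \<open>simp_all add: tracks_iff\<close>)
qed

lemma tracking_imp_has_axis:
  assumes \<gamma>: "tracking_geodesic S p f (p z) \<gamma>" and z: "Im z > 0"
  shows "has_axis z"
proof -
  obtain v c where v: "v > 0" "has_rotation_speed S p f (p z) v"
    and c: "is_path_lift p \<gamma> c" "tracks p f v z c" and "\<gamma> \<in> geodesics S"
    using \<gamma> z unfolding tracking_geodesic_def by auto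
  then obtain N M where geod: "hgeod c N M"
    using geodesic_lift_hgeod by blast
  obtain C where "two_drifts z (\<lambda>n. (F ^^ n) z) (\<lambda>n. (FI ^^ n) z) v C C"
    using rotation_speed_two_drifts[OF z v] by blast
  then interpret two_drifts z "\<lambda>n. (F ^^ n) z" "\<lambda>n. (FI ^^ n) z" v C C .
  have "X.N \<noteq> Y.N"
    using tracked_imp_ends_neq[OF geod] c(2) by (simp add: tracks_iff)
  then have "mink (end_plus z) (end_minus z) \<noteq> 0"
    unfolding ends_eq_iff by (simp add: X.N_def Y.N_def end_plus_def end_minus_def)
  then show ?thesis
    using v z by (auto simp: has_axis_def)
qed

text \<open>One lift suffices: a deck transformation commutes with \<open>F\<close> and preserves
  \<open>hdist\<close>, so it carries the axis over \<open>z\<close> to a tracking lift for any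
  other point of the fibre.\<close>

lemma has_axis_imp_normalized:
  assumes "has_axis z"
  shows "normalized_tracking_geodesic S p f (p z) (\<lambda>t. p (track_axis z t))"
proof -
  have z: "Im z > 0"
    using assms by (simp add: has_axis_def)
  obtain v where v: "v > 0" "has_rotation_speed S p f (p z) v" "tracks p f v z (track_axis z)"
    "hgeod (track_axis z) (end_scale z *\<^sub>R end_plus z) (end_scale z *\<^sub>R end_minus z)"
    "hdist z (track_axis z 0) = (INF t. hdist z (track_axis z t))"
    using has_axisE[OF assms] by blast
  note lift = hgeod_path_lift[OF v(4)]
  have "\<exists>c. is_path_lift p (\<lambda>t. p (track_axis z t)) c \<and> tracks p f v w c" if w: "Im w > 0" "p w = p z" for w
  proof -
    obtain g where "g \<in> deck_group p" "g z = w"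
      using deck_transitive[OF z w(1) w(2)[symmetric]] by blast
    then show ?thesis
      using tracks_deck[OF v(3) _ z hgeodD(5)[OF v(4)]] is_path_lift_deck[OF lift] by blast
  qed
  then have "tracking_geodesic S p f (p z) (\<lambda>t. p (track_axis z t))"
    using v hgeod_projects_to_geodesic[OF v(4)] unfolding tracking_geodesic_def by auto
  then show ?thesis
    unfolding normalized_tracking_geodesic_def using v z lift by auto
qed

lemma normalized_tracking_geodesic_unique:
  assumes \<gamma>: "normalized_tracking_geodesic S p f x \<gamma>" and \<gamma>': "normalized_tracking_geodesic S p f x \<gamma>'"
  shows "\<gamma> = \<gamma>'"
proof -
  obtain v z c where v: "has_rotation_speed S p f x v" and z: "Im z > 0" "p z = x"
    and c: "is_path_lift p \<gamma> c" "tracks p f v z c" "hdist z (c 0) = (INF t. hdist z (c t))"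
    and geo: "\<gamma> \<in> geodesics S" and pos: "\<exists>v>0. has_rotation_speed S p f x v"
    using \<gamma> unfolding normalized_tracking_geodesic_def tracking_geodesic_def by auto
  obtain v' z' c' where v': "has_rotation_speed S p f x v'" and z': "Im z' > 0" "p z' = x"
    and c': "is_path_lift p \<gamma>' c'" "tracks p f v' z' c'" "hdist z' (c' 0) = (INF t. hdist z' (c' t))"
    and geo': "\<gamma>' \<in> geodesics S"
    using \<gamma>' unfolding normalized_tracking_geodesic_def tracking_geodesic_def by auto
  have "v' = v" "v > 0"
    using v v' pos has_rotation_speed_unique by metis+
  \<comment> \<open>The two normalizations may be witnessed at different lifts of x; one of them is
    moved so that both curves are compared from the same base point.\<close>
  obtain g where g: "g \<in> deck_group p" "g z' = z"
    using deck_transitive[OF z'(1) z(1)] z z' by metis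
  define d where "d t = g (c' t)" for t
  have d: "is_path_lift p \<gamma>' d" "tracks p f v z d"
    using is_path_lift_deck[OF c'(1) g(1)] tracks_deck[OF c'(2) g(1) z'(1) is_path_liftD(2)[OF c'(1)]] g(2)
    by (simp_all add: d_def[abs_def] \<open>v' = v\<close>)
  have "hdist z (d t) = hdist z' (c' t)" for t
    using deck_hdist[OF g(1) z'(1) is_path_liftD(2)[OF c'(1)]] g(2) by (simp add: d_def)
  then have near: "hdist z (d 0) = (INF t. hdist z (d t))"
    using c'(3) by simp
  obtain N M where cN: "hgeod c N M"
    using geodesic_lift_hgeod[OF geo c(1)] by blast
  obtain N' M' where dN: "hgeod d N' M'"
    using geodesic_lift_hgeod[OF geo' d(1)] by blast
  have lim: "(\<lambda>n. hdist (c (s n)) (d (s n)) / real n) \<longlonglongrightarrow> 0"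
    if "(\<lambda>n. hdist (x n) (c (s n)) / real n) \<longlonglongrightarrow> 0" "(\<lambda>n. hdist (x n) (d (s n)) / real n) \<longlonglongrightarrow> 0"
      "\<And>n. Im (x n) > 0" for x s
  proof (rule tendsto_sandwich[OF _ _ tendsto_const tendsto_add_zero[OF that(1,2)]])
    show "\<forall>\<^sub>F n in sequentially. 0 \<le> hdist (c (s n)) (d (s n)) / real n"
      using hgeodD(5)[OF cN] hgeodD(5)[OF dN] by (simp add: hdist_nonneg)
    have "hdist (c (s n)) (d (s n)) \<le> hdist (x n) (c (s n)) + hdist (x n) (d (s n))" for n
      using hdist_triangle[of "c (s n)" "x n" "d (s n)"] hgeodD(5)[OF cN] hgeodD(5)[OF dN] that(3)
        hdist_commute[of "c (s n)" "x n"] by simp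
    then show "\<forall>\<^sub>F n in sequentially. hdist (c (s n)) (d (s n)) / real n
        \<le> hdist (x n) (c (s n)) / real n + hdist (x n) (d (s n)) / real n"
      by (simp add: divide_right_mono flip: add_divide_distrib)
  qed
  have "c = d"
  proof (rule sublinear_nearest_unique[OF cN dN \<open>v > 0\<close> _ _ z(1) c(3) near])
    show "(\<lambda>n. hdist (c (real n * v)) (d (real n * v)) / real n) \<longlonglongrightarrow> 0"
      by (rule lim[of "\<lambda>n. (F ^^ n) z"]) (use c(2) d(2) pow_hplane[OF z(1)] in \<open>simp_all add: tracks_iff\<close>)
    show "(\<lambda>n. hdist (c (- real n * v)) (d (- real n * v)) / real n) \<longlonglongrightarrow> 0"
      by (rule lim[of "\<lambda>n. (FI ^^ n) z"]) (use c(2) d(2) pow_hplane[OF z(1)] in \<open>simp_all add: tracks_iff\<close>)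
  qed
  then show ?thesis
    using is_path_liftD(3)[OF c(1)] is_path_liftD(3)[OF d(1)] by (metis ext)
qed

lemma tracked_points_iff:
  assumes z: "Im z > 0"
  shows "p z \<in> tracked_points S p f \<longleftrightarrow> has_axis z"
  using tracking_imp_has_axis[OF _ z] has_axis_imp_normalized[of z] p_in_S[OF z]
  by (auto simp: tracked_points_def normalized_tracking_geodesic_def)

definition normalized_geodesic :: "'a \<Rightarrow> real \<Rightarrow> 'a"
  where "normalized_geodesic x = (\<lambda>t. p (track_axis (inv_into hplane p x) t))"

lemma normalized_geodesic_iff:
  assumes "x \<in> tracked_points S p f"
  shows "normalized_tracking_geodesic S p f x \<gamma> \<longleftrightarrow> \<gamma> = normalized_geodesic x"
proof -
  define z where "z = inv_into hplane p x"
  have z: "Im z > 0" "p z = x"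
    using inv_into_p[of x] assms by (simp_all add: z_def tracked_points_def)
  then have "has_axis z"
    using tracked_points_iff assms by blast
  then have "normalized_tracking_geodesic S p f x (normalized_geodesic x)"
    using has_axis_imp_normalized[of z] z(2) by (simp add: normalized_geodesic_def z_def)
  then show ?thesis
    using normalized_tracking_geodesic_unique by blast
qed

text \<open>Uniqueness makes the value independent of the lift chosen by \<open>inv_into\<close>, so
  measurability can be examined at an arbitrary z in the half-plane.\<close>

lemma normalized_geodesic_p:
  assumes "has_axis z"
  shows "normalized_geodesic (p z) = (\<lambda>t. p (track_axis z t))"
proof -
  have "p z \<in> tracked_points S p f"
    using assms tracked_points_iff by (auto simp: has_axis_def)
  then show ?thesis
    using normalized_geodesic_iff has_axis_imp_normalized[OF assms] by metis
qed

end

section \<open>Measurability\<close>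

lemma borel_measurable_fst_comp [measurable]:
  fixes f :: "'a \<Rightarrow> real \<times> complex"
  shows "f \<in> borel_measurable M \<Longrightarrow> (\<lambda>x. fst (f x)) \<in> borel_measurable M"
  by (rule borel_measurable_continuous_on[of fst]) (intro continuous_intros)

lemma borel_measurable_snd_comp [measurable]:
  fixes f :: "'a \<Rightarrow> real \<times> complex"
  shows "f \<in> borel_measurable M \<Longrightarrow> (\<lambda>x. snd (f x)) \<in> borel_measurable M"
  by (rule borel_measurable_continuous_on[of snd]) (intro continuous_intros)

lemma borel_measurable_hyp_inv [measurable]:
  assumes [measurable]: "f \<in> borel_measurable M"
  shows "(\<lambda>x. hyp_inv (f x)) \<in> borel_measurable M"
  unfolding hyp_inv_def Complex_eq by measurable

lemma borel_measurable_geo_velocity [measurable]: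
  assumes [measurable]: "f \<in> borel_measurable M" "g \<in> borel_measurable M"
  shows "(\<lambda>x. geo_velocity (f x) (g x)) \<in> borel_measurable M"
  unfolding geo_velocity_def Let_def Complex_eq by measurable

context hyperbolic_surface
begin

lemma S_borel: "S \<in> sets borel"
  using compact_S by (simp add: borel_compact)

lemma sets_borel_S: "A \<in> sets (restrict_space borel S) \<longleftrightarrow> A \<subseteq> S \<and> A \<in> sets borel"
  using S_borel by (subst sets_restrict_space_iff) auto

text \<open>Over small open sets \<open>p\<close> has continuous inverses, and there
  \<open>A\<close> is the preimage of a Borel set under such an inverse. Compactness of
  \<open>S\<close> leaves finitely many pieces.\<close>

lemma borel_if_preimage_borel:
  assumes A: "A \<subseteq> S" and pA: "{z\<in>hplane. p z \<in> A} \<in> sets (restrict_space borel hplane)"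
  shows "A \<in> sets (restrict_space borel S)"
proof -
  have pA': "{z\<in>hplane. p z \<in> A} \<in> sets borel"
    using pA open_hplane by (simp add: sets_restrict_space_iff)
  have "\<exists>T. x \<in> T \<and> openin (top_of_set S) T \<and> A \<inter> T \<in> sets borel" if x: "x \<in> S" for x
  proof -
    obtain z u T q where T: "x \<in> T" "openin (top_of_set S) T" and q: "homeomorphism u T p q"
      and u: "openin (top_of_set hplane) u"
      by (rule covering_space_local_homeomorphism_alt[OF cov x])
    have T': "T \<in> sets borel"
      using T(2) S_borel unfolding openin_open by (auto intro: sets.Int)
    have "q \<in> borel_measurable (restrict_space borel T)"
      using q by (intro borel_measurable_continuous_on_restrict) (auto simp: homeomorphism_def)
    from measurable_sets[OF this pA'] have "q -` {z\<in>hplane. p z \<in> A} \<inter> T \<in> sets borel"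
      using T' by (simp add: space_restrict_space sets_restrict_space_iff)
    also have "q -` {z\<in>hplane. p z \<in> A} \<inter> T = A \<inter> T"
      using q openin_imp_subset[OF u] unfolding homeomorphism_def by (auto simp del: hplane_iff)
    finally show ?thesis
      using T by blast
  qed
  then obtain T where T: "\<And>x. x \<in> S \<Longrightarrow> x \<in> T x" "\<And>x. x \<in> S \<Longrightarrow> openin (top_of_set S) (T x)"
    "\<And>x. x \<in> S \<Longrightarrow> A \<inter> T x \<in> sets borel"
    by metis
  have "\<forall>x\<in>S. \<exists>W. open W \<and> T x = S \<inter> W"
    using T(2) unfolding openin_open by auto
  then obtain W where W: "\<And>x. x \<in> S \<Longrightarrow> open (W x)" "\<And>x. x \<in> S \<Longrightarrow> T x = S \<inter> W x"
    by metis
  obtain D where D: "D \<subseteq> S" "finite D" "S \<subseteq> (\<Union>x\<in>D. W x)"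
    by (rule compactE_image[OF compact_S, of S W]) (use W T(1) in auto)
  have "A \<inter> T x = A \<inter> W x" if "x \<in> D" for x
    using A D(1) W(2)[of x] that by auto
  then have "(\<Union>x\<in>D. A \<inter> T x) = (\<Union>x\<in>D. A \<inter> W x)"
    by simp
  then have "A = (\<Union>x\<in>D. A \<inter> T x)"
    using A D(3) by auto
  also have "\<dots> \<in> sets borel"
    using D(1,2) T(3) by (intro sets.finite_UN) auto
  finally show ?thesis
    using A by (simp add: sets_borel_S)
qed

end

context surface_homeo
begin

abbreviation "H \<equiv> restrict_space borel hplane :: complex measure"

lemma measurable_hyp_pow:
  "(\<lambda>z. hyp ((F ^^ n) z)) \<in> borel_measurable H" "(\<lambda>z. hyp ((FI ^^ n) z)) \<in> borel_measurable H"
  by (intro borel_measurable_continuous_on_restrict continuous_on_compose2[OF continuous_on_hyp] pow_cont;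
      auto simp: pow_hplane)+

lemma measurable_hdist_pow:
  "(\<lambda>z. hdist z ((F ^^ n) z)) \<in> borel_measurable H" "(\<lambda>z. hdist z ((FI ^^ n) z)) \<in> borel_measurable H"
  by (intro borel_measurable_continuous_on_restrict continuous_on_hdist continuous_on_id pow_cont;
      auto simp: pow_hplane)+

lemma measurable_ends: "end_plus \<in> borel_measurable H" "end_minus \<in> borel_measurable H"
proof -
  have [measurable]: "hyp \<in> borel_measurable H"
    by (intro borel_measurable_continuous_on_restrict continuous_on_hyp)
  note [measurable] = measurable_hyp_pow
  show "end_plus \<in> borel_measurable H" "end_minus \<in> borel_measurable H"
    unfolding end_plus_def[abs_def] end_minus_def[abs_def] enddir_def dirvec_def by measurable
qed

lemma measurable_end_scale: "end_scale \<in> borel_measurable H"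
  using measurable_ends unfolding end_scale_def[abs_def] by measurable

lemma measurable_velocity:
  "(\<lambda>z. (track_axis z 0, geo_velocity (end_scale z *\<^sub>R end_plus z) (end_scale z *\<^sub>R end_minus z)))
    \<in> borel_measurable H"
proof -
  note [measurable] = measurable_ends measurable_end_scale
  show ?thesis
    unfolding track_axis_def geo_def by measurable
qed

text \<open>Removes the quantifier over the uncountably many speeds v in favour of the Cauchy
  property and \<open>lim\<close>, which are measurable for sequences of measurable
  functions.\<close>

lemma common_limit_pos_iff:
  fixes a b :: "nat \<Rightarrow> real"
  shows "(\<exists>v>0. a \<longlonglongrightarrow> v \<and> b \<longlonglongrightarrow> v) \<longleftrightarrow> Cauchy a \<and> Cauchy b \<and> lim a = lim b \<and> lim a > 0"
proof
  assume "\<exists>v>0. a \<longlonglongrightarrow> v \<and> b \<longlonglongrightarrow> v"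
  then obtain v where v: "v > 0" "a \<longlonglongrightarrow> v" "b \<longlonglongrightarrow> v"
    by blast
  then show "Cauchy a \<and> Cauchy b \<and> lim a = lim b \<and> lim a > 0"
    using limI[OF v(2)] limI[OF v(3)] LIMSEQ_imp_Cauchy by auto
next
  assume "Cauchy a \<and> Cauchy b \<and> lim a = lim b \<and> lim a > 0"
  then show "\<exists>v>0. a \<longlonglongrightarrow> v \<and> b \<longlonglongrightarrow> v"
    by (metis Cauchy_convergent convergent_LIMSEQ_iff)
qed

lemma sets_has_axis: "{z\<in>hplane. has_axis z} \<in> sets H"
proof -
  note [measurable] = measurable_ends measurable_hdist_pow
  define a where "a z n = hdist z ((F ^^ n) z) / real n" for z n
  define b where "b z n = hdist z ((FI ^^ n) z) / real n" for z n
  have [measurable]: "(\<lambda>z. a z n) \<in> borel_measurable H" "(\<lambda>z. b z n) \<in> borel_measurable H" for n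
    unfolding a_def b_def by measurable
  have [measurable]: "{z\<in>space H. Cauchy (a z)} \<in> sets H" "{z\<in>space H. Cauchy (b z)} \<in> sets H"
    by (intro sets_Collect_Cauchy; measurable)+
  have [measurable]: "(\<lambda>z. lim (a z)) \<in> borel_measurable H" "(\<lambda>z. lim (b z)) \<in> borel_measurable H"
    by (intro borel_measurable_lim_metric; measurable)+
  have speed: "(\<exists>v>0. has_rotation_speed S p f (p z) v) \<longleftrightarrow>
      Cauchy (a z) \<and> Cauchy (b z) \<and> lim (a z) = lim (b z) \<and> lim (a z) > 0" if "Im z > 0" for z
    unfolding has_rotation_speed_iff[OF that] common_limit_pos_iff[symmetric]
    by (simp add: a_def[abs_def] b_def[abs_def])
  have "{z\<in>hplane. has_axis z} = {z\<in>space H. Cauchy (a z)} \<inter> {z\<in>space H. Cauchy (b z)} \<inter>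
      {z\<in>space H. lim (a z) = lim (b z) \<and> lim (a z) > 0 \<and> mink (end_plus z) (end_minus z) \<noteq> 0}"
    unfolding has_axis_def using speed by (auto simp: space_restrict_space)
  also have "\<dots> \<in> sets H"
    by measurable
  finally show ?thesis .
qed

lemma tracked_subset: "tracked_points S p f \<subseteq> S"
  by (auto simp: tracked_points_def)

lemma sets_tracked_points: "tracked_points S p f \<in> sets (restrict_space borel S)"
proof (rule borel_if_preimage_borel[OF tracked_subset])
  have "{z\<in>hplane. p z \<in> tracked_points S p f} = {z\<in>hplane. has_axis z}"
    using tracked_points_iff by auto
  then show "{z\<in>hplane. p z \<in> tracked_points S p f} \<in> sets H"
    using sets_has_axis by simp
qed

text \<open>It is enough to test the generating open sets. Unwinding the pullback and the quotient
  topology, membership in such a set becomes the condition that the initial vector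
  \<open>V z\<close> lies in an open set of pairs of complex numbers, and \<open>V\<close> is a
  Borel function of the ends.\<close>

lemma measurable_normalized_geodesic:
  "normalized_geodesic \<in> measurable (restrict_space borel (tracked_points S p f)) (geodesic_borel S p)"
  unfolding geodesic_borel_def
proof (rule measurable_measure_of)
  let ?T = "tracked_points S p f"
  define V where "V z = (track_axis z 0, geo_velocity (end_scale z *\<^sub>R end_plus z) (end_scale z *\<^sub>R end_minus z))"
    for z
  have "topspace (geodesic_topology S p) \<subseteq> geodesics S"
    unfolding geodesic_topology_def topspace_pullback_topology by auto
  then show "{U. openin (geodesic_topology S p) U} \<subseteq> Pow (geodesics S)"
    using openin_subset by blast
  show "normalized_geodesic \<in> space (restrict_space borel ?T) \<rightarrow> geodesics S"
    using normalized_geodesic_iff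
    by (auto simp: space_restrict_space normalized_tracking_geodesic_def tracking_geodesic_def)
  fix U assume "U \<in> {U. openin (geodesic_topology S p) U}"
  then obtain U' where U': "openin (unit_tangent_topology p) U'" "U = initial_velocity p -` U' \<inter> geodesics S"
    unfolding geodesic_topology_def openin_pullback_topology by auto
  then obtain W where W: "open W" "unit_tangent_hplane \<inter> tangent_proj p -` U' = unit_tangent_hplane \<inter> W"
    unfolding openin_unit_tangent_topology openin_open by auto
  define A where "A = {x\<in>?T. normalized_geodesic x \<in> U}"
  have "p z \<in> A \<longleftrightarrow> has_axis z \<and> V z \<in> W" if z: "Im z > 0" for z
  proof (cases "has_axis z")
    case True
    then obtain v where geod: "hgeod (track_axis z) (end_scale z *\<^sub>R end_plus z) (end_scale z *\<^sub>R end_minus z)"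
      using has_axisE by blast
    \<comment> \<open>\<open>W\<close> and the preimage of \<open>U'\<close> agree only on the unit
      tangent bundle.\<close>
    have "V z \<in> unit_tangent_hplane"
      using geo_velocity_unit[OF geod] by (simp add: V_def)
    then have "tangent_proj p (V z) \<in> U' \<longleftrightarrow> V z \<in> W"
      using W(2) by blast
    moreover have "p z \<in> A \<longleftrightarrow> tangent_proj p (V z) \<in> U'"
      using tracked_points_iff[OF z] True initial_velocity_eq[OF geod] hgeod_projects_to_geodesic[OF geod]
      by (simp add: A_def U'(2) normalized_geodesic_p V_def)
    ultimately show ?thesis
      using True by simp
  qed (use tracked_points_iff[OF z] in \<open>simp add: A_def\<close>)
  then have "{z\<in>hplane. p z \<in> A} = {z\<in>hplane. has_axis z} \<inter> (V -` W \<inter> space H)"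
    by (auto simp: space_restrict_space)
  moreover have "V -` W \<inter> space H \<in> sets H"
    using measurable_velocity W(1) unfolding V_def[abs_def] by (intro measurable_sets[of _ _ borel]) auto
  ultimately have "A \<in> sets (restrict_space borel S)"
    using sets_has_axis tracked_subset by (intro borel_if_preimage_borel) (auto simp: A_def)
  then have "A \<in> sets borel"
    by (simp add: sets_borel_S)
  then have "A \<in> sets (restrict_space borel ?T)"
    using sets_tracked_points by (simp add: sets_borel_S sets_restrict_space_iff A_def)
  moreover have "normalized_geodesic -` U \<inter> space (restrict_space borel ?T) = A"
    by (auto simp: A_def space_restrict_space)
  ultimately show "normalized_geodesic -` U \<inter> space (restrict_space borel ?T) \<in> sets (restrict_space borel ?T)"
    by simp
qed

section \<open>Tracked points have full measure\<close>

lemma continuous_on_displacement: "continuous_on S (displacement p f n)"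
proof -
  obtain \<psi> :: "'a \<Rightarrow> real" where \<psi>: "continuous_on S \<psi>" "\<And>z. Im z > 0 \<Longrightarrow> \<psi> (p z) = hdist z ((F ^^ n) z)"
  proof (rule continuous_invariant_descends[of "\<lambda>z. hdist z ((F ^^ n) z)"])
    show "continuous_on hplane (\<lambda>z. hdist z ((F ^^ n) z))"
      using pow_hplane by (intro continuous_on_hdist continuous_on_id pow_cont) auto
    show "hdist (g z) ((F ^^ n) (g z)) = hdist z ((F ^^ n) z)" if "Im z > 0" "g \<in> deck_group p" for z g
      using that by (simp add: pow_deck deck_hdist pow_hplane)
  qed blast
  have "\<psi> x = displacement p f n x" if "x \<in> S" for x
    using \<psi>(2)[of "inv_into hplane p x"] displacement_p[of "inv_into hplane p x"] inv_into_p[OF that] by simp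
  with \<psi>(1) show ?thesis
    by (rule continuous_on_eq)
qed

text \<open>The distance between the n-th future and the n-th past of a lift, written as a
  displacement at a past point so that invariance of the measure applies to its integral.\<close>

definition past_future :: "nat \<Rightarrow> 'a \<Rightarrow> real"
  where "past_future n x = displacement p f (n + n) ((inv_into S f ^^ n) x)"

lemma past_future_p:
  assumes "Im z > 0"
  shows "past_future n (p z) = hdist ((F ^^ n) z) ((FI ^^ n) z)"
  using displacement_p[OF pow_hplane(2)[OF assms], of "n + n" n] assms
  by (simp add: past_future_def p_pow funpow_add F_pow_FI_pow hdist_commute)

lemma finv_pow_S: "x \<in> S \<Longrightarrow> (inv_into S f ^^ n) x \<in> S"
  by (induction n) (auto simp: finv_S)

lemma continuous_on_past_future: "continuous_on S (past_future n)"
proof -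
  have "continuous_on S (inv_into S f ^^ n)"
  proof (induction n)
    case (Suc n)
    have "continuous_on S (inv_into S f)"
      using f_homeo by (simp add: homeomorphism_def)
    from continuous_on_compose2[OF this Suc] show ?case
      using finv_pow_S by (auto simp: o_def)
  qed auto
  then show ?thesis
    unfolding past_future_def[abs_def]
    using finv_pow_S by (intro continuous_on_compose2[OF continuous_on_displacement]) auto
qed

text \<open>The dichotomy for the two half-orbits: distinct ends, the tracked case, give rate 2 v,
  and coincident ends give rate 0.\<close>

lemma past_future_limit:
  assumes x: "x \<in> S" and v: "v > 0" "has_rotation_speed S p f x v"
  shows "(\<lambda>n. past_future n x / (2 * real n)) \<longlonglongrightarrow> v * indicator (tracked_points S p f) x"
proof -
  obtain z where z: "Im z > 0" "p z = x"
    using inv_into_p[OF x] by blast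
  obtain C where "two_drifts z (\<lambda>n. (F ^^ n) z) (\<lambda>n. (FI ^^ n) z) v C C"
    using rotation_speed_two_drifts[OF z(1) v(1)] v(2) z(2) by blast
  then interpret two_drifts z "\<lambda>n. (F ^^ n) z" "\<lambda>n. (FI ^^ n) z" v C C .
  have iff: "x \<in> tracked_points S p f \<longleftrightarrow> X.N \<noteq> Y.N"
    using tracked_points_iff[OF z(1)] z v
    unfolding ends_eq_iff by (auto simp: has_axis_def X.N_def Y.N_def end_plus_def end_minus_def)
  have "(\<lambda>n. hdist ((F ^^ n) z) ((FI ^^ n) z) / real n) \<longlonglongrightarrow> 2 * (v * indicator (tracked_points S p f) x)"
    using same_end_imp_sublinear ends_neq_imp_apart iff by (cases "X.N = Y.N") auto
  from tendsto_divide[OF this tendsto_const[of 2]] show ?thesis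
    using past_future_p[OF z(1)] z(2) by (simp add: mult.commute)
qed

text \<open>Two dominated sequences with equal integrals converge almost everywhere, one to v and
  the other to v times the indicator of the tracked set. Comparing the integrals of the limits and
  cancelling v > 0 gives measure 1.\<close>

lemma tracked_points_full_measure:
  assumes \<mu>: "\<mu> \<in> ergodic_measures_pos S p f"
  shows "emeasure \<mu> (tracked_points S p f) = 1"
proof -
  let ?T = "tracked_points S p f"
  have sets: "sets \<mu> = sets (restrict_space borel S)" and "prob_space \<mu>" and inv: "distr \<mu> \<mu> f = \<mu>"
    using \<mu> unfolding ergodic_measures_pos_def ergodic_measures_def by auto
  obtain v where v: "v > 0" "AE x in \<mu>. has_rotation_speed S p f x v"
    using \<mu> unfolding ergodic_measures_pos_def by blast
  interpret prob_space \<mu> by fact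
  have space: "space \<mu> = S"
    using sets_eq_imp_space_eq[OF sets] by (simp add: space_restrict_space)
  have meas: "g \<in> borel_measurable \<mu>" if "continuous_on S g" for g :: "'a \<Rightarrow> real"
    using borel_measurable_continuous_on_restrict[OF that] by (simp add: measurable_cong_sets[OF sets refl])
  have T: "?T \<in> sets \<mu>"
    using sets_tracked_points sets by simp
  have f_meas: "f \<in> measurable \<mu> \<mu>"
  proof -
    have "f \<in> measurable (restrict_space borel S) (restrict_space borel S)"
      using f_S by (intro measurable_restrict_space2 borel_measurable_continuous_on_restrict f_cont)
        (auto simp: space_restrict_space)
    then show ?thesis
      by (simp add: measurable_cong_sets[OF sets sets])
  qed
  have pow_meas: "f ^^ n \<in> measurable \<mu> \<mu>" for n
    using measurable_compose_n[OF f_meas] by simp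
  have pow_inv: "distr \<mu> \<mu> (f ^^ n) = \<mu>" for n
  proof (induction n)
    case (Suc n)
    have "distr \<mu> \<mu> (f ^^ Suc n) = distr (distr \<mu> \<mu> (f ^^ n)) \<mu> f"
      using distr_distr[OF f_meas pow_meas[of n]] by simp
    then show ?case
      by (simp only: Suc inv)
  qed (simp add: distr_id2 id_def)
  obtain C where C: "C \<ge> 0" "\<And>z n. Im z > 0 \<Longrightarrow> hdist z ((F ^^ n) z) \<le> C * real n"
    using displacement_le by blast
  have bound: "\<bar>displacement p f (n + n) x / (2 * real n)\<bar> \<le> C" if "x \<in> S" for x n
  proof -
    define z where "z = inv_into hplane p x"
    have z: "Im z > 0" "p z = x"
      using inv_into_p[OF that] by (simp_all add: z_def)
    have "0 \<le> displacement p f (n + n) x" "displacement p f (n + n) x \<le> C * (2 * real n)"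
      using displacement_p[OF z(1), of "n + n"] z C(2)[OF z(1), of "n + n"] pow_hplane(1)[OF z(1)]
      by (auto intro: hdist_nonneg simp del: funpow_add)
    \<comment> \<open>For n = 0 the quotient is 0 by the convention on division by zero, which is
      covered by C being nonnegative.\<close>
    then show ?thesis
      using C(1) by (cases "n = 0") (simp_all add: abs_le_iff field_simps)
  qed
  have integral_eq: "(\<integral>x. past_future n x / (2 * real n) \<partial>\<mu>) = (\<integral>x. displacement p f (n + n) x / (2 * real n) \<partial>\<mu>)" for n
  proof -
    have m: "(\<lambda>x. past_future n x / (2 * real n)) \<in> borel_measurable \<mu>"
      by (cases "n = 0") (auto intro!: meas continuous_on_divide continuous_on_past_future continuous_on_const)
    \<comment> \<open>Invariance allows the n-th iterate of f to be inserted under the integral,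
      where it cancels the backward iterate in \<open>past_future\<close>.\<close>
    have "(\<integral>x. past_future n x / (2 * real n) \<partial>\<mu>) = (\<integral>x. past_future n x / (2 * real n) \<partial>(distr \<mu> \<mu> (f ^^ n)))"
      by (simp add: pow_inv)
    also have "\<dots> = (\<integral>x. past_future n ((f ^^ n) x) / (2 * real n) \<partial>\<mu>)"
      by (rule integral_distr[OF pow_meas m])
    also have "\<dots> = (\<integral>x. displacement p f (n + n) x / (2 * real n) \<partial>\<mu>)"
    proof (rule Bochner_Integration.integral_cong[OF refl])
      fix x assume "x \<in> space \<mu>"
      then have "x \<in> S"
        by (simp add: space)
      have "(inv_into S f ^^ n) ((f ^^ n) x) = x"
      proof (induction n)
        case (Suc n)
        have "(f ^^ n) x \<in> S"
          using \<open>x \<in> S\<close> by (induction n) (auto simp: f_S)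
        moreover have "(inv_into S f ^^ Suc n) ((f ^^ Suc n) x) = (inv_into S f ^^ n) (inv_into S f (f ((f ^^ n) x)))"
          by (subst funpow_Suc_right) simp
        ultimately show ?case
          using Suc by (simp add: finv_f)
      qed simp
      then show "past_future n ((f ^^ n) x) / (2 * real n) = displacement p f (n + n) x / (2 * real n)"
        by (simp add: past_future_def)
    qed
    finally show ?thesis .
  qed
  have "(\<lambda>n. \<integral>x. displacement p f (n + n) x / (2 * real n) \<partial>\<mu>) \<longlonglongrightarrow> (\<integral>x. v \<partial>\<mu>)"
  proof (rule integral_dominated_convergence[where w = "\<lambda>_. C"])
    show "(\<lambda>x. displacement p f (n + n) x / (2 * real n)) \<in> borel_measurable \<mu>" for n
      by (cases "n = 0") (auto intro!: meas continuous_on_divide continuous_on_displacement continuous_on_const)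
    show "AE x in \<mu>. (\<lambda>n. displacement p f (n + n) x / (2 * real n)) \<longlonglongrightarrow> v"
      using v(2)
    proof eventually_elim
      case (elim x)
      then have "(\<lambda>n. displacement p f n x / real n) \<longlonglongrightarrow> v"
        by (simp add: has_rotation_speed_def)
      moreover have "strict_mono (\<lambda>n::nat. n + n)"
        by (simp add: strict_mono_def)
      ultimately have "((\<lambda>n. displacement p f n x / real n) \<circ> (\<lambda>n. n + n)) \<longlonglongrightarrow> v"
        by (rule LIMSEQ_subseq_LIMSEQ)
      then show ?case
        unfolding o_def of_nat_add mult_2 .
    qed
  qed (use bound space in \<open>auto intro!: AE_I2\<close>)
  moreover have "(\<lambda>n. \<integral>x. past_future n x / (2 * real n) \<partial>\<mu>) \<longlonglongrightarrow> (\<integral>x. v * indicator ?T x \<partial>\<mu>)"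
  proof (rule integral_dominated_convergence[where w = "\<lambda>_. C"])
    show "(\<lambda>x. past_future n x / (2 * real n)) \<in> borel_measurable \<mu>" for n
      by (cases "n = 0") (auto intro!: meas continuous_on_divide continuous_on_past_future continuous_on_const)
    show "(\<lambda>x. v * indicator ?T x) \<in> borel_measurable \<mu>"
      using T by measurable
    show "AE x in \<mu>. (\<lambda>n. past_future n x / (2 * real n)) \<longlonglongrightarrow> v * indicator ?T x"
      using v(2) AE_space by eventually_elim (use past_future_limit v(1) space in auto)
    show "AE x in \<mu>. norm (past_future n x / (2 * real n)) \<le> C" for n
      using bound finv_pow_S by (intro AE_I2) (simp add: space past_future_def)
  qed simp
  ultimately have "(\<integral>x. v \<partial>\<mu>) = (\<integral>x. v * indicator ?T x \<partial>\<mu>)"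
    unfolding integral_eq by (rule LIMSEQ_unique)
  then have "v = v * measure \<mu> ?T"
    using T prob_space by (auto simp: space tracked_subset Int_absorb2)
  then have "measure \<mu> ?T = 1"
    using v(1) by simp
  then show ?thesis
    by (simp add: emeasure_eq_measure)
qed

end

theorem theorem2:
  fixes S :: "'a::metric_space set" and p :: "complex \<Rightarrow> 'a" and f :: "'a \<Rightarrow> 'a"
  assumes "closed_orientable_hyperbolic_surface S p"
    and "f \<in> Homeo\<^sub>0 S"
  shows "tracked_points S p f \<in> sets (restrict_space borel S) \<and>
    (\<forall>\<mu> \<in> ergodic_measures_pos S p f. emeasure \<mu> (tracked_points S p f) = 1) \<and>
    (\<exists>G. G \<in> measurable (restrict_space borel (tracked_points S p f)) (geodesic_borel S p) \<and>
         (\<forall>x \<in> tracked_points S p f. \<forall>\<gamma>. normalized_tracking_geodesic S p f x \<gamma> \<longleftrightarrow> \<gamma> = G x))"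
proof -
  interpret surface_homeo S p f
    using assms by unfold_locales
  show ?thesis
    using sets_tracked_points tracked_points_full_measure measurable_normalized_geodesic
      normalized_geodesic_iff by blast
qed

end
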